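(* The following statements hold. (1) For any $Z\in\Omega_0$ and any small neighborhood $\mathcal N\subset\Omega$ of $Z$, there exists a vector field in $\mathcal N$ having a crossing limit cycle bifurcating from the non-smooth equilibrium $O$ of $Z$. (2) There exists a $Z_0\in\Omega_1$ (resp. there exists a $Z_0\in\Omega_0\setminus\Omega_1$) such that, for any $m\in\mathbb N^+\cup\{\infty\}$ and any small neighborhood $\mathcal N\subset\Omega$ of $Z_0$, there exists a vector field in $\mathcal N$ having exactly $m$ hyperbolic crossing limit cycles bifurcating from the non-smooth equilibrium $O$ of $Z_0$ (for $m=\infty$: infinitely many).
   Context: Let $\mathcal U\subset\mathbb R^2$ be a bounded open set containing the origin $O$, and let $\mathfrak X$ be the set of $\mathcal C^1$ vector fields on $\mathcal U$ with the $\mathcal C^1$-topology. Put $\Sigma^+=\{(x,y)\in\mathcal U:y>0\}$, $\Sigma^-=\{(x,y)\in\mathcal U:y<0\}$, $\Sigma=\{(x,y)\in\mathcal U:y=0\}$ (the switching line). $\Omega$ is the set of piecewise smooth vector fields $Z=(X,Y)$, with $X=(X_1,X_2)$, $Y=(Y_1,Y_2)\in\mathfrak X$, given by $Z=X$ on $\Sigma^+$ and $Z=Y$ on $\Sigma^-$, with the product topology. On $\Sigma$, $Z$ is defined to be $Z_\Sigma$ by the Filippov convention. If $X\equiv Y$ on $\Sigma$, then $Z_\Sigma=X=Y$. Otherwise: on the crossing set $\Sigma^c=\{p\in\Sigma:X_2(p)Y_2(p)>0\}$ (whose points are the crossing points), $Z_\Sigma=X$ if $X_2>0$ and $Z_\Sigma=Y$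 if $X_2<0$ (orbits cross $\Sigma$ there); on the sliding set $\Sigma^s=\{p\in\Sigma:X_2(p)Y_2(p)\le0\}$, $Z_\Sigma=\left(\frac{Y_2X_1-X_2Y_1}{Y_2-X_2},0\right)$ if $X_2\ne Y_2$, and $Z_\Sigma=(0,0)$ if $X_2=Y_2=0$. Orbits of $Z$ are obtained by concatenating orbits of $X$ in $\Sigma^+$, $Y$ in $\Sigma^-$ and $Z_\Sigma$ in $\Sigma$. A non-smooth equilibrium of $Z$ is a point of $\Sigma$ at which $Z_\Sigma$ vanishes. $\Omega_0\subset\Omega$ is the set of $Z=(X,Y)$ with $X(0,0)=Y(0,0)=(0,0)$, $\det A^+\det A^-\neq0$ and $X_{2x}(0,0)\,Y_{2x}(0,0)>0$, where $A^+$ (resp. $A^-$) is the Jacobian matrix of $X$ (resp. $Y$) at $O$ and the subscript $x$ denotes the partial derivative in $x$. Let $\lambda_1^\pm,\lambda_2^\pm$ be the eigenvalues of $A^\pm$. Then $\Omega_1=\{Z\in\Omega_0:\lambda_1^+\ne\lambda_2^+,\ \lambda_1^-\ne\lambda_2^-,\ \ell\ne0\}$, where $\ell=\frac{\mathrm{Re}\lambda_1^+}{|\mathrm{Im}\lambda_1^+|}+\frac{\mathrm{Re}\lambda_1^-}{|\mathrm{Im}\lambda_1^-|}$ if $\mathrm{Im}\lambda_1^+\,\mathrm{Im}\lambda_1^-\ne0$, and $\ell=1$ if $\mathrm{Im}\lambda_1^+\,\mathrm{Im}\lambda_1^-=0$. A crossing limit cycle is a limit cycle (isolated periodic orbit)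 that intersects $\Sigma$ only at crossing points. It is hyperbolic if the derivative of its Poincaré return map at the corresponding fixed point is different from $1$ in absolute value. "Bifurcating from $O$" has its usual meaning: the limit cycles of the perturbed vector field are born from $O$, i.e. they shrink to $O$ as the perturbed vector field tends to the unperturbed one (so the perturbed vector field in $\mathcal N$ can be chosen with these limit cycles contained in any prescribed neighborhood of $O$). *)

theory Defs
  imports "HOL-Analysis.Analysis"
begin

type_synonym vfield = "real^2 \<Rightarrow> real^2"

text \<open>A pair \<open>(X, Y)\<close> stands for the field equal to \<open>X\<close> above and to \<open>Y\<close> below the
  switching line. Fields are total functions, but every notion below only depends on their
  values in \<open>U\<close>.\<close>

type_synonym pwfield = "vfield \<times> vfield"

definition C1_fields :: "(real^2) set \<Rightarrow> vfield set" where
  "C1_fields U = {X. X differentiable_on U \<and> continuous_on U (\<lambda>p. jacobian X (at p))}"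

text \<open>The distance is infinite for two fields whose difference is unbounded in \<open>C\<^sup>1\<close> on \<open>U\<close>;
  the topology is that of uniform convergence on \<open>U\<close> of the field and its first derivatives.\<close>

definition C1_dist :: "(real^2) set \<Rightarrow> vfield \<Rightarrow> vfield \<Rightarrow> ereal" where
  "C1_dist U X Y =
     (SUP p\<in>U. ereal (norm (X p - Y p) + norm (jacobian X (at p) - jacobian Y (at p))))"

definition C1_topology :: "(real^2) set \<Rightarrow> vfield topology" where
  "C1_topology U = topology_generated_by
     {{Y \<in> C1_fields U. C1_dist U X Y < ereal e} | X e. X \<in> C1_fields U \<and> e > 0}"

definition Omega :: "(real^2) set \<Rightarrow> pwfield set" where
  "Omega U = C1_fields U \<times> C1_fields U"

definition Omega_topology :: "(real^2) set \<Rightarrow> pwfield topology" where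
  "Omega_topology U = prod_topology (C1_topology U) (C1_topology U)"

definition Omega_nbhd :: "(real^2) set \<Rightarrow> pwfield \<Rightarrow> pwfield set \<Rightarrow> bool" where
  "Omega_nbhd U Z N \<longleftrightarrow>
     N \<subseteq> Omega U \<and> (\<exists>V. openin (Omega_topology U) V \<and> Z \<in> V \<and> V \<subseteq> N)"

definition upper_part :: "(real^2) set \<Rightarrow> (real^2) set" where
  "upper_part U = {p \<in> U. p $ 2 > 0}"

definition lower_part :: "(real^2) set \<Rightarrow> (real^2) set" where
  "lower_part U = {p \<in> U. p $ 2 < 0}"

definition switching_line :: "(real^2) set \<Rightarrow> (real^2) set" where
  "switching_line U = {p \<in> U. p $ 2 = 0}"

definition crossing_set :: "(real^2) set \<Rightarrow> pwfield \<Rightarrow> (real^2) set" where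
  "crossing_set U Z = {p \<in> switching_line U. fst Z p $ 2 * snd Z p $ 2 > 0}"

text \<open>The Filippov convention on the switching line. In the last case both normal components
  vanish.\<close>

definition filippov :: "(real^2) set \<Rightarrow> pwfield \<Rightarrow> vfield" where
  "filippov U Z p =
     (let X = fst Z; Y = snd Z in
      if \<forall>q\<in>switching_line U. X q = Y q then X p
      else if X p $ 2 * Y p $ 2 > 0 then (if X p $ 2 > 0 then X p else Y p)
      else if X p $ 2 \<noteq> Y p $ 2
        then vector [(Y p $ 2 * X p $ 1 - X p $ 2 * Y p $ 1) / (Y p $ 2 - X p $ 2), 0]
      else 0)"

definition nonsmooth_equilibrium :: "(real^2) set \<Rightarrow> pwfield \<Rightarrow> real^2 \<Rightarrow> bool" where
  "nonsmooth_equilibrium U Z p \<longleftrightarrow> p \<in> switching_line U \<and> filippov U Z p = 0"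

definition Omega0 :: "(real^2) set \<Rightarrow> pwfield set" where
  "Omega0 U = {(X, Y) \<in> Omega U. X 0 = 0 \<and> Y 0 = 0 \<and>
     det (jacobian X (at 0)) * det (jacobian Y (at 0)) \<noteq> 0 \<and>
     jacobian X (at 0) $ 2 $ 1 * jacobian Y (at 0) $ 2 $ 1 > 0}"

text \<open>\<open>l1\<close> and \<open>l2\<close> are the complex eigenvalues of \<open>A\<close>, repeated according to their
  algebraic multiplicity.\<close>

definition eigenvalues :: "real^2^2 \<Rightarrow> complex \<Rightarrow> complex \<Rightarrow> bool" where
  "eigenvalues A l1 l2 \<longleftrightarrow>
     (\<forall>z. det (mat z - (\<chi> i j. complex_of_real (A $ i $ j))) = (z - l1) * (z - l2))"

definition ell :: "complex \<Rightarrow> complex \<Rightarrow> real" where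
  "ell lp lm = (if Im lp * Im lm \<noteq> 0 then Re lp / \<bar>Im lp\<bar> + Re lm / \<bar>Im lm\<bar> else 1)"

text \<open>The labelling of the eigenvalues is immaterial: non-real ones are conjugate.\<close>

definition Omega1 :: "(real^2) set \<Rightarrow> pwfield set" where
  "Omega1 U = {(X, Y) \<in> Omega0 U. \<exists>lp1 lp2 lm1 lm2.
     eigenvalues (jacobian X (at 0)) lp1 lp2 \<and> eigenvalues (jacobian Y (at 0)) lm1 lm2 \<and>
     lp1 \<noteq> lp2 \<and> lm1 \<noteq> lm2 \<and> ell lp1 lm1 \<noteq> 0}"

definition solves_in :: "(real^2) set \<Rightarrow> vfield \<Rightarrow> (real \<Rightarrow> real^2) \<Rightarrow> real set \<Rightarrow> bool" where
  "solves_in D F g J \<longleftrightarrow>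
     (\<forall>t\<in>J. g t \<in> D \<and> (g has_vector_derivative F (g t)) (at t))"

text \<open>Orbits of the piecewise smooth field over a time interval \<open>I\<close>: the switching times \<open>B\<close>
  are locally finite, and between them \<open>g\<close> is an orbit of one of the three fields.\<close>

definition pw_orbit :: "(real^2) set \<Rightarrow> pwfield \<Rightarrow> real set \<Rightarrow> (real \<Rightarrow> real^2) \<Rightarrow> bool" where
  "pw_orbit U Z I g \<longleftrightarrow> continuous_on I g \<and> g ` I \<subseteq> U \<and>
     (\<exists>B. (\<forall>a b. finite (B \<inter> {a..b})) \<and>
       (\<forall>s t. s < t \<and> {s<..<t} \<subseteq> I \<and> {s<..<t} \<inter> B = {} \<longrightarrow>
          solves_in (upper_part U) (fst Z) g {s<..<t} \<or>
          solves_in (lower_part U) (snd Z) g {s<..<t} \<or>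
          solves_in (switching_line U) (filippov U Z) g {s<..<t}))"

definition periodic_orbit :: "(real^2) set \<Rightarrow> pwfield \<Rightarrow> (real^2) set \<Rightarrow> bool" where
  "periodic_orbit U Z C \<longleftrightarrow>
     (\<exists>g T. pw_orbit U Z UNIV g \<and> T > 0 \<and> (\<forall>t. g (t + T) = g t) \<and>
        (\<exists>t. g t \<noteq> g 0) \<and> C = range g)"

definition limit_cycle :: "(real^2) set \<Rightarrow> pwfield \<Rightarrow> (real^2) set \<Rightarrow> bool" where
  "limit_cycle U Z C \<longleftrightarrow> periodic_orbit U Z C \<and>
     (\<exists>V. open V \<and> C \<subseteq> V \<and> (\<forall>C'. periodic_orbit U Z C' \<and> C' \<subseteq> V \<longrightarrow> C' = C))"

definition crossing_limit_cycle :: "(real^2) set \<Rightarrow> pwfield \<Rightarrow> (real^2) set \<Rightarrow> bool" where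
  "crossing_limit_cycle U Z C \<longleftrightarrow> limit_cycle U Z C \<and>
     C \<inter> switching_line U \<noteq> {} \<and> C \<inter> switching_line U \<subseteq> crossing_set U Z"

definition first_return ::
  "(real^2) set \<Rightarrow> pwfield \<Rightarrow> (real^2) set \<Rightarrow> real^2 \<Rightarrow> real^2 \<Rightarrow> bool" where
  "first_return U Z S p q \<longleftrightarrow> q \<in> S \<and>
     (\<exists>g T. T > 0 \<and> pw_orbit U Z {0..T} g \<and> g 0 = p \<and> g T = q \<and> (\<forall>t\<in>{0<..<T}. g t \<notin> S))"

text \<open>\<open>P\<close>, in the coordinate \<open>x\<close> of the switching line, is near its fixed point \<open>x0\<close> the
  Poincare return map of the section formed by the points of the line at distance less than \<open>r\<close>
  from \<open>(x0, 0)\<close>. Near a crossing limit cycle orbits are unique, and the section at another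
  crossing point gives a conjugate map, with the same derivative at the fixed point.\<close>

definition poincare_map ::
  "(real^2) set \<Rightarrow> pwfield \<Rightarrow> real \<Rightarrow> real \<Rightarrow> (real \<Rightarrow> real) \<Rightarrow> bool" where
  "poincare_map U Z x0 r P \<longleftrightarrow> r > 0 \<and> P x0 = x0 \<and>
     (\<exists>e>0. \<forall>x. \<bar>x - x0\<bar> < e \<longrightarrow>
        first_return U Z {vector [s, 0] | s. \<bar>s - x0\<bar> < r} (vector [x, 0]) (vector [P x, 0]))"

definition hyperbolic_clc :: "(real^2) set \<Rightarrow> pwfield \<Rightarrow> (real^2) set \<Rightarrow> bool" where
  "hyperbolic_clc U Z C \<longleftrightarrow> crossing_limit_cycle U Z C \<and>
     (\<exists>x0 r P D. vector [x0, 0] \<in> C \<and> poincare_map U Z x0 r P \<and>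
        (P has_real_derivative D) (at x0) \<and> \<bar>D\<bar> \<noteq> 1)"

definition ecard :: "'a set \<Rightarrow> enat" where
  "ecard S = (if finite S then enat (card S) else \<infinity>)"

definition bifurcates_clc :: "(real^2) set \<Rightarrow> pwfield \<Rightarrow> bool" where
  "bifurcates_clc U Z \<longleftrightarrow> nonsmooth_equilibrium U Z 0 \<and>
     (\<forall>N W. Omega_nbhd U Z N \<and> open W \<and> 0 \<in> W \<longrightarrow>
        (\<exists>Z'\<in>N. \<exists>C. crossing_limit_cycle U Z' C \<and> C \<subseteq> W))"

text \<open>The cycles counted are those in a neighbourhood \<open>V\<close> of the origin fixed before the
  perturbation, and all of them lie in the prescribed \<open>W\<close>: so exactly \<open>m\<close> cycles shrink to the
  origin, and none is left uncounted because it lies in \<open>V - W\<close>.\<close>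

definition bifurcates_exactly_hyperbolic :: "(real^2) set \<Rightarrow> pwfield \<Rightarrow> enat \<Rightarrow> bool" where
  "bifurcates_exactly_hyperbolic U Z m \<longleftrightarrow> nonsmooth_equilibrium U Z 0 \<and>
     (\<exists>V. open V \<and> 0 \<in> V \<and>
       (\<forall>N W. Omega_nbhd U Z N \<and> open W \<and> 0 \<in> W \<longrightarrow>
         (\<exists>Z'\<in>N. ecard {C. crossing_limit_cycle U Z' C \<and> C \<subseteq> V} = m \<and>
            (\<forall>C. crossing_limit_cycle U Z' C \<and> C \<subseteq> V \<longrightarrow> hyperbolic_clc U Z' C \<and> C \<subseteq> W))))"

end

theory Submission
  imports Defs
begin

text \<open>A translation by an arbitrarily small \<open>e\<close> makes the origin an invisible fold of both fields.
  In a small ball the upper field can then be taken to be a positive multiple of the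
  Hamiltonian field of \<open>H(x, y) = f(x) + (e + a x) y + sg y^2 / 2\<close>, and likewise, after \<open>p \<mapsto> -p\<close>,
  the lower one: \<open>a\<close> and the positive factor absorb the linear part, and the remainder is
  quadratic, hence small in \<open>C\<^sup>1\<close> once cut off to a small ball. On the line \<open>H\<close> equals \<open>f\<close>, so an
  upper arc joins \<open>(x, 0)\<close> to \<open>(x', 0)\<close> with \<open>f x' = f x\<close>. Taking \<open>f(x) = b (x^2 / 2 + k(x))\<close> above,
  where \<open>k\<close> vanishes for \<open>x \<le> 0\<close>, and \<open>f(x) = b' x^2 / 2\<close> below, the return map is
  \<open>P(x) = sqrt (x^2 + 2 k(x))\<close>. Its fixed points are the positive zeros of \<open>k\<close>, hyperbolic when
  simple, and \<open>k\<close> can be any function that is small in \<open>C\<^sup>2\<close>.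
  For the linear saddle and the linear center the perturbed fields have this form with no cutoff,
  so that all cycles near the origin are counted.\<close>

subsection \<open>A perturbation with prescribed number of zeros\<close>

text \<open>The return map has to be known exactly: zeros of \<open>k\<close> that accumulate at 0
  would not survive even a small error term. The first integral provides this, and it also replaces
  uniqueness of orbits: between two crossings an orbit traces a whole level arc, however it is
  parametrised, so an arbitrary periodic orbit can be identified with a constructed cycle. This
  matters because a limit cycle must be isolated among all periodic orbits, sliding ones included.
  The sign condition on the two x-derivatives says that both fields cross the line in the same
  direction on each side of the origin; the opposite translations then send upper orbits one way and
  lower orbits back. For a general field the translation \<open>e\<close> is fixed first, then the
  cutoff radii and \<open>R\<close>, then the bound \<open>d\<close> on the zeros of
  \<open>k\<close>, and last the amplitude of \<open>k\<close>. For the linear saddle and center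
  \<open>a = 0\<close> and \<open>s = 1\<close>, so \<open>R\<close> is independent of
  \<open>e\<close> and can be fixed before the perturbation, as exact counting demands.\<close>

lemma glued_derivative_at_0:
  fixes G :: "real \<Rightarrow> real"
  assumes "\<And>x. 0 < x \<Longrightarrow> x \<le> 1 \<Longrightarrow> \<bar>G x\<bar> \<le> M * x\<^sup>2" "M \<ge> 0"
  shows "((\<lambda>x. if x \<le> 0 then 0 else G x) has_real_derivative 0) (at 0)"
proof -
  have "((\<lambda>y. (if y \<le> 0 then 0 else G y) / y) \<longlongrightarrow> 0) (at 0)"
  proof (rule Lim_null_comparison)
    show "\<forall>\<^sub>F y in at 0. norm ((if y \<le> 0 then 0 else G y) / y) \<le> M * \<bar>y\<bar>"
      unfolding eventually_at
    proof (intro exI[of _ 1] conjI ballI impI)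
      fix y :: real assume y: "y \<noteq> 0 \<and> dist y 0 < 1"
      show "norm ((if y \<le> 0 then 0 else G y) / y) \<le> M * \<bar>y\<bar>"
      proof (cases "y \<le> 0")
        case False
        then have "\<bar>G y\<bar> \<le> M * y * y" using assms(1)[of y] y by (simp add: dist_real_def power2_eq_square)
        then show ?thesis using False by (simp add: divide_le_eq)
      qed (use assms(2) in \<open>simp add: mult_nonneg_nonpos\<close>)
    qed simp
    show "((\<lambda>y. M * \<bar>y\<bar>) \<longlongrightarrow> 0) (at 0)" by (auto intro!: tendsto_eq_intros)
  qed
  then show ?thesis by (simp add: has_field_derivative_iff)
qed

text \<open>The quadratic bound makes the difference quotient at 0 tend to 0, so gluing with zero on
  the left costs no smoothness.\<close>

lemma glued_derivative:
  fixes G G1 :: "real \<Rightarrow> real"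
  assumes "\<And>x. 0 < x \<Longrightarrow> x \<le> 1 \<Longrightarrow> \<bar>G x\<bar> \<le> M * x\<^sup>2" "M \<ge> 0"
    and "\<And>x. 0 < x \<Longrightarrow> (G has_real_derivative G1 x) (at x)"
  shows "((\<lambda>x. if x \<le> 0 then 0 else G x) has_real_derivative (if x \<le> 0 then 0 else G1 x)) (at x)"
proof -
  consider "x = 0" | "x < 0" | "x > 0" by linarith
  then show ?thesis
  proof cases
    case 1
    then show ?thesis using glued_derivative_at_0[OF assms(1,2)] by simp
  next
    case 2
    have "((\<lambda>x. if x \<le> 0 then 0 else G x) has_real_derivative 0) (at x)"
      by (rule has_field_derivative_transform_within_open[OF DERIV_const[of 0], where S = "{..<0}"])
         (use 2 in auto)
    then show ?thesis using 2 by simp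
  next
    case 3
    have "((\<lambda>x. if x \<le> 0 then 0 else G x) has_real_derivative G1 x) (at x)"
      by (rule has_field_derivative_transform_within_open[OF assms(3)[OF 3], where S = "{0<..}"])
         (use 3 in auto)
    then show ?thesis using 3 by simp
  qed
qed

lemma sin_reciprocal_zeros:
  fixes c d :: real
  assumes "c \<ge> 0" "d > 0" "x > 0"
  shows "sin (d / (x + c)) = 0 \<longleftrightarrow> (\<exists>n::nat. 1 \<le> n \<and> x = d / (real n * pi) - c)"
proof
  assume "sin (d / (x + c)) = 0"
  then obtain n :: int where n: "d / (x + c) = n * pi" unfolding sin_zero_iff_int2 by blast
  have "d / (x + c) > 0" using assms by simp
  then have "of_int n * pi > 0" using n by simp
  then have "n > 0" by (simp add: zero_less_mult_iff)
  then obtain j where j: "n = int j" "j \<ge> 1" by (metis One_nat_def Suc_leI zero_less_imp_eq_int)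
  have "x + c = d / (j * pi)" using n j assms by (simp add: field_simps)
  then show "\<exists>n::nat. 1 \<le> n \<and> x = d / (real n * pi) - c" using j by (intro exI[of _ j]) auto
next
  assume "\<exists>n::nat. 1 \<le> n \<and> x = d / (real n * pi) - c"
  then obtain n :: nat where n: "n \<ge> 1" "x = d / (real n * pi) - c" by blast
  then have "d / (x + c) = n * pi" using assms by simp
  then show "sin (d / (x + c)) = 0" by simp
qed

lemma ecard_sin_reciprocal_zeros:
  fixes m :: enat and d :: real
  assumes "m \<noteq> 0" "d > 0"
  obtains c where "c \<ge> 0" "ecard {x. 0 < x \<and> sin (d / (x + c)) = 0} = m"
proof -
  define z where "z c n = d / (real n * pi) - c" for c and n :: nat
  have inj: "inj_on (z c) {1..}" for c
  proof (rule inj_onI)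
    have "real n * pi = d / (z c n + c)" for n using assms(2) by (simp add: z_def)
    moreover fix x y assume "z c x = z c y"
    ultimately have "real x * pi = real y * pi" by metis
    then show "x = y" by simp
  qed
  have eq: "{x. 0 < x \<and> sin (d / (x + c)) = 0} = z c ` {n. n \<ge> 1 \<and> z c n > 0}" if "c \<ge> 0" for c
  proof (intro equalityI subsetI)
    fix x assume "x \<in> {x. 0 < x \<and> sin (d / (x + c)) = 0}"
    then have x: "x > 0" "sin (d / (x + c)) = 0" by auto
    from iffD1[OF sin_reciprocal_zeros[OF \<open>c \<ge> 0\<close> assms(2) x(1)] x(2)]
    obtain n :: nat where "n \<ge> 1" "x = z c n" unfolding z_def by blast
    then show "x \<in> z c ` {n. n \<ge> 1 \<and> z c n > 0}" using x(1) by blast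
  next
    fix x assume "x \<in> z c ` {n. n \<ge> 1 \<and> z c n > 0}"
    then obtain n where n: "n \<ge> 1" "x = z c n" "x > 0" by blast
    then have "\<exists>n::nat. 1 \<le> n \<and> x = d / (real n * pi) - c" unfolding z_def by blast
    from iffD2[OF sin_reciprocal_zeros[OF \<open>c \<ge> 0\<close> assms(2) n(3)] this] n(3)
    show "x \<in> {x. 0 < x \<and> sin (d / (x + c)) = 0}" by blast
  qed
  show ?thesis
  proof (cases m)
    case (enat j)
    define c where "c = d / ((j + 1) * pi)"
    have c: "c \<ge> 0" using assms(2) by (simp add: c_def)
    have "z c n > 0 \<longleftrightarrow> n \<le> j" if "n \<ge> 1" for n
    proof -
      have "z c n > 0 \<longleftrightarrow> d / ((j + 1) * pi) < d / (real n * pi)" by (simp add: z_def c_def)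
      also have "\<dots> \<longleftrightarrow> real n * pi < real (j + 1) * pi"
        unfolding divide_inverse mult_less_cancel_left_pos[OF assms(2)]
        using that by (intro inverse_less_iff_less) auto
      also have "\<dots> \<longleftrightarrow> n < j + 1" by (simp only: of_nat_less_iff mult_less_cancel_right_pos[OF pi_gt_zero])
      finally show ?thesis by auto
    qed
    then have "{n. n \<ge> 1 \<and> z c n > 0} = {1..j}" by auto
    then have "ecard {x. 0 < x \<and> sin (d / (x + c)) = 0} = enat (card (z c ` {1..j}))"
      by (simp add: eq[OF c] ecard_def)
    also have "card (z c ` {1..j}) = j"
      using card_image[OF inj_on_subset[OF inj[of c], of "{1..j}"]] by auto
    finally show ?thesis using that[OF c] enat by simp
  next
    case infinity
    have "{n. n \<ge> 1 \<and> z 0 n > 0} = {1..}" using assms(2) by (auto simp: z_def)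
    moreover have "infinite (z 0 ` {1..})" using inj[of 0] by (simp add: finite_image_iff infinite_Ici)
    ultimately have "ecard {x. 0 < x \<and> sin (d / (x + 0)) = 0} = \<infinity>"
      unfolding eq[OF order_refl] ecard_def by simp
    then show ?thesis using that[of 0] infinity by simp
  qed
qed

text \<open>With \<open>c = 0\<close> the zeros \<open>d / (n \<pi>)\<close> accumulate at 0; with \<open>c = d / ((m + 1) \<pi>)\<close> exactly
  \<open>m\<close> of the \<open>d / (n \<pi>) - c\<close> are positive.\<close>

definition bump :: "real \<Rightarrow> real \<Rightarrow> real \<Rightarrow> real" where
  "bump c d x = (if x \<le> 0 then 0 else x ^ 6 * sin (d / (x + c)))"

text \<open>Each differentiation of the sine produces a factor 1 / (x + c)^2, so two of them cost
  x^4 when c = 0; the sixth power in \<open>bump\<close> leaves x^2, enough for a continuous second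
  derivative. The quotients are collected into powers of \<open>x / (x + c)\<close>, which lies in
  [0, 1] for x > 0 and every c >= 0, so the bounds are uniform in c.\<close>

definition bump' :: "real \<Rightarrow> real \<Rightarrow> real \<Rightarrow> real" where
  "bump' c d x = (if x \<le> 0 then 0 else
     6 * x ^ 5 * sin (d / (x + c)) - d * x ^ 4 * (x / (x + c)) ^ 2 * cos (d / (x + c)))"

definition bump'' :: "real \<Rightarrow> real \<Rightarrow> real \<Rightarrow> real" where
  "bump'' c d x = (if x \<le> 0 then 0 else
     30 * x ^ 4 * sin (d / (x + c)) - 12 * d * x ^ 3 * (x / (x + c)) ^ 2 * cos (d / (x + c)) +
     2 * d * x ^ 3 * (x / (x + c)) ^ 3 * cos (d / (x + c)) - d\<^sup>2 * x\<^sup>2 * (x / (x + c)) ^ 4 * sin (d / (x + c)))"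

text \<open>Common bound for the terms of \<open>bump\<close>, \<open>bump'\<close> and
  \<open>bump''\<close>: \<open>u\<close> stands for x / (x + c), and \<open>w\<close> for a sine or
  cosine.\<close>

lemma trig_term_le:
  fixes x u w M :: real
  assumes "0 < x" "x \<le> 1" "2 \<le> j" "0 \<le> u" "u \<le> 1" "\<bar>w\<bar> \<le> 1" "0 \<le> M"
  shows "\<bar>M * x ^ j * u ^ n * w\<bar> \<le> M * x\<^sup>2"
proof -
  have "x ^ j \<le> x ^ 2" using assms by (intro power_decreasing) auto
  moreover have "u ^ n \<le> 1" using assms by (intro power_le_one) auto
  ultimately have "x ^ j * (u ^ n * \<bar>w\<bar>) \<le> x\<^sup>2 * (1 * 1)"
    using assms by (intro mult_mono) auto
  then have "M * (x ^ j * (u ^ n * \<bar>w\<bar>)) \<le> M * x\<^sup>2" using assms(7) by (simp add: mult_left_mono)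
  then show ?thesis using assms by (simp add: abs_mult mult.assoc)
qed

lemma bump_derivs:
  assumes "c \<ge> 0" "d > 0"
  shows "(bump c d has_real_derivative bump' c d x) (at x)"
    and "(bump' c d has_real_derivative bump'' c d x) (at x)"
    and "continuous_on UNIV (bump'' c d)"
proof -
  have u: "0 \<le> x / (x + c)" "x / (x + c) \<le> 1" if "0 < x" for x using that assms by auto
  have b: "\<bar>x ^ 6 * sin (d / (x + c))\<bar> \<le> 1 * x\<^sup>2"
    "\<bar>6 * x ^ 5 * sin (d / (x + c)) - d * x ^ 4 * (x / (x + c)) ^ 2 * cos (d / (x + c))\<bar> \<le> (6 + d) * x\<^sup>2"
    "\<bar>30 * x ^ 4 * sin (d / (x + c)) - 12 * d * x ^ 3 * (x / (x + c)) ^ 2 * cos (d / (x + c)) +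
     2 * d * x ^ 3 * (x / (x + c)) ^ 3 * cos (d / (x + c)) - d\<^sup>2 * x\<^sup>2 * (x / (x + c)) ^ 4 * sin (d / (x + c))\<bar>
     \<le> (30 + 12 * d + 2 * d + d\<^sup>2) * x\<^sup>2"
    if x: "0 < x" "x \<le> 1" for x
  proof -
    note t = trig_term_le[OF x _ u[OF x(1)]]
    show "\<bar>x ^ 6 * sin (d / (x + c))\<bar> \<le> 1 * x\<^sup>2"
      using t[of 6 "sin (d / (x + c))" 1 0] by simp
    show "\<bar>6 * x ^ 5 * sin (d / (x + c)) - d * x ^ 4 * (x / (x + c)) ^ 2 * cos (d / (x + c))\<bar> \<le> (6 + d) * x\<^sup>2"
      using t[of 5 "sin (d / (x + c))" 6 0] t[of 4 "cos (d / (x + c))" d 2] assms(2)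
      unfolding distrib_right by (simp del: times_divide_eq_right times_divide_eq_left power_divide)
    show "\<bar>30 * x ^ 4 * sin (d / (x + c)) - 12 * d * x ^ 3 * (x / (x + c)) ^ 2 * cos (d / (x + c)) +
     2 * d * x ^ 3 * (x / (x + c)) ^ 3 * cos (d / (x + c)) - d\<^sup>2 * x\<^sup>2 * (x / (x + c)) ^ 4 * sin (d / (x + c))\<bar>
     \<le> (30 + 12 * d + 2 * d + d\<^sup>2) * x\<^sup>2"
      using t[of 4 "sin (d / (x + c))" 30 0] t[of 3 "cos (d / (x + c))" "12 * d" 2]
        t[of 3 "cos (d / (x + c))" "2 * d" 3] t[of 2 "sin (d / (x + c))" "d\<^sup>2" 4] assms(2)
      unfolding distrib_right by (simp del: times_divide_eq_right times_divide_eq_left power_divide)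
  qed
  have th: "((\<lambda>x. d / (x + c)) has_real_derivative - d * inverse (x + c) ^ 2) (at x)"
    "((\<lambda>x. x / (x + c)) has_real_derivative inverse (x + c) - x * inverse (x + c) ^ 2) (at x)" if "0 < x" for x
  proof -
    have inv: "((\<lambda>x. inverse (x + c)) has_real_derivative - (inverse (x + c) ^ 2)) (at x)"
      using that assms by (auto intro!: derivative_eq_intros simp: power2_eq_square)
    show "((\<lambda>x. d / (x + c)) has_real_derivative - d * inverse (x + c) ^ 2) (at x)"
      unfolding divide_inverse by (rule DERIV_cong[OF DERIV_cmult[OF inv]]) simp
    show "((\<lambda>x. x / (x + c)) has_real_derivative inverse (x + c) - x * inverse (x + c) ^ 2) (at x)"
      unfolding divide_inverse by (rule DERIV_cong[OF DERIV_mult[OF DERIV_ident inv]]) simp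
  qed
  have tsin: "((\<lambda>x. sin (d / (x + c))) has_real_derivative cos (d / (x + c)) * (- d * inverse (x + c) ^ 2)) (at x)"
    and tcos: "((\<lambda>x. cos (d / (x + c))) has_real_derivative - sin (d / (x + c)) * (- d * inverse (x + c) ^ 2)) (at x)"
    and tsq: "((\<lambda>x. (x / (x + c)) ^ 2) has_real_derivative
      2 * (x / (x + c)) * (inverse (x + c) - x * inverse (x + c) ^ 2)) (at x)" if "0 < x" for x
    using DERIV_chain2[OF DERIV_sin th(1)[OF that]] DERIV_chain2[OF DERIV_cos th(1)[OF that]]
      DERIV_power[OF th(2)[OF that], of 2] by (simp_all add: mult_ac)
  have pw: "((\<lambda>x. M * x ^ Suc n) has_real_derivative M * (real (Suc n) * x ^ n)) (at x)" for M x :: real and n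
    by (rule DERIV_cong[OF DERIV_cmult[OF DERIV_pow]]) simp
  have d0: "((\<lambda>x. x ^ 6 * sin (d / (x + c))) has_real_derivative
      6 * x ^ 5 * sin (d / (x + c)) - d * x ^ 4 * (x / (x + c)) ^ 2 * cos (d / (x + c))) (at x)" if x: "0 < x" for x
  proof -
    show ?thesis
      by (rule DERIV_cong[OF DERIV_mult[OF pw[of 1 5 x] tsin[OF x]], simplified])
         (simp only: divide_inverse, algebra)
  qed
  have d1: "((\<lambda>x. 6 * x ^ 5 * sin (d / (x + c)) - d * x ^ 4 * (x / (x + c)) ^ 2 * cos (d / (x + c))) has_real_derivative
      30 * x ^ 4 * sin (d / (x + c)) - 12 * d * x ^ 3 * (x / (x + c)) ^ 2 * cos (d / (x + c)) +
     2 * d * x ^ 3 * (x / (x + c)) ^ 3 * cos (d / (x + c)) - d\<^sup>2 * x\<^sup>2 * (x / (x + c)) ^ 4 * sin (d / (x + c))) (at x)" if x: "0 < x" for x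
  proof -
    have p5: "((\<lambda>x. 6 * x ^ 5) has_real_derivative 6 * (5 * x ^ 4)) (at x)"
      and p4: "((\<lambda>x. d * x ^ 4) has_real_derivative d * (4 * x ^ 3)) (at x)"
      using pw[of 6 4 x] pw[of d 3 x] by (simp_all add: eval_nat_numeral)
    show ?thesis
      by (rule DERIV_cong[OF DERIV_diff[OF DERIV_mult[OF p5 tsin[OF x]]
            DERIV_mult[OF DERIV_mult[OF p4 tsq[OF x]] tcos[OF x]]]])
         (simp only: divide_inverse, algebra)
  qed
  show "(bump c d has_real_derivative bump' c d x) (at x)"
    unfolding bump_def[abs_def] bump'_def by (rule glued_derivative[OF b(1) _ d0]) auto
  show "(bump' c d has_real_derivative bump'' c d x) (at x)"
    unfolding bump'_def[abs_def] bump''_def by (rule glued_derivative[OF b(2) _ d1]) (use assms in auto)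
  show "continuous_on UNIV (bump'' c d)"
  proof (intro continuous_at_imp_continuous_on ballI)
    fix x :: real
    consider "x = 0" | "x < 0" | "x > 0" by linarith
    then show "isCont (bump'' c d) x"
    proof cases
      case 1
      have "(bump'' c d has_real_derivative 0) (at 0)"
        unfolding bump''_def[abs_def]
        by (rule glued_derivative_at_0[OF b(3)]) (use assms in auto)
      then show ?thesis using 1 DERIV_isCont by blast
    next
      case 2
      have "continuous_on {..<0} (\<lambda>x::real. 0::real)" by simp
      then have "continuous_on {..<0} (bump'' c d)"
        by (rule continuous_on_eq) (simp add: bump''_def)
      then show ?thesis using 2 continuous_on_eq_continuous_at[OF open_lessThan] by blast
    next
      case 3
      have "continuous_on {0<..} (\<lambda>x. 30 * x ^ 4 * sin (d / (x + c)) - 12 * d * x ^ 3 * (x / (x + c)) ^ 2 * cos (d / (x + c)) +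
     2 * d * x ^ 3 * (x / (x + c)) ^ 3 * cos (d / (x + c)) - d\<^sup>2 * x\<^sup>2 * (x / (x + c)) ^ 4 * sin (d / (x + c)))"
        by (intro continuous_intros ballI) (use assms in auto)
      then have "continuous_on {0<..} (bump'' c d)"
        by (rule continuous_on_eq) (simp add: bump''_def)
      then show ?thesis using 3 continuous_on_eq_continuous_at[OF open_greaterThan] by blast
    qed
  qed
qed

text \<open>A constant multiple of \<open>bump\<close> works: scaling makes it small and leaves its
  zeros where they are, so their number and the size are prescribed independently. At a positive
  zero the sine vanishes, hence the cosine does not, and the zero is simple. The bound on
  \<open>k1\<close> follows from that on \<open>k2\<close> because \<open>k1\<close> vanishes at 0;
  being linear in x, it later preserves the sign of x + k1 x.\<close>

lemma perturbation_profile: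
  fixes m :: enat and d R r :: real
  assumes "m \<noteq> 0" "d > 0" "R > 0" "r > 0"
  obtains k k1 k2 where "\<And>x. (k has_real_derivative k1 x) (at x)"
    "\<And>x. (k1 has_real_derivative k2 x) (at x)" "continuous_on UNIV k2" "\<And>x. x \<le> 0 \<Longrightarrow> k x = 0"
    "\<And>x. \<bar>x\<bar> \<le> R \<Longrightarrow> \<bar>k1 x\<bar> \<le> r * \<bar>x\<bar> \<and> \<bar>k2 x\<bar> \<le> r"
    "\<And>x. 0 < x \<Longrightarrow> k x = 0 \<Longrightarrow> x < d \<and> k1 x \<noteq> 0"
    "ecard {x. 0 < x \<and> k x = 0} = m"
proof -
  obtain c where c: "c \<ge> 0" "ecard {x. 0 < x \<and> sin (d / (x + c)) = 0} = m"
    using ecard_sin_reciprocal_zeros[OF assms(1,2)] by blast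
  note D = bump_derivs[OF c(1) assms(2)]
  have "bounded (bump'' c d ` {-R..R})"
    by (rule compact_imp_bounded[OF compact_continuous_image[OF continuous_on_subset[OF D(3) subset_UNIV] compact_Icc]])
  then obtain M where M: "M > 0" "\<And>x. \<bar>x\<bar> \<le> R \<Longrightarrow> \<bar>bump'' c d x\<bar> \<le> M"
    unfolding bounded_pos by (metis abs_le_iff atLeastAtMost_iff imageI minus_le_iff real_norm_def)
  define l where "l = r / M"
  have l: "l > 0" "l * M = r" using M assms by (auto simp: l_def)
  have k2: "\<bar>l * bump'' c d x\<bar> \<le> r" if "\<bar>x\<bar> \<le> R" for x
    using mult_left_mono[OF M(2)[OF that], of l] l by (simp add: abs_mult)
  have k1: "\<bar>l * bump' c d x\<bar> \<le> r * \<bar>x\<bar>" if x: "\<bar>x\<bar> \<le> R" for x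
  proof -
    have "norm (l * bump' c d x - l * bump' c d 0) \<le> r * norm (x - 0)"
    proof (rule field_differentiable_bound[where S = "{-R..R}" and f' = "\<lambda>x. l * bump'' c d x"])
      show "((\<lambda>x. l * bump' c d x) has_field_derivative l * bump'' c d z) (at z within {-R..R})" for z
        by (rule DERIV_cmult[OF has_field_derivative_at_within[OF D(2)]])
    next
      show "norm (l * bump'' c d z) \<le> r" if "z \<in> {-R..R}" for z
        using k2[of z] that by (simp add: abs_le_iff)
      show "x \<in> {-R..R}" using x by (simp add: abs_le_iff)
    qed (use assms in simp_all)
    then show ?thesis by (simp add: bump'_def)
  qed
  have zero: "l * bump c d x = 0 \<longleftrightarrow> sin (d / (x + c)) = 0" if "x > 0" for x
    using that l(1) by (simp add: bump_def)
  show ?thesis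
  proof (rule that[of "\<lambda>x. l * bump c d x" "\<lambda>x. l * bump' c d x" "\<lambda>x. l * bump'' c d x"])
    show "continuous_on UNIV (\<lambda>x. l * bump'' c d x)" by (intro continuous_intros D(3))
    show "x < d \<and> l * bump' c d x \<noteq> 0" if x: "0 < x" "l * bump c d x = 0" for x
    proof
      have s: "sin (d / (x + c)) = 0" by (rule iffD1[OF zero[OF x(1)] x(2)])
      from iffD1[OF sin_reciprocal_zeros[OF c(1) assms(2) x(1)] s]
      obtain n :: nat where n: "n \<ge> 1" "x = d / (real n * pi) - c" by blast
      have "pi \<le> real n * pi" using n(1) by simp
      then have "1 < real n * pi" using pi_gt3 by linarith
      then have "d / (real n * pi) < d / 1" using assms(2) by (intro divide_strict_left_mono) auto
      then show "x < d" using n(2) c(1) by simp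
      have "cos (d / (x + c)) \<noteq> 0" using sin_zero_abs_cos_one[OF s] by auto
      then show "l * bump' c d x \<noteq> 0" using s x(1) l(1) c(1) assms(2) by (simp add: bump'_def)
    qed
    have "{x. 0 < x \<and> l * bump c d x = 0} = {x. 0 < x \<and> sin (d / (x + c)) = 0}" using zero by blast
    then show "ecard {x. 0 < x \<and> l * bump c d x = 0} = m" using c(2) by simp
    show "((\<lambda>x. l * bump c d x) has_real_derivative l * bump' c d x) (at x)" for x
      by (rule DERIV_cmult[OF D(1)])
    show "((\<lambda>x. l * bump' c d x) has_real_derivative l * bump'' c d x) (at x)" for x
      by (rule DERIV_cmult[OF D(2)])
    show "\<bar>l * bump' c d x\<bar> \<le> r * \<bar>x\<bar> \<and> \<bar>l * bump'' c d x\<bar> \<le> r" if "\<bar>x\<bar> \<le> R" for x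
      using k1[OF that] k2[OF that] by simp
  qed (simp add: bump_def)
qed

lemma continuous_on_vector2:
  fixes u v :: "'a::topological_space \<Rightarrow> 'b::{zero, topological_space}"
  assumes "continuous_on S u" "continuous_on S v"
  shows "continuous_on S (\<lambda>x. vector [u x, v x] :: 'b^2)"
proof -
  have "(vector [u x, v x] :: 'b^2) = (\<chi> i. if i = 1 then u x else v x)" for x
    by (simp add: vec_eq_iff forall_2)
  moreover have "continuous_on S (\<lambda>x. (\<chi> i. if i = 1 then u x else v x) :: 'b^2)"
  proof (rule continuous_on_vec_lambda)
    show "continuous_on S (\<lambda>x. if i = 1 then u x else v x)" for i :: 2
      by (cases "i = 1") (use assms in auto)
  qed
  ultimately show ?thesis by simp
qed

subsection \<open>Arcs in a half plane\<close>

lemma vector2_eq_iff [simp]: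
  "(vector [a, b] :: real^2) = vector [c, d] \<longleftrightarrow> a = c \<and> b = d"
  by (simp add: vec_eq_iff forall_2)

lemma norm_vec2_le: "norm (p :: real^2) \<le> \<bar>p $ 1\<bar> + \<bar>p $ 2\<bar>"
  using norm_le_l1_cart[of p] by (simp add: sum_2)

lemma has_vector_derivative_vec2:
  fixes g :: "real \<Rightarrow> real^2"
  assumes "((\<lambda>t. g t $ 1) has_real_derivative d1) (at t)" "((\<lambda>t. g t $ 2) has_real_derivative d2) (at t)"
  shows "(g has_vector_derivative vector [d1, d2]) (at t)"
proof -
  have "((\<lambda>t. g t \<bullet> i) has_derivative (\<lambda>h. (h *\<^sub>R (vector [d1, d2] :: real^2)) \<bullet> i)) (at t)"
    if "i \<in> Basis" for i
  proof -
    obtain j :: 2 where j: "i = axis j 1" using \<open>i \<in> Basis\<close> by (auto simp: Basis_vec_def)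
    consider "j = 1" | "j = 2" using exhaust_2 by blast
    then show ?thesis
      using assms by cases (simp_all add: j inner_axis has_field_derivative_def mult.commute[of _ d1] mult.commute[of _ d2])
  qed
  then show ?thesis
    unfolding has_vector_derivative_def by (subst has_derivative_componentwise_within) auto
qed

lemma has_vector_derivative_component:
  fixes g :: "real \<Rightarrow> real^2"
  assumes "(g has_vector_derivative v) (at t)"
  shows "((\<lambda>t. g t $ i) has_real_derivative v $ i) (at t)"
  using bounded_linear.has_vector_derivative[OF bounded_linear_vec_nth assms]
  by (simp add: has_real_derivative_iff_has_vector_derivative)

text \<open>Separation of variables: the travel time from p to x is the integral of 1 / l, a
  strictly increasing function whose inverse is the solution. Continuity of \<open>l\<close>
  suffices for this.\<close>

lemma autonomous_solution_1d:
  fixes l :: "real \<Rightarrow> real"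
  assumes "p < q" and cont: "continuous_on {p..q} l" and pos: "\<And>x. x \<in> {p..q} \<Longrightarrow> l x > 0"
  obtains T z where "T > 0" "continuous_on {0..T} z" "z 0 = p" "z T = q"
    "\<And>t. t \<in> {0<..<T} \<Longrightarrow> p < z t \<and> z t < q \<and> (z has_real_derivative l (z t)) (at t)"
proof -
  define G where "G x = integral {p..x} (\<lambda>u. 1 / l u)" for x
  have ci: "continuous_on {p..q} (\<lambda>u. 1 / l u)"
    by (intro continuous_intros cont) (use pos in force)
  have dG: "(G has_real_derivative 1 / l x) (at x within {p..q})" if "x \<in> {p..q}" for x
    unfolding G_def using integral_has_real_derivative[OF ci that] .
  have cG: "continuous_on {p..q} G"
    using dG by (meson DERIV_continuous continuous_on_eq_continuous_within)
  have dG': "(G has_real_derivative 1 / l x) (at x)" if "x \<in> {p<..<q}" for x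
    using dG[of x] that by (simp add: at_within_Icc_at)
  have mono: "G x < G y" if "p \<le> x" "x < y" "y \<le> q" for x y
  proof (rule DERIV_pos_imp_increasing_open[OF that(2)])
    fix u assume "x < u" "u < y"
    then show "\<exists>d. (G has_real_derivative d) (at u) \<and> 0 < d"
      using dG'[of u] pos[of u] that by (intro exI[of _ "1 / l u"]) auto
  next
    show "continuous_on {x..y} G" using cG that by (auto elim: continuous_on_subset)
  qed
  define T where "T = G q"
  have G0: "G p = 0" by (simp add: G_def)
  have "T > 0" using mono[of p q] \<open>p < q\<close> by (simp add: G0 T_def)
  have inj: "inj_on G {p..q}"
    by (rule linorder_inj_onI) (use mono in force)+
  have img: "G ` {p..q} = {0..T}"
  proof
    show "G ` {p..q} \<subseteq> {0..T}"
    proof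
      fix v assume "v \<in> G ` {p..q}"
      then obtain x where x: "x \<in> {p..q}" "v = G x" by auto
      show "v \<in> {0..T}"
        using mono[of p x] mono[of x q] x G0 by (cases "x = p"; cases "x = q") (auto simp: T_def)
    qed
    show "{0..T} \<subseteq> G ` {p..q}"
    proof
      fix v assume "v \<in> {0..T}"
      then show "v \<in> G ` {p..q}"
        using IVT'[of G p v q] cG G0 \<open>p < q\<close> by (fastforce simp: T_def)
    qed
  qed
  define z where "z = the_inv_into {p..q} G"
  have zG: "z (G x) = x" if "x \<in> {p..q}" for x
    using that inj by (simp add: z_def the_inv_into_f_f)
  have Gz: "G (z t) = t" "z t \<in> {p..q}" if "t \<in> {0..T}" for t
    using that inj img unfolding z_def
    by (metis f_the_inv_into_f) (metis that img inj the_inv_into_into order_refl)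
  have cz: "continuous_on {0..T} z"
    using continuous_on_inv[OF cG compact_Icc, of z] zG img by simp
  have zz: "z 0 = p" "z T = q" using zG[of p] zG[of q] \<open>p < q\<close> by (auto simp: G0 T_def)
  show ?thesis
  proof (rule that[OF \<open>T > 0\<close> cz zz])
    fix t assume t: "t \<in> {0<..<T}"
    have "z t \<in> {p..q}" using Gz t by auto
    moreover have "z t \<noteq> p" "z t \<noteq> q" using Gz(1)[of t] t G0 by (auto simp: T_def)
    ultimately have zt: "p < z t" "z t < q" by auto
    have "(z has_real_derivative inverse (1 / l (z t))) (at t)"
    proof (rule DERIV_inverse_function[where f = G and a = 0 and b = T])
      show "(G has_real_derivative 1 / l (z t)) (at (z t))" using dG' zt by auto
      show "1 / l (z t) \<noteq> 0" using pos[of "z t"] zt by auto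
      show "isCont z t" using cz t by (simp add: continuous_on_interior)
    qed (use t Gz in auto)
    then show "p < z t \<and> z t < q \<and> (z has_real_derivative l (z t)) (at t)" using zt by simp
  qed
qed

text \<open>With \<open>f1\<close> the derivative of \<open>f\<close>, the vector is (-H_y, H_x) for
  the function \<open>H\<close> of the locale below. The sign is the counterclockwise one: where H_y
  > 0, orbits move to the left.\<close>

definition half_field ::
  "(real^2 \<Rightarrow> real) \<Rightarrow> real \<Rightarrow> real \<Rightarrow> real \<Rightarrow> (real \<Rightarrow> real) \<Rightarrow> vfield" where
  "half_field s e a sg f1 p =
     s p *\<^sub>R vector [- (e + a * p $ 1 + sg * p $ 2), f1 (p $ 1) + a * p $ 2]"

lemma half_field_nth [simp]:
  "half_field s e a sg f1 p $ 1 = - (s p * (e + a * p $ 1 + sg * p $ 2))"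
  "half_field s e a sg f1 p $ 2 = s p * (f1 (p $ 1) + a * p $ 2)"
  by (simp_all add: half_field_def algebra_simps)

text \<open>The bounds make \<open>\<partial>H/\<partial>y\<close> positive for \<open>0 \<le> y \<le> Y\<close> and \<open>H \<ge> Y e / 2\<close> for \<open>y = Y\<close>, so an
  orbit leaving the line at a lower level never reaches height \<open>Y\<close>; what the field does above
  that height is irrelevant.\<close>

locale half_plane =
  fixes R e a sg Y :: real and f f1 :: "real \<Rightarrow> real" and s :: "real^2 \<Rightarrow> real"
  assumes e_pos: "e > 0" and Y_pos: "0 < Y" and Y_less: "Y < R"
    and a_le: "\<bar>a\<bar> * R \<le> e / 4" and sg_le: "\<bar>sg\<bar> * Y \<le> e / 2"
    and f_0: "f 0 = 0"
    and f_deriv: "\<And>x. \<bar>x\<bar> < R \<Longrightarrow> (f has_real_derivative f1 x) (at x)"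
    and f1_pos: "\<And>x. 0 < x \<Longrightarrow> x < R \<Longrightarrow> f1 x > 0"
    and f1_neg: "\<And>x. - R < x \<Longrightarrow> x < 0 \<Longrightarrow> f1 x < 0"
    and s_cont: "continuous_on (ball 0 R) s"
    and s_pos: "\<And>p. norm p < R \<Longrightarrow> s p > 0"
begin

abbreviation X where "X \<equiv> half_field s e a sg f1"

definition H :: "real^2 \<Rightarrow> real" where
  "H p = f (p $ 1) + (e + a * p $ 1) * p $ 2 + sg * (p $ 2)\<^sup>2 / 2"

definition arc :: "real \<Rightarrow> (real^2) set" where
  "arc c = {p. norm p < R \<and> 0 \<le> p $ 2 \<and> p $ 2 \<le> Y \<and> H p = c}"

lemma R_pos: "R > 0" using Y_pos Y_less by simp

lemma slope_ge: "\<bar>x\<bar> < R \<Longrightarrow> e + a * x \<ge> 3 * e / 4"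
proof -
  assume "\<bar>x\<bar> < R"
  then have "\<bar>a * x\<bar> \<le> \<bar>a\<bar> * R" by (simp add: abs_mult mult_left_mono)
  then show ?thesis using a_le by linarith
qed

lemma sg_ge: "0 \<le> y \<Longrightarrow> y \<le> Y \<Longrightarrow> \<bar>sg * y\<bar> \<le> e / 2"
proof -
  assume "0 \<le> y" "y \<le> Y"
  then have "\<bar>sg * y\<bar> \<le> \<bar>sg\<bar> * Y" by (simp add: abs_mult mult_left_mono)
  then show ?thesis using sg_le by linarith
qed

lemma f_continuous: "continuous_on {-R<..<R} f"
proof (rule continuous_at_imp_continuous_on, rule ballI)
  fix x assume "x \<in> {-R<..<R}"
  then have "\<bar>x\<bar> < R" by auto
  then show "isCont f x" by (rule DERIV_isCont[OF f_deriv])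
qed

lemma f_strict_incr:
  assumes "0 \<le> x" "x < y" "y < R" shows "f x < f y"
proof (rule DERIV_pos_imp_increasing_open[OF assms(2)])
  fix u assume "x < u" "u < y"
  then show "\<exists>d. (f has_real_derivative d) (at u) \<and> 0 < d"
    using assms f_deriv[of u] f1_pos[of u] by (intro exI[of _ "f1 u"]) auto
next
  have "{x..y} \<subseteq> {-R<..<R}" using assms by auto
  then show "continuous_on {x..y} f" by (rule continuous_on_subset[OF f_continuous])
qed

lemma f_strict_decr:
  assumes "- R < x" "x < y" "y \<le> 0" shows "f y < f x"
proof (rule DERIV_neg_imp_decreasing_open[OF assms(2)])
  fix u assume "x < u" "u < y"
  then show "\<exists>d. (f has_real_derivative d) (at u) \<and> d < 0"
    using assms f_deriv[of u] f1_neg[of u] by (intro exI[of _ "f1 u"]) auto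
next
  have "{x..y} \<subseteq> {-R<..<R}" using assms R_pos by auto
  then show "continuous_on {x..y} f" by (rule continuous_on_subset[OF f_continuous])
qed

lemma f_nonneg: "\<bar>x\<bar> < R \<Longrightarrow> f x \<ge> 0"
  using f_strict_incr[of 0 x] f_strict_decr[of x 0] f_0 by (cases x "0::real" rule: linorder_cases) auto

lemma comps: "norm p < R \<Longrightarrow> \<bar>p $ 1\<bar> < R \<and> \<bar>p $ 2\<bar> < R" for p :: "real^2"
  using component_le_norm_cart[of p 1] component_le_norm_cart[of p 2] by auto

text \<open>Of the coefficient e of y, the term a x can remove at most e / 4 and sg y / 2 at most
  another e / 4. At y = Y this is the barrier; for general y it shows that f does not exceed the
  level anywhere on an arc.\<close>

lemma H_ge:
  assumes "\<bar>p $ 1\<bar> < R" "0 \<le> p $ 2" "p $ 2 \<le> Y"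
  shows "H p \<ge> f (p $ 1) + p $ 2 * e / 2"
proof -
  have "p $ 2 * (e + a * p $ 1 + sg * p $ 2 / 2) \<ge> p $ 2 * (e / 2)"
    using slope_ge[OF assms(1)] sg_ge[OF assms(2,3)] assms(2)
    by (intro mult_left_mono) auto
  then show ?thesis by (simp add: H_def algebra_simps power2_eq_square)
qed

text \<open>On a vertical line the difference of the two values of \<open>H\<close> is the
  difference of the heights times a factor of at least e / 4. Hence a level set in the strip is a
  graph over the x-axis.\<close>

lemma H_strict_mono_y:
  assumes "norm p < R" "norm q < R" "p $ 1 = q $ 1" "0 \<le> p $ 2" "p $ 2 \<le> Y" "0 \<le> q $ 2" "q $ 2 \<le> Y" "H p = H q"
  shows "p = q"
proof -
  have "(p $ 2 - q $ 2) * (e + a * p $ 1 + sg * p $ 2 / 2 + sg * q $ 2 / 2) = 0"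
    using assms(3,8) unfolding H_def by (simp add: field_simps power2_eq_square)
  moreover have "e + a * p $ 1 + sg * p $ 2 / 2 + sg * q $ 2 / 2 > 0"
    using slope_ge[of "p $ 1"] comps[OF assms(1)] sg_ge[OF assms(4,5)] sg_ge[OF assms(6,7)] e_pos
    by linarith
  ultimately show ?thesis using assms(3) by (simp add: vec_eq_iff forall_2)
qed

lemma H_has_derivative_0:
  assumes "(g has_vector_derivative X (g t)) (at t)" "norm (g t) < R"
  shows "((\<lambda>t. H (g t)) has_real_derivative 0) (at t)"
proof -
  have "\<bar>g t $ 1\<bar> < R" using comps assms(2) by auto
  note fg = DERIV_chain2[OF f_deriv[OF this] has_vector_derivative_component[OF assms(1)]]
  note d = has_vector_derivative_component[OF assms(1)]
  show ?thesis
    unfolding H_def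
    by (rule DERIV_cong, (rule derivative_intros fg d | simp)+) (simp add: algebra_simps power2_eq_square)
qed

lemma H_continuous: "continuous_on (ball 0 R) H"
  unfolding H_def
  by (intro continuous_intros continuous_on_compose2[OF f_continuous])
     (auto dest!: comps simp: abs_less_iff)

text \<open>The finite set \<open>B\<close> allows for switching times, at which an orbit is only
  known to be continuous.\<close>

lemma H_constant:
  assumes "t0 \<le> t1" "continuous_on {t0..t1} g" "finite B"
    "\<And>t. t \<in> {t0<..<t1} - B \<Longrightarrow> (g has_vector_derivative X (g t)) (at t)"
    "\<And>t. t \<in> {t0..t1} \<Longrightarrow> norm (g t) < R" "t \<in> {t0..t1}"
  shows "H (g t) = H (g t0)"
proof (rule has_derivative_zero_unique_strong_interval[where f = "\<lambda>t. H (g t)" and x = t and k = "B \<union> {t0, t1}" and a = t0 and b = t1])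
  show "continuous_on {t0..t1} (\<lambda>t. H (g t))"
    by (rule continuous_on_compose2[OF H_continuous assms(2)]) (use assms(5) in auto)
  fix u assume "u \<in> {t0..t1} - (B \<union> {t0, t1})"
  then show "((\<lambda>t. H (g t)) has_derivative (\<lambda>h. 0)) (at u within {t0..t1})"
    using H_has_derivative_0[of g u, OF assms(4) assms(5)]
    by (auto simp: has_field_derivative_def lambda_zero intro: has_derivative_at_withinI)
qed (use assms in auto)

text \<open>Below level Y e / 2 the orbit cannot reach height Y. On the arc f is at most c, so by
  the monotonicity of f on each side every point of the arc has its abscissa between those of the
  two ends; by the intermediate value theorem the orbit attains this abscissa, and a level set has
  only one point above it. The image thus depends on the level alone.\<close>

lemma excursion_image:
  assumes "t0 < t1" and cont: "continuous_on {t0..t1} g" and "finite B"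
    and sol: "\<And>t. t \<in> {t0<..<t1} - B \<Longrightarrow> (g has_vector_derivative X (g t)) (at t)"
    and ball: "\<And>t. t \<in> {t0..t1} \<Longrightarrow> norm (g t) < R"
    and pos: "\<And>t. t \<in> {t0<..<t1} \<Longrightarrow> g t $ 2 > 0"
    and ends: "g t0 $ 2 = 0" "g t1 $ 2 = 0" "g t0 $ 1 > 0" "g t1 $ 1 < 0"
    and c: "c = f (g t0 $ 1)" "c < Y * e / 2"
  shows "g ` {t0..t1} = arc c"
proof -
  have H: "H (g t) = c" if "t \<in> {t0..t1}" for t
    using H_constant[OF less_imp_le[OF assms(1)] cont \<open>finite B\<close> sol ball that] ends c by (simp add: H_def)
  have nn: "g t $ 2 \<ge> 0" if "t \<in> {t0..t1}" for t
    using pos[of t] ends that by (cases "t = t0"; cases "t = t1") auto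
  have yc: "continuous_on {t0..t1} (\<lambda>t. g t $ 2)" "continuous_on {t0..t1} (\<lambda>t. g t $ 1)"
    using cont by (auto intro: continuous_intros)
  have small: "g t $ 2 \<le> Y" if t: "t \<in> {t0..t1}" for t
  proof (rule ccontr)
    assume "\<not> g t $ 2 \<le> Y"
    then obtain u where "t0 \<le> u" "u \<le> t" "g u $ 2 = Y"
      using IVT'[of "\<lambda>t. g t $ 2" t0 Y t] continuous_on_subset[OF yc(1), of "{t0..t}"] ends t Y_pos by auto
    then have u: "u \<in> {t0..t1}" "g u $ 2 = Y" using t by auto
    then show False
      using H_ge[of "g u"] H[OF u(1)] c f_nonneg[of "g u $ 1"] comps[OF ball[OF u(1)]] Y_pos by auto
  qed
  show ?thesis
  proof
    show "g ` {t0..t1} \<subseteq> arc c" using H nn small ball by (auto simp: arc_def)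
    show "arc c \<subseteq> g ` {t0..t1}"
    proof
      fix p assume "p \<in> arc c"
      then have p: "norm p < R" "0 \<le> p $ 2" "p $ 2 \<le> Y" "H p = c" by (auto simp: arc_def)
      have cp: "\<bar>p $ 1\<bar> < R" using comps p by auto
      have fp: "f (p $ 1) \<le> c" using H_ge[OF cp p(2,3)] p e_pos
        by (smt (verit) mult_nonneg_nonneg divide_nonneg_nonneg)
      have b0: "\<bar>g t0 $ 1\<bar> < R" "\<bar>g t1 $ 1\<bar> < R" using ball comps assms(1) by auto
      have f1: "f (g t1 $ 1) = c" using H[of t1] ends assms(1) by (simp add: H_def)
      have "p $ 1 \<le> g t0 $ 1"
        using f_strict_incr[of "g t0 $ 1" "p $ 1"] fp c ends cp by (smt (verit))
      moreover have "g t1 $ 1 \<le> p $ 1"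
        using f_strict_decr[of "p $ 1" "g t1 $ 1"] fp f1 ends cp by (smt (verit))
      ultimately obtain u where u: "u \<in> {t0..t1}" "g u $ 1 = p $ 1"
        using IVT2'[of "\<lambda>t. g t $ 1" t1 "p $ 1" t0] yc assms(1) by auto
      have "g u = p"
        using H_strict_mono_y[of "g u" p] u ball nn small H p by auto
      then show "p \<in> g ` {t0..t1}" using u by auto
    qed
  qed
qed

text \<open>The arc is the graph of an explicit function \<open>y\<close>, so only the motion of the
  abscissa has to be solved for. The ends lie within R - Y of the origin, which keeps an arc of
  height below Y inside the ball of radius R.\<close>

lemma excursion_exists:
  assumes x0: "0 < x0" "x0 < R - Y" and x1: "x1 < 0" "- x1 < R - Y" and c: "f x0 = c" "f x1 = c" "c < Y * e / 2"
  obtains T g where "T > 0" "continuous_on {0..T} g" "g 0 = vector [x0, 0]" "g T = vector [x1, 0]"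
    "\<And>t. t \<in> {0<..<T} \<Longrightarrow> g t $ 2 > 0 \<and> (g has_vector_derivative X (g t)) (at t)"
    "\<And>t. t \<in> {0..T} \<Longrightarrow> x1 \<le> g t $ 1 \<and> g t $ 1 \<le> x0 \<and> 0 \<le> g t $ 2 \<and> g t $ 2 < Y"
proof -
  have xR: "\<bar>x\<bar> < R" if "x \<in> {x1..x0}" for x using that x0 x1 Y_pos by auto
  have f_le: "f x \<le> c" if "x \<in> {x1..x0}" for x
    using f_strict_incr[of x x0] f_strict_decr[of x1 x] c that x0 x1 Y_pos
    by (cases "x \<ge> 0"; cases "x = x0"; cases "x = x1") (auto simp: less_imp_le)
  have f_less: "f x < c" if "x1 < x" "x < x0" for x
    using f_strict_incr[of x x0] f_strict_decr[of x1 x] c that x0 x1 Y_pos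
    by (cases "x \<ge> 0") auto
  define b where "b x = e + a * x" for x
  define w where "w x = c - f x" for x
  \<comment> \<open>the root of \<open>b x * y + sg * y\<^sup>2 / 2 = w x\<close>, in a form that also covers \<open>sg = 0\<close>\<close>
  define y where "y x = 2 * w x / (b x + sqrt ((b x)\<^sup>2 + 2 * sg * w x))" for x
  have b: "b x \<ge> 3 * e / 4" if "x \<in> {x1..x0}" for x using slope_ge[OF xR[OF that]] by (simp add: b_def)
  have w: "0 \<le> w x" "w x < Y * e / 2" if "x \<in> {x1..x0}" for x
    using f_le[OF that] f_nonneg[OF xR[OF that]] c by (auto simp: w_def)
  \<comment> \<open>The square of b is at least 9 e^2 / 16, and 2 sg w is at most e^2 / 2 in
    absolute value.\<close>
  have D: "(b x)\<^sup>2 + 2 * sg * w x \<ge> e\<^sup>2 / 16" if x: "x \<in> {x1..x0}" for x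
  proof -
    have "(3 * e / 4)\<^sup>2 \<le> (b x)\<^sup>2" using b[OF x] e_pos by (intro power_mono) auto
    moreover have "\<bar>sg * w x\<bar> \<le> e\<^sup>2 / 4"
    proof -
      have "\<bar>sg\<bar> * \<bar>w x\<bar> \<le> \<bar>sg\<bar> * (Y * e / 2)" using w[OF x] by (intro mult_left_mono) auto
      then have "\<bar>sg * w x\<bar> \<le> \<bar>sg\<bar> * (Y * e / 2)" by (simp add: abs_mult)
      also have "\<dots> = (\<bar>sg\<bar> * Y) * (e / 2)" by simp
      also have "\<dots> \<le> (e / 2) * (e / 2)" using sg_le e_pos by (intro mult_right_mono) auto
      finally show ?thesis by (simp add: power2_eq_square)
    qed
    moreover have "e\<^sup>2 > 0" using e_pos by simp
    ultimately show ?thesis by (simp add: power2_eq_square abs_le_iff)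
  qed
  have sq: "sqrt ((b x)\<^sup>2 + 2 * sg * w x) \<ge> e / 4" if x: "x \<in> {x1..x0}" for x
    by (rule real_le_rsqrt) (use D[OF x] in \<open>simp add: power_divide\<close>)
  have den: "b x + sqrt ((b x)\<^sup>2 + 2 * sg * w x) \<ge> e" if x: "x \<in> {x1..x0}" for x
    using sq[OF x] b[OF x] by linarith
  have y_nn: "0 \<le> y x" if x: "x \<in> {x1..x0}" for x
    using w[OF x] den[OF x] e_pos by (simp add: y_def)
  have y_pos: "0 < y x" if x: "x1 < x" "x < x0" for x
    using f_less[OF x] den[of x] e_pos x by (simp add: y_def w_def)
  have y_lt: "y x < Y" if x: "x \<in> {x1..x0}" for x
  proof -
    have "2 * w x < Y * e" using w[OF x] by simp
    also have "\<dots> \<le> Y * (b x + sqrt ((b x)\<^sup>2 + 2 * sg * w x))"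
      using den[OF x] Y_pos by (intro mult_left_mono) auto
    finally show ?thesis using den[OF x] e_pos by (simp add: y_def divide_less_eq)
  qed
  have y_eq: "f x + b x * y x + sg * (y x)\<^sup>2 / 2 = c" if x: "x \<in> {x1..x0}" for x
  proof -
    define d where "d = sqrt ((b x)\<^sup>2 + 2 * sg * w x)"
    have "0 \<le> (b x)\<^sup>2 + 2 * sg * w x" by (rule order_trans[OF _ D[OF x]]) simp
    then have "d\<^sup>2 = (b x)\<^sup>2 + 2 * sg * w x" unfolding d_def by (rule real_sqrt_pow2)
    then have d2: "2 * sg * w x = d\<^sup>2 - (b x)\<^sup>2" by simp
    \<comment> \<open>Multiplying by n^2 clears the denominator of \<open>y x\<close>; since 2 sg w
      = d^2 - b^2, what remains is the expansion of (b + d)^2.\<close>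
    define n where "n = b x + d"
    have nz: "n \<noteq> 0" using den[OF x] e_pos by (simp add: n_def d_def)
    have yd: "y x * n = 2 * w x" using nz by (simp add: y_def n_def d_def)
    have "(b x * y x + sg * (y x)\<^sup>2 / 2) * n\<^sup>2 = b x * (y x * n) * n + sg / 2 * (y x * n)\<^sup>2"
      by (simp add: field_simps power2_eq_square)
    also have "\<dots> = w x * (2 * b x * n + 2 * sg * w x)"
      unfolding yd by (simp add: distrib_left power2_eq_square mult_ac)
    also have "\<dots> = w x * n\<^sup>2" unfolding d2 n_def by (simp add: algebra_simps power2_eq_square)
    finally have "b x * y x + sg * (y x)\<^sup>2 / 2 = w x" using nz by simp
    then show ?thesis by (simp add: w_def)
  qed
  have dw: "(w has_real_derivative - f1 x) (at x)" if x: "x \<in> {x1..x0}" for x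
    unfolding w_def using f_deriv[OF xR[OF x]] by (auto intro!: derivative_eq_intros)
  have db: "(b has_real_derivative a) (at x)" for x
    unfolding b_def by (auto intro!: derivative_eq_intros)
  have dy: "\<exists>d. (y has_real_derivative d) (at x)" if x: "x \<in> {x1..x0}" for x
  proof -
    have Dx: "(b x)\<^sup>2 + 2 * sg * w x > 0" by (rule less_le_trans[OF _ D[OF x]]) (use e_pos in simp)
    have dz: "((\<lambda>x. (b x)\<^sup>2 + 2 * sg * w x) has_real_derivative (2 * b x * a - 2 * sg * f1 x)) (at x)"
      by (auto intro!: derivative_eq_intros dw[OF x] db)
    have nz: "b x + sqrt ((b x)\<^sup>2 + 2 * sg * w x) \<noteq> 0" using den[OF x] e_pos by simp
    show ?thesis
      unfolding y_def
      by (rule exI, rule DERIV_divide[OF DERIV_cmult[OF dw[OF x]]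
            DERIV_add[OF db DERIV_chain2[OF DERIV_real_sqrt[OF Dx] dz]] nz])
  qed
  \<comment> \<open>The explicit formula only shows that \<open>y\<close> has a derivative; its
    value comes from differentiating the level equation.\<close>
  have dy': "(y has_real_derivative - (f1 x + a * y x) / (b x + sg * y x)) (at x)" if x: "x1 < x" "x < x0" for x
  proof -
    have xi: "x \<in> {x1..x0}" using x by simp
    obtain d where d: "(y has_real_derivative d) (at x)" using dy[OF xi] by blast
    have 1: "((\<lambda>x. f x + b x * y x + sg * (y x)\<^sup>2 / 2) has_real_derivative
        (f1 x + (a * y x + d * b x) + sg * y x * d)) (at x)"
      using f_deriv[OF xR[OF xi]] d db[of x]
      by (auto intro!: derivative_eq_intros simp: algebra_simps)
    have "((\<lambda>x. f x + b x * y x + sg * (y x)\<^sup>2 / 2) has_real_derivative 0) (at x)"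
      by (rule has_field_derivative_transform_within_open[OF DERIV_const[of c], where S = "{x1<..<x0}"])
         (use x y_eq in auto)
    from DERIV_unique[OF 1 this] have "d * (b x + sg * y x) = - (f1 x + a * y x)"
      by (simp add: algebra_simps)
    moreover have "b x + sg * y x > 0"
      using b[OF xi] sg_ge[of "y x"] y_nn[OF xi] y_lt[OF xi] e_pos by linarith
    ultimately have "d = - (f1 x + a * y x) / (b x + sg * y x)" by (simp add: eq_divide_eq)
    then show ?thesis using d by simp
  qed
  have y_cont: "continuous_on {x1..x0} y"
    using dy by (meson DERIV_isCont continuous_at_imp_continuous_on)
  have nrm: "norm (vector [x, y x] :: real^2) < R" if x: "x \<in> {x1..x0}" for x
    using norm_vec2_le[of "vector [x, y x]"] y_nn[OF x] y_lt[OF x] x x0 x1 by auto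
  \<comment> \<open>The abscissa decreases along the arc, so the equation is solved for u = -x,
    which increases with speed \<open>l u\<close>.\<close>
  define l where "l u = s (vector [- u, y (- u)]) * (b (- u) + sg * y (- u))" for u
  have l_pos: "l u > 0" if "u \<in> {-x0..-x1}" for u
  proof -
    have u: "- u \<in> {x1..x0}" using that by auto
    have "b (-u) + sg * y (-u) > 0"
      using b[OF u] sg_ge[of "y (-u)"] y_nn[OF u] y_lt[OF u] e_pos by linarith
    then show ?thesis using s_pos[OF nrm[OF u]] by (simp add: l_def)
  qed
  have yc: "continuous_on {-x0..-x1} (\<lambda>u. y (- u))"
    by (rule continuous_on_compose2[OF y_cont]) (auto intro!: continuous_intros)
  have vc: "continuous_on {-x0..-x1} (\<lambda>u. vector [- u, y (- u)] :: real^2)"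
    by (rule continuous_on_vector2) (auto intro!: continuous_intros yc)
  have l_cont: "continuous_on {-x0..-x1} l"
    unfolding l_def b_def
    by (intro continuous_intros yc continuous_on_compose2[OF s_cont vc]) (auto intro!: nrm)
  obtain T z where T: "T > 0" "continuous_on {0..T} z" "z 0 = - x0" "z T = - x1"
    and z: "\<And>t. t \<in> {0<..<T} \<Longrightarrow> - x0 < z t \<and> z t < - x1 \<and> (z has_real_derivative l (z t)) (at t)"
    using autonomous_solution_1d[of "-x0" "-x1" l] l_cont l_pos x0 x1 by auto
  define g where "g t = (vector [- z t, y (- z t)] :: real^2)" for t
  have zi: "z t \<in> {-x0..-x1}" if "t \<in> {0..T}" for t
    using z[of t] that T x0 x1 by (cases "t = 0"; cases "t = T") auto
  have y_ends: "y x0 = 0" "y x1 = 0" using c by (auto simp: y_def w_def)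
  show ?thesis
  proof (rule that[of T g])
    show "continuous_on {0..T} g"
      unfolding g_def by (rule continuous_on_compose2[OF vc T(2)]) (use zi in auto)
    show "g 0 = vector [x0, 0]" "g T = vector [x1, 0]" using T y_ends by (auto simp: g_def)
    show "x1 \<le> g t $ 1 \<and> g t $ 1 \<le> x0 \<and> 0 \<le> g t $ 2 \<and> g t $ 2 < Y" if "t \<in> {0..T}" for t
      using zi[OF that] y_nn[of "- z t"] y_lt[of "- z t"] by (auto simp: g_def)
    fix t assume t: "t \<in> {0<..<T}"
    define x where "x = - z t"
    have x: "x1 < x" "x < x0" and dz: "(z has_real_derivative l (- x)) (at t)" using z[OF t] by (auto simp: x_def)
    have xi: "x \<in> {x1..x0}" using x by simp
    have bp: "b x + sg * y x > 0"
      using b[OF xi] sg_ge[of "y x"] y_nn[OF xi] y_lt[OF xi] e_pos by linarith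
    have dzm: "((\<lambda>t. - z t) has_real_derivative - l (- x)) (at t)"
      using dz by (auto intro!: derivative_eq_intros)
    have dyz: "((\<lambda>t. y (- z t)) has_real_derivative - (f1 x + a * y x) / (b x + sg * y x) * - l (- x)) (at t)"
      by (rule DERIV_chain2[OF _ dzm]) (use dy'[OF x] in \<open>simp add: x_def\<close>)
    have gt: "g t = vector [x, y x]" by (simp add: g_def x_def)
    have "(g has_vector_derivative vector [- l (- x), - (f1 x + a * y x) / (b x + sg * y x) * - l (- x)]) (at t)"
      by (rule has_vector_derivative_vec2) (use dzm dyz in \<open>simp_all add: g_def\<close>)
    moreover have "vector [- l (- x), - (f1 x + a * y x) / (b x + sg * y x) * - l (- x)] = X (g t)"
      using bp by (simp add: gt vec_eq_iff forall_2 l_def b_def, simp add: algebra_simps)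
    ultimately show "g t $ 2 > 0 \<and> (g has_vector_derivative X (g t)) (at t)"
      using y_pos[OF x] gt by simp
  qed (use T in auto)
qed

text \<open>In the strip the abscissa has negative velocity, bounded away from 0 on a compact time
  interval. Integrating the velocity gives a strict loss, regardless of the finitely many
  exceptional times.\<close>

lemma no_periodic_arc:
  assumes "0 < T" and cont: "continuous_on {0..T} g" and "finite B"
    and sol: "\<And>t. t \<in> {0<..<T} - B \<Longrightarrow> (g has_vector_derivative X (g t)) (at t)"
    and ball: "\<And>t. t \<in> {0..T} \<Longrightarrow> norm (g t) < R"
    and y: "\<And>t. t \<in> {0..T} \<Longrightarrow> 0 \<le> g t $ 2 \<and> g t $ 2 \<le> Y"
  shows "g T \<noteq> g 0"
proof
  assume eq: "g T = g 0"
  define v where "v t = s (g t) * (e + a * g t $ 1 + sg * g t $ 2)" for t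
  have "continuous_on {0..T} (\<lambda>t. s (g t))"
    by (rule continuous_on_compose2[OF s_cont cont]) (use ball in auto)
  then have v_cont: "continuous_on {0..T} v"
    unfolding v_def using cont by (auto intro!: continuous_intros)
  have v_pos: "v t > 0" if t: "t \<in> {0..T}" for t
  proof -
    have "e + a * g t $ 1 + sg * g t $ 2 > 0"
      using slope_ge[of "g t $ 1"] comps[OF ball[OF t]] sg_ge[of "g t $ 2"] y[OF t] e_pos by linarith
    then show ?thesis using s_pos[OF ball[OF t]] by (simp add: v_def)
  qed
  obtain u where u: "u \<in> {0..T}" "\<And>t. t \<in> {0..T} \<Longrightarrow> v u \<le> v t"
    using continuous_attains_inf[OF compact_Icc _ v_cont] \<open>0 < T\<close> by auto
  have "((\<lambda>t. - v t) has_integral (g T $ 1 - g 0 $ 1)) {0..T}"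
  proof (rule fundamental_theorem_of_calculus_interior_strong[OF \<open>finite B\<close>])
    fix t assume "t \<in> {0<..<T} - B"
    from has_vector_derivative_component[OF sol[OF this], of 1]
    show "((\<lambda>t. g t $ 1) has_vector_derivative - v t) (at t)"
      by (simp add: v_def has_real_derivative_iff_has_vector_derivative)
  qed (use \<open>0 < T\<close> cont in \<open>auto intro: continuous_intros\<close>)
  moreover have "((\<lambda>t. - v u) has_integral - v u * T) {0..T}"
    using has_integral_const_real[of "- v u" 0 T] \<open>0 < T\<close> by (simp add: mult.commute)
  ultimately have "g T $ 1 - g 0 $ 1 \<le> - v u * T"
    by (rule has_integral_le) (use u in auto)
  moreover have "v u * T > 0" using v_pos[OF u(1)] \<open>0 < T\<close> by simp
  ultimately show False using eq by simp
qed

end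

subsection \<open>Orbits of piecewise smooth fields\<close>

text \<open>Switching times are locally finite, so any other time has a neighbourhood free of them,
  on which the orbit follows a single one of the three fields; the sign of the second coordinate
  tells which.\<close>

lemma pw_orbit_off_line:
  assumes orb: "pw_orbit U Z I g" and "{t0<..<t1} \<subseteq> I" and nz: "\<And>t. t \<in> {t0<..<t1} \<Longrightarrow> g t $ 2 \<noteq> 0"
  obtains B where "finite B" "\<And>t. t \<in> {t0<..<t1} - B \<Longrightarrow>
    (g has_vector_derivative (if g t $ 2 > 0 then fst Z (g t) else snd Z (g t))) (at t)"
proof -
  obtain B where B: "\<And>a b. finite (B \<inter> {a..b})"
    and sol: "\<And>s t. s < t \<Longrightarrow> {s<..<t} \<subseteq> I \<Longrightarrow> {s<..<t} \<inter> B = {} \<Longrightarrow>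
          solves_in (upper_part U) (fst Z) g {s<..<t} \<or>
          solves_in (lower_part U) (snd Z) g {s<..<t} \<or>
          solves_in (switching_line U) (filippov U Z) g {s<..<t}"
    using orb unfolding pw_orbit_def by meson
  show ?thesis
  proof (rule that[of "B \<inter> {t0..t1}"])
    fix t assume t: "t \<in> {t0<..<t1} - B \<inter> {t0..t1}"
    obtain d where d: "d > 0" "\<forall>x\<in>B \<inter> {t0..t1}. x \<noteq> t \<longrightarrow> d \<le> dist t x"
      using finite_set_avoid[OF B] by blast
    define l where "l = max t0 (t - d)"
    define r where "r = min t1 (t + d)"
    have lr: "l < t" "t < r" "{l<..<r} \<subseteq> {t0<..<t1}" using t d by (auto simp: l_def r_def)
    have "{l<..<r} \<inter> B = {}"
      using d t by (force simp: l_def r_def dist_real_def)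
    with sol[of l r] lr assms(2) consider "solves_in (upper_part U) (fst Z) g {l<..<r}"
      | "solves_in (lower_part U) (snd Z) g {l<..<r}"
      | "solves_in (switching_line U) (filippov U Z) g {l<..<r}" by fastforce
    then show "(g has_vector_derivative (if g t $ 2 > 0 then fst Z (g t) else snd Z (g t))) (at t)"
      using lr t nz[of t]
      by cases (force simp: solves_in_def upper_part_def lower_part_def switching_line_def)+
  qed (rule B)
qed

lemma pw_orbit_upper:
  assumes "pw_orbit U Z I g" "{t0<..<t1} \<subseteq> I" and pos: "\<And>t. t \<in> {t0<..<t1} \<Longrightarrow> g t $ 2 > 0"
  obtains B where "finite B" "\<And>t. t \<in> {t0<..<t1} - B \<Longrightarrow> (g has_vector_derivative fst Z (g t)) (at t)"
proof (rule pw_orbit_off_line[OF assms(1,2)])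
  show "g t $ 2 \<noteq> 0" if "t \<in> {t0<..<t1}" for t using pos[OF that] by simp
  fix B assume B: "finite B" "\<And>t. t \<in> {t0<..<t1} - B \<Longrightarrow>
    (g has_vector_derivative (if g t $ 2 > 0 then fst Z (g t) else snd Z (g t))) (at t)"
  show thesis
  proof (rule that[OF B(1)])
    show "(g has_vector_derivative fst Z (g t)) (at t)" if "t \<in> {t0<..<t1} - B" for t
      using B(2)[OF that] pos[of t] that by simp
  qed
qed

lemma pw_orbit_lower:
  assumes "pw_orbit U Z I g" "{t0<..<t1} \<subseteq> I" and neg: "\<And>t. t \<in> {t0<..<t1} \<Longrightarrow> g t $ 2 < 0"
  obtains B where "finite B" "\<And>t. t \<in> {t0<..<t1} - B \<Longrightarrow> (g has_vector_derivative snd Z (g t)) (at t)"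
proof (rule pw_orbit_off_line[OF assms(1,2)])
  show "g t $ 2 \<noteq> 0" if "t \<in> {t0<..<t1}" for t using neg[OF that] by simp
  fix B assume B: "finite B" "\<And>t. t \<in> {t0<..<t1} - B \<Longrightarrow>
    (g has_vector_derivative (if g t $ 2 > 0 then fst Z (g t) else snd Z (g t))) (at t)"
  show thesis
  proof (rule that[OF B(1)])
    show "(g has_vector_derivative snd Z (g t)) (at t)" if "t \<in> {t0<..<t1} - B" for t
      using B(2)[OF that] neg[of t] that by simp
  qed
qed

lemma filippov_crossing:
  assumes "sg * fst Z p $ 2 > 0" "sg * snd Z p $ 2 > (0::real)"
  shows "filippov U Z p = fst Z p \<or> filippov U Z p = snd Z p"
proof -
  have "fst Z p $ 2 * snd Z p $ 2 > 0"
    using assms by (auto simp: zero_less_mult_iff)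
  then show ?thesis by (auto simp: filippov_def Let_def)
qed

text \<open>Near a crossing point all three regimes give \<open>sg * g t $ 2\<close> a positive
  derivative, since the Filippov value there is one of the two fields. So the orbit passes strictly
  from one side to the other and cannot stay on the line. The factor \<open>sg\<close> treats upward
  and downward crossings together.\<close>

lemma pw_orbit_crossing:
  assumes orb: "pw_orbit U Z UNIV g" and y: "g t0 $ 2 = 0"
    and sg: "sg * fst Z (g t0) $ 2 > 0" "sg * snd Z (g t0) $ 2 > (0::real)"
    and cont: "isCont (fst Z) (g t0)" "isCont (snd Z) (g t0)"
  obtains d where "d > 0" "\<And>t. t \<in> {t0<..<t0 + d} \<Longrightarrow> sg * g t $ 2 > 0"
    "\<And>t. t \<in> {t0 - d<..<t0} \<Longrightarrow> sg * g t $ 2 < 0"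
proof -
  obtain B where B: "\<And>a b. finite (B \<inter> {a..b})"
    and sol: "\<And>s t. s < t \<Longrightarrow> {s<..<t} \<inter> B = {} \<Longrightarrow>
          solves_in (upper_part U) (fst Z) g {s<..<t} \<or>
          solves_in (lower_part U) (snd Z) g {s<..<t} \<or>
          solves_in (switching_line U) (filippov U Z) g {s<..<t}"
    using orb unfolding pw_orbit_def by (metis subset_UNIV)
  have gc: "isCont g t" for t using orb by (simp add: pw_orbit_def continuous_on_eq_continuous_at)
  have yc: "continuous_on A (\<lambda>t. sg * g t $ 2)" for A
    using gc by (intro continuous_at_imp_continuous_on ballI continuous_intros) auto
  have "isCont (\<lambda>t. sg * fst Z (g t) $ 2) t0" "isCont (\<lambda>t. sg * snd Z (g t) $ 2) t0"
    using isCont_o2[OF gc cont(1)] isCont_o2[OF gc cont(2)] by (auto intro!: continuous_intros)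
  then have "\<forall>\<^sub>F t in at t0. sg * fst Z (g t) $ 2 > 0" "\<forall>\<^sub>F t in at t0. sg * snd Z (g t) $ 2 > 0"
    using sg by (auto simp: isCont_def intro: order_tendstoD)
  then have "\<forall>\<^sub>F t in at t0. sg * fst Z (g t) $ 2 > 0 \<and> sg * snd Z (g t) $ 2 > 0"
    by (rule eventually_conj)
  then obtain d1 where d1: "d1 > 0"
      "\<And>t. t \<noteq> t0 \<Longrightarrow> dist t t0 < d1 \<Longrightarrow> sg * fst Z (g t) $ 2 > 0 \<and> sg * snd Z (g t) $ 2 > 0"
    unfolding eventually_at by auto
  obtain d2 where d2: "d2 > 0" "\<forall>x\<in>B \<inter> {t0 - 1..t0 + 1}. x \<noteq> t0 \<longrightarrow> d2 \<le> dist t0 x"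
    using finite_set_avoid[OF B] by blast
  define d where "d = min 1 (min d1 d2)"
  have d: "d > 0" "d \<le> 1" "d \<le> d1" "d \<le> d2" using d1 d2 by (auto simp: d_def)
  have slope: "\<exists>v. ((\<lambda>t. sg * g t $ 2) has_real_derivative v) (at u) \<and> v > 0"
    if "u \<in> {l<..<r}" "{l<..<r} \<inter> B = {}" "\<And>u. u \<in> {l<..<r} \<Longrightarrow> u \<noteq> t0 \<and> dist u t0 < d" for u l r
  proof -
    have u: "sg * fst Z (g u) $ 2 > 0" "sg * snd Z (g u) $ 2 > 0"
      using d1(2)[of u] that(3)[OF that(1)] d by auto
    have "l < r" using that(1) by auto
    then have "(g has_vector_derivative fst Z (g u)) (at u) \<or> (g has_vector_derivative snd Z (g u)) (at u)"
      using sol[of l r] that(1,2) filippov_crossing[OF u, of U] unfolding solves_in_def by metis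
    then show ?thesis
      using u by (auto dest!: has_vector_derivative_component[where i = 2] intro: DERIV_cmult)
  qed
  show ?thesis
  proof (rule that[OF d(1)])
    fix t assume t: "t \<in> {t0<..<t0 + d}"
    have "{t0<..<t0 + d} \<inter> B = {}"
      using d2 d by (force simp: dist_real_def)
    then have "sg * g t0 $ 2 < sg * g t $ 2"
      using t by (intro DERIV_pos_imp_increasing_open[OF _ _ yc] slope[of _ t0 "t0 + d"])
        (auto simp: dist_real_def)
    then show "sg * g t $ 2 > 0" using y by simp
  next
    fix t assume t: "t \<in> {t0 - d<..<t0}"
    have "{t0 - d<..<t0} \<inter> B = {}"
      using d2 d by (force simp: dist_real_def)
    then have "sg * g t $ 2 < sg * g t0 $ 2"
      using t by (intro DERIV_pos_imp_increasing_open[OF _ _ yc] slope[of _ "t0 - d" t0])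
        (auto simp: dist_real_def)
    then show "sg * g t $ 2 < 0" using y by simp
  qed
qed

section \<open>Next zero of a function, and periodic continuation of a loop\<close>

lemma first_zero_after:
  fixes y :: "real \<Rightarrow> real"
  assumes cont: "continuous_on UNIV y" and "d > 0" and pos: "\<And>t. t \<in> {t0<..<t0 + d} \<Longrightarrow> y t > 0"
    and "t0 < t'" "y t' = 0"
  obtains t1 where "t0 < t1" "t1 \<le> t'" "y t1 = 0" "\<And>t. t \<in> {t0<..<t1} \<Longrightarrow> y t > 0"
proof -
  define A where "A = {t0 + d..t'} \<inter> {t. y t = 0}"
  have "t' \<ge> t0 + d" using pos[of t'] assms(4,5) by force
  then have "A \<noteq> {}" using assms(5) by (auto simp: A_def)
  have "compact A"
    unfolding A_def using cont by (intro compact_Int_closed closed_Collect_eq) auto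
  then obtain t1 where t1: "t1 \<in> A" "\<And>t. t \<in> A \<Longrightarrow> t1 \<le> t"
    using compact_attains_inf[OF _ \<open>A \<noteq> {}\<close>] by blast
  show ?thesis
  proof (rule that[of t1])
    fix t assume t: "t \<in> {t0<..<t1}"
    show "y t > 0"
    proof (rule ccontr)
      assume "\<not> y t > 0"
      then have "t \<ge> t0 + d" using pos[of t] t by force
      have "y (t0 + d / 2) > 0" using pos[of "t0 + d / 2"] \<open>d > 0\<close> by (simp add: field_simps)
      then obtain u where "t0 + d / 2 \<le> u" "u \<le> t" "y u = 0"
        using IVT2'[of y t 0 "t0 + d / 2"] \<open>\<not> y t > 0\<close> \<open>t \<ge> t0 + d\<close> \<open>d > 0\<close>
          continuous_on_subset[OF cont] by (auto simp: not_less)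
      then have "u \<in> A" "u < t1" using pos[of u] t t1(1) \<open>d > 0\<close> by (force simp: A_def)+
      then show False using t1(2) by force
    qed
  qed (use t1 \<open>d > 0\<close> in \<open>auto simp: A_def\<close>)
qed

lemma periodic_extension:
  fixes g :: "real \<Rightarrow> real^2"
  assumes T: "0 < T1" "T1 < T" and cont: "continuous_on {0..T} g" and loop: "g T = g 0"
    and U: "g ` {0..T} \<subseteq> U"
    and up: "solves_in (upper_part U) (fst Z) g {0<..<T1}"
    and lo: "solves_in (lower_part U) (snd Z) g {T1<..<T}"
  obtains G where "pw_orbit U Z UNIV G" "\<And>t. G (t + T) = G t" "range G = g ` {0..T}"
    "\<And>t. t \<in> {0..T} \<Longrightarrow> G t = g t"
proof -
  have "T > 0" using T by simp
  define G where "G t = g (t - of_int \<lfloor>t / T\<rfloor> * T)" for t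
  have red: "t - of_int \<lfloor>t / T\<rfloor> * T \<in> {0..<T}" for t
    using floor_divide_lower[OF \<open>T > 0\<close>, of t] floor_divide_upper[OF \<open>T > 0\<close>, of t]
    by (auto simp: algebra_simps)
  \<comment> \<open>The right end of each period is included: there the floor already belongs to the
    next period, and \<open>g T = g 0\<close> reconciles the two values. Continuity at multiples of
    \<open>T\<close> rests on this.\<close>
  have G_eq: "G t = g (t - of_int n * T)" if "of_int n * T \<le> t" "t \<le> (of_int n + 1) * T" for t n
  proof (cases "t = (of_int n + 1) * T")
    case True
    then have "t / T = of_int (n + 1)" using \<open>T > 0\<close> by simp
    then have "\<lfloor>t / T\<rfloor> = n + 1" by (simp only: floor_of_int)
    then show ?thesis using True loop by (simp add: G_def algebra_simps)
  next
    case False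
    then have "\<lfloor>t / T\<rfloor> = n"
      using that \<open>T > 0\<close> by (intro floor_unique) (auto simp: field_simps)
    then show ?thesis by (simp add: G_def)
  qed
  have piece: "continuous_on {of_int n * T..(of_int n + 1) * T} G" for n :: int
  proof (subst continuous_on_cong[OF refl G_eq])
    show "continuous_on {of_int n * T..(of_int n + 1) * T} (\<lambda>t. g (t - of_int n * T))"
      by (rule continuous_on_compose2[OF cont]) (auto intro!: continuous_intros simp: algebra_simps)
  qed auto
  have Gc: "isCont G t" for t
  proof -
    define n where "n = \<lfloor>t / T\<rfloor>"
    have n: "of_int n * T \<le> t" "t < (of_int n + 1) * T"
      using red[of t] by (auto simp: n_def algebra_simps)
    have "continuous_on ({of_int (n - 1) * T..(of_int (n - 1) + 1) * T} \<union> {of_int n * T..(of_int n + 1) * T}) G"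
      by (intro continuous_on_closed_Un piece) auto
    moreover have "{of_int (n - 1) * T..(of_int (n - 1) + 1) * T} \<union> {of_int n * T..(of_int n + 1) * T}
        = {(of_int n - 1) * T..(of_int n + 1) * T}"
      using \<open>T > 0\<close> by (auto simp: algebra_simps)
    ultimately show ?thesis
      using n \<open>T > 0\<close> by (auto intro!: continuous_on_interior simp: algebra_simps)
  qed
  have per: "G (t + T) = G t" for t
  proof -
    have "(t + T) / T = t / T + 1" using \<open>T > 0\<close> by (simp add: field_simps)
    then show ?thesis by (simp add: G_def algebra_simps)
  qed
  have G_g: "G t = g t" if "t \<in> {0..T}" for t using G_eq[of 0 t] that by simp
  have rng: "range G = g ` {0..T}"
  proof
    show "range G \<subseteq> g ` {0..T}" using red by (force simp: G_def)
    show "g ` {0..T} \<subseteq> range G" using G_g by (metis image_subsetI rangeI)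
  qed
  define B where "B = range (\<lambda>n :: int. of_int n * T) \<union> range (\<lambda>n :: int. of_int n * T + T1)"
  have finB: "finite (B \<inter> {a..b})" for a b
  proof -
    define N where "N = {\<lfloor>a / T\<rfloor> - 1..\<lceil>b / T\<rceil>}"
    have "B \<inter> {a..b} \<subseteq> (\<lambda>n :: int. of_int n * T) ` N \<union> (\<lambda>n :: int. of_int n * T + T1) ` N"
    proof
      fix x assume "x \<in> B \<inter> {a..b}"
      then obtain n :: int and c where n: "x = of_int n * T + c" "c = 0 \<or> c = T1" "a \<le> x" "x \<le> b"
        by (auto simp: B_def) (metis add.right_neutral)
      have "of_int n * T \<le> b" "a < (of_int n + 1) * T" using n T by (auto simp: algebra_simps)
      then have "of_int n \<le> b / T" "a / T < of_int n + 1" using \<open>T > 0\<close> by (auto simp: field_simps)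
      then have "n \<in> N" unfolding N_def by (simp, linarith)
      then show "x \<in> (\<lambda>n :: int. of_int n * T) ` N \<union> (\<lambda>n :: int. of_int n * T + T1) ` N" using n by auto
    qed
    then show ?thesis by (rule finite_subset) (simp add: N_def)
  qed
  have shift: "G t \<in> D \<and> (G has_vector_derivative F (G t)) (at t)"
    if "solves_in D F g {l<..<r}" "0 \<le> l" "r \<le> T" "t \<in> {of_int n * T + l<..<of_int n * T + r}" for D F l r t and n :: int
  proof -
    define u where "u = t - of_int n * T"
    have u: "u \<in> {l<..<r}" using that(4) by (auto simp: u_def)
    have Gt: "G w = g (w - of_int n * T)" if "w \<in> {of_int n * T + l<..<of_int n * T + r}" for w
      using that \<open>0 \<le> l\<close> \<open>r \<le> T\<close> by (intro G_eq) (auto simp: algebra_simps)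
    have "(g has_vector_derivative F (g u)) (at u)" "g u \<in> D" using that(1) u by (auto simp: solves_in_def)
    then have "((\<lambda>w. g (w - of_int n * T)) has_vector_derivative F (g u)) (at t)"
      using vector_diff_chain_at[OF has_vector_derivative_diff[OF has_vector_derivative_id
          has_vector_derivative_const], of g "F (g u)" t "of_int n * T"]
      by (simp add: u_def o_def)
    then have "(G has_vector_derivative F (g u)) (at t)"
      by (rule has_vector_derivative_transform_within_open[where S = "{of_int n * T + l<..<of_int n * T + r}"])
         (use that(4) Gt in auto)
    then show ?thesis using Gt[OF that(4)] \<open>g u \<in> D\<close> by (simp add: u_def)
  qed
  have "pw_orbit U Z UNIV G"
    unfolding pw_orbit_def
  proof (intro conjI exI[of _ B] allI impI)
    show "continuous_on UNIV G" using Gc by (simp add: continuous_at_imp_continuous_on)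
    show "range G \<subseteq> U" using rng U by simp
    show "finite (B \<inter> {a..b})" for a b by (rule finB)
    fix s t :: real
    assume st: "s < t \<and> {s<..<t} \<subseteq> UNIV \<and> {s<..<t} \<inter> B = {}"
    define n where "n = \<lfloor>s / T\<rfloor>"
    have n: "of_int n * T \<le> s" "s < (of_int n + 1) * T"
      using red[of s] by (auto simp: n_def algebra_simps)
    have notB: "v \<le> s \<or> t \<le> v" if "v \<in> B" for v using st that by (meson IntI disjoint_iff greaterThanLessThan_iff not_le)
    have "of_int (n + 1) * T \<in> B" "of_int n * T + T1 \<in> B" by (auto simp only: B_def)
    then have b: "t \<le> (of_int n + 1) * T" "of_int n * T + T1 \<le> s \<or> t \<le> of_int n * T + T1"
      using notB[of "of_int (n + 1) * T"] notB[of "of_int n * T + T1"] n by auto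
    show "solves_in (upper_part U) (fst Z) G {s<..<t} \<or> solves_in (lower_part U) (snd Z) G {s<..<t} \<or>
        solves_in (switching_line U) (filippov U Z) G {s<..<t}"
    proof (cases "t \<le> of_int n * T + T1")
      case True
      then have "solves_in (upper_part U) (fst Z) G {s<..<t}"
        using n T shift[OF up, of _ n] by (auto simp: solves_in_def)
      then show ?thesis by simp
    next
      case False
      then have "solves_in (lower_part U) (snd Z) G {s<..<t}"
        using n T b shift[OF lo, of _ n] by (auto simp: solves_in_def algebra_simps)
      then show ?thesis by simp
    qed
  qed
  then show ?thesis using per rng G_g that by blast
qed

subsection \<open>The return map and its cycles\<close>

text \<open>Rotation by pi turns the lower half plane into an upper one, so both halves are
  instances of one locale. The bounds in \<open>d_le\<close> come from the loop starting at x < d: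
  its upper level is at most b1 x^2 because |k x| <= x^2 / 2, and it returns at P x < 2 x, so the
  lower level is below b2 (2 d)^2 / 2; all its abscissas are below 2 d in absolute value and its
  heights below Y.\<close>

locale perturbed_pair =
  up: half_plane R e a1 sg Y "\<lambda>x. b1 * (x\<^sup>2 / 2 + k x)" "\<lambda>x. b1 * (x + k1 x)" s1 +
  lo: half_plane R e a2 sg Y "\<lambda>x. b2 * (x\<^sup>2 / 2)" "\<lambda>x. b2 * x" s2
  for R e a1 a2 sg Y b1 b2 k k1 s1 s2 +
  fixes U :: "(real^2) set" and Z :: pwfield and d :: real
  assumes U: "ball 0 R \<subseteq> U"
    and fst_Z: "\<And>p. norm p < R \<Longrightarrow> fst Z p = half_field s1 e a1 sg (\<lambda>x. b1 * (x + k1 x)) p"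
    and snd_Z: "\<And>p. norm p < R \<Longrightarrow> snd Z p = - half_field s2 e a2 sg (\<lambda>x. b2 * x) (- p)"
    and Z_cont: "continuous_on (ball 0 R) (fst Z)" "continuous_on (ball 0 R) (snd Z)"
    and b1_pos: "b1 > 0" and b2_pos: "b2 > 0" and d_pos: "d > 0"
    and k_deriv: "\<And>x. \<bar>x\<bar> < R \<Longrightarrow> (k has_real_derivative k1 x) (at x)"
    and k1_le: "\<And>x. \<bar>x\<bar> < R \<Longrightarrow> \<bar>k1 x\<bar> \<le> \<bar>x\<bar> / 2"
    and k_0: "\<And>x. x \<le> 0 \<Longrightarrow> k x = 0"
    and k_zero: "\<And>x. 0 < x \<Longrightarrow> x < R \<Longrightarrow> k x = 0 \<Longrightarrow> x < d \<and> k1 x \<noteq> 0"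
    and d_le: "2 * d + Y < R" "b1 * d\<^sup>2 < Y * e / 2" "2 * b2 * d\<^sup>2 < Y * e / 2"
begin

definition P :: "real \<Rightarrow> real" where "P x = sqrt (x\<^sup>2 + 2 * k x)"

text \<open>The upper level of the point (x, 0) also contains b1 k x; it is left out because the set
  serves only for zeros of \<open>k\<close>.\<close>

definition cycle :: "real \<Rightarrow> (real^2) set" where
  "cycle x = up.arc (b1 * (x\<^sup>2 / 2)) \<union> uminus ` lo.arc (b2 * (x\<^sup>2 / 2))"

section \<open>The return map as a real function\<close>

lemma k_abs_le: assumes "0 < x" "x < R" shows "\<bar>k x\<bar> \<le> x\<^sup>2 / 2"
proof -
  obtain u where u: "0 < u" "u < x" "k x - k 0 = (x - 0) * k1 u"
    using MVT2[of 0 x k k1] assms k_deriv by force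
  have "\<bar>k1 u\<bar> \<le> x / 2" using k1_le[of u] u assms by auto
  then have "\<bar>x * k1 u\<bar> \<le> x * (x / 2)" using assms by (simp add: abs_mult mult_left_mono del: times_divide_eq_right)
  then show ?thesis using u(3) k_0[of 0] by (simp add: power2_eq_square)
qed

lemma radicand_pos: assumes "0 < x" "x < R" shows "x\<^sup>2 + 2 * k x > 0"
  using up.f_strict_incr[of 0 x] assms up.f_0 b1_pos by (simp add: zero_less_mult_iff add_pos_pos)

lemma P_sq: "0 < x \<Longrightarrow> x < R \<Longrightarrow> (P x)\<^sup>2 = x\<^sup>2 + 2 * k x"
  using radicand_pos[of x] by (simp add: P_def)

lemma P_pos: "0 < x \<Longrightarrow> x < R \<Longrightarrow> P x > 0"
  using radicand_pos[of x] by (simp add: P_def)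

lemma P_less: assumes "0 < x" "x < R" shows "P x < 2 * x"
proof (rule power_less_imp_less_base[where n = 2])
  have "x\<^sup>2 > 0" using assms by (simp del: zero_less_power2)
  moreover have "(P x)\<^sup>2 \<le> 2 * x\<^sup>2" using P_sq[OF assms] k_abs_le[OF assms] by simp
  ultimately have "(P x)\<^sup>2 < 4 * x\<^sup>2" by linarith
  then show "(P x)\<^sup>2 < (2 * x)\<^sup>2" by (simp add: power_mult_distrib)
qed (use assms in simp)

lemma P_mono: assumes "0 < x" "x \<le> y" "y < R" shows "P x \<le> P y"
proof (cases "x = y")
  case False
  then show ?thesis
    using up.f_strict_incr[of x y] assms b1_pos by (auto simp: P_def)
qed simp

lemma P_fix_iff: "0 < x \<Longrightarrow> x < R \<Longrightarrow> P x = x \<longleftrightarrow> k x = 0"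
  using P_sq[of x] P_pos[of x] by (metis add_cancel_right_right less_imp_le mult_eq_0_iff power2_eq_imp_eq zero_neq_numeral)

lemma P_deriv:
  assumes "0 < x" "x < R" "k x = 0"
  shows "(P has_real_derivative (1 + k1 x / x)) (at x)"
proof -
  have "((\<lambda>x. x\<^sup>2 + 2 * k x) has_real_derivative (2 * x + 2 * k1 x)) (at x)"
    using k_deriv[of x] assms by (auto intro!: derivative_eq_intros)
  from DERIV_chain2[OF DERIV_real_sqrt[OF radicand_pos[OF assms(1,2)]] this]
  have "(P has_real_derivative inverse (sqrt (x\<^sup>2 + 2 * k x)) / 2 * (2 * x + 2 * k1 x)) (at x)"
    unfolding P_def .
  moreover have "inverse (sqrt (x\<^sup>2 + 2 * k x)) / 2 * (2 * x + 2 * k1 x) = 1 + k1 x / x"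
    using assms by (simp add: field_simps)
  ultimately show ?thesis by (simp only:)
qed

lemma crossing_values:
  assumes "norm p < R" "p $ 2 = 0" "p $ 1 \<noteq> 0"
  shows "sgn (p $ 1) * fst Z p $ 2 > 0" "sgn (p $ 1) * snd Z p $ 2 > 0"
proof -
  have x: "\<bar>p $ 1\<bar> < R" using up.comps assms(1) by auto
  have "sgn (p $ 1) * (b1 * (p $ 1 + k1 (p $ 1))) > 0"
    using up.f1_pos[of "p $ 1"] up.f1_neg[of "p $ 1"] x assms(3)
    by (cases "p $ 1" "0 :: real" rule: linorder_cases) auto
  then have "s1 p * (sgn (p $ 1) * (b1 * (p $ 1 + k1 (p $ 1)))) > 0"
    using up.s_pos[OF assms(1)] by simp
  then show "sgn (p $ 1) * fst Z p $ 2 > 0"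
    using fst_Z[OF assms(1)] assms(2) by (simp add: mult.left_commute)
  have "s2 (- p) * (b2 * \<bar>p $ 1\<bar>) > 0"
    using lo.s_pos[of "- p"] assms b2_pos by simp
  then show "sgn (p $ 1) * snd Z p $ 2 > 0"
    using snd_Z[OF assms(1)] assms(2) by (simp add: mult.left_commute abs_sgn mult_ac)
qed

lemma crossing_iff:
  assumes "norm p < R" "p $ 2 = 0"
  shows "p \<in> crossing_set U Z \<longleftrightarrow> p $ 1 \<noteq> 0"
proof
  assume "p $ 1 \<noteq> 0"
  from crossing_values[OF assms this] have "fst Z p $ 2 * snd Z p $ 2 > 0"
    by (auto simp: zero_less_mult_iff)
  then show "p \<in> crossing_set U Z"
    using assms U by (auto simp: crossing_set_def switching_line_def)
next
  assume "p \<in> crossing_set U Z"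
  then show "p $ 1 \<noteq> 0"
    using fst_Z[OF assms(1)] assms k1_le[of 0] up.R_pos by (auto simp: crossing_set_def)
qed


section \<open>Constructed loops, their cycles and the Poincare map\<close>

lemma loop_exists:
  assumes x: "0 < x" "x < d"
  obtains T1 T g where "0 < T1" "T1 < T" "continuous_on {0..T} g"
    "g 0 = vector [x, 0]" "g T1 = vector [- P x, 0]" "g T = vector [P x, 0]"
    "\<And>t. t \<in> {0<..<T1} \<Longrightarrow> g t $ 2 > 0" "\<And>t. t \<in> {T1<..<T} \<Longrightarrow> g t $ 2 < 0"
    "\<And>t. t \<in> {0..T} \<Longrightarrow> norm (g t) < 2 * d + Y \<and> \<bar>g t $ 2\<bar> < Y"
    "solves_in (upper_part U) (fst Z) g {0<..<T1}" "solves_in (lower_part U) (snd Z) g {T1<..<T}"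
    "P x = x \<Longrightarrow> g ` {0..T} = cycle x"
proof -
  have xR: "x < R" "d < R" using x d_le d_pos up.Y_pos by auto
  note Pp = P_pos[OF x(1) xR(1)] and P2 = P_less[OF x(1) xR(1)]
  have fx: "b1 * (x\<^sup>2 / 2 + k x) < Y * e / 2" "b2 * ((P x)\<^sup>2 / 2) < Y * e / 2"
  proof -
    have "x\<^sup>2 \<le> d\<^sup>2" using x by (intro power_mono) auto
    then have "x\<^sup>2 / 2 + k x \<le> d\<^sup>2" using k_abs_le[OF x(1) xR(1)] by simp
    then show "b1 * (x\<^sup>2 / 2 + k x) < Y * e / 2"
      using d_le(2) mult_left_mono[of "x\<^sup>2 / 2 + k x" "d\<^sup>2" b1] b1_pos by linarith
    have "(P x)\<^sup>2 \<le> (2 * d)\<^sup>2" using P2 Pp x by (intro power_mono) auto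
    then have "(P x)\<^sup>2 / 2 \<le> 2 * d\<^sup>2" by (simp add: power_mult_distrib)
    then show "b2 * ((P x)\<^sup>2 / 2) < Y * e / 2"
      using d_le(3) mult_left_mono[of "(P x)\<^sup>2 / 2" "2 * d\<^sup>2" b2] b2_pos by linarith
  qed
  \<comment> \<open>Since \<open>k\<close> vanishes on the left, -P x lies on the same upper level
    as x; the formula for \<open>P\<close> solves exactly this equation.\<close>
  have fP: "b1 * ((- P x)\<^sup>2 / 2 + k (- P x)) = b1 * (x\<^sup>2 / 2 + k x)"
    using P_sq[OF x(1) xR(1)] k_0[of "- P x"] Pp by (simp add: field_simps)
  obtain T1 g1 where g1: "T1 > 0" "continuous_on {0..T1} g1" "g1 0 = vector [x, 0]" "g1 T1 = vector [- P x, 0]"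
    "\<And>t. t \<in> {0<..<T1} \<Longrightarrow> g1 t $ 2 > 0 \<and> (g1 has_vector_derivative up.X (g1 t)) (at t)"
    "\<And>t. t \<in> {0..T1} \<Longrightarrow> - P x \<le> g1 t $ 1 \<and> g1 t $ 1 \<le> x \<and> 0 \<le> g1 t $ 2 \<and> g1 t $ 2 < Y"
    using up.excursion_exists[of x "- P x", OF _ _ _ _ refl fP fx(1)] x xR Pp P2 d_le(1) by auto
  obtain T2 g2 where g2: "T2 > 0" "continuous_on {0..T2} g2" "g2 0 = vector [P x, 0]" "g2 T2 = vector [- P x, 0]"
    "\<And>t. t \<in> {0<..<T2} \<Longrightarrow> g2 t $ 2 > 0 \<and> (g2 has_vector_derivative lo.X (g2 t)) (at t)"
    "\<And>t. t \<in> {0..T2} \<Longrightarrow> - P x \<le> g2 t $ 1 \<and> g2 t $ 1 \<le> P x \<and> 0 \<le> g2 t $ 2 \<and> g2 t $ 2 < Y"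
    using lo.excursion_exists[of "P x" "- P x", OF _ _ _ _ refl _ fx(2)] x xR Pp P2 d_le(1) by auto
  have n1: "norm (g1 t) < 2 * d + Y \<and> \<bar>g1 t $ 2\<bar> < Y" if "t \<in> {0..T1}" for t
    using norm_vec2_le[of "g1 t"] g1(6)[OF that] x P2 d_pos by auto
  have n2: "norm (g2 t) < 2 * d + Y \<and> \<bar>g2 t $ 2\<bar> < Y" if "t \<in> {0..T2}" for t
    using norm_vec2_le[of "g2 t"] g2(6)[OF that] x P2 d_pos by auto
  \<comment> \<open>\<open>g2\<close> runs in the upper half plane from P x to -P x; its negative is
    the lower arc from -P x back to P x.\<close>
  define g where "g t = (if t \<le> T1 then g1 t else - g2 (t - T1))" for t
  have gl: "g t = - g2 (t - T1)" if "T1 \<le> t" for t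
    using that g1(4) g2(3) by (auto simp: g_def vec_eq_iff forall_2)
  have gc: "continuous_on ({0..T1} \<union> {T1..T1 + T2}) g"
  proof (rule continuous_on_closed_Un)
    show "continuous_on {0..T1} g"
      using g1(2) by (rule continuous_on_eq) (auto simp: g_def)
    have "continuous_on {T1..T1 + T2} (\<lambda>t. - g2 (t - T1))"
      by (intro continuous_intros continuous_on_compose2[OF g2(2)]) auto
    then show "continuous_on {T1..T1 + T2} g"
      by (rule continuous_on_eq) (use gl in auto)
  qed auto
  show ?thesis
  proof (rule that[of T1 "T1 + T2" g])
    show "continuous_on {0..T1 + T2} g"
      using gc g1(1) g2(1) by (simp add: ivl_disj_un_two_touch)
    show "g 0 = vector [x, 0]" "g T1 = vector [- P x, 0]" using g1 by (auto simp: g_def)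
    show "g (T1 + T2) = vector [P x, 0]" using gl[of "T1 + T2"] g2 by (simp add: vec_eq_iff forall_2)
    show "g t $ 2 > 0" if "t \<in> {0<..<T1}" for t using that g1(5)[OF that] by (simp add: g_def)
    show "g t $ 2 < 0" if "t \<in> {T1<..<T1 + T2}" for t using that g2(5)[of "t - T1"] by (simp add: g_def)
    show "norm (g t) < 2 * d + Y \<and> \<bar>g t $ 2\<bar> < Y" if "t \<in> {0..T1 + T2}" for t
      using that n1[of t] n2[of "t - T1"] by (auto simp: g_def)
    show "solves_in (upper_part U) (fst Z) g {0<..<T1}"
      unfolding solves_in_def
    proof (rule ballI)
      fix t assume t: "t \<in> {0<..<T1}"
      have n: "norm (g1 t) < R" using n1[of t] t d_le(1) by auto
      have "(g has_vector_derivative fst Z (g t)) (at t)"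
        using has_vector_derivative_transform_within_open[of g1 "fst Z (g1 t)" t "{0<..<T1}" g]
          g1(5)[OF t] t fst_Z[OF n] by (simp add: g_def)
      then show "g t \<in> upper_part U \<and> (g has_vector_derivative fst Z (g t)) (at t)"
        using n U g1(5)[OF t] t by (auto simp: upper_part_def g_def)
    qed
    show "solves_in (lower_part U) (snd Z) g {T1<..<T1 + T2}"
      unfolding solves_in_def
    proof (rule ballI)
      fix t assume t: "t \<in> {T1<..<T1 + T2}"
      have n: "norm (g2 (t - T1)) < R" using n2[of "t - T1"] t d_le(1) by auto
      have "((\<lambda>t. - g2 (t - T1)) has_vector_derivative - lo.X (g2 (t - T1))) (at t)"
        using has_vector_derivative_minus[OF vector_diff_chain_at[OF has_vector_derivative_diff[OF has_vector_derivative_id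
          has_vector_derivative_const], of g2 "lo.X (g2 (t - T1))" t T1]] g2(5)[of "t - T1"] t
        by (simp add: o_def)
      then have "(g has_vector_derivative - lo.X (g2 (t - T1))) (at t)"
        by (rule has_vector_derivative_transform_within_open[where S = "{T1<..<T1 + T2}"])
          (use t in \<open>auto simp: g_def\<close>)
      moreover have "snd Z (g t) = - lo.X (g2 (t - T1))" using snd_Z[of "g t"] n gl[of t] t by simp
      ultimately show "g t \<in> lower_part U \<and> (g has_vector_derivative snd Z (g t)) (at t)"
        using n U g2(5)[of "t - T1"] t gl[of t] by (auto simp: lower_part_def)
    qed
    show "g ` {0..T1 + T2} = cycle x" if Px: "P x = x"
    proof -
      have kx: "k x = 0" using P_fix_iff[OF x(1) xR(1)] Px by simp
      have n1R: "norm (g1 t) < R" if "t \<in> {0..T1}" for t using n1[OF that] d_le(1) by simp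
      have n2R: "norm (g2 t) < R" if "t \<in> {0..T2}" for t using n2[OF that] d_le(1) by simp
      have "g1 ` {0..T1} = up.arc (b1 * (x\<^sup>2 / 2))"
        by (rule up.excursion_image[where B = "{}"])
           (use g1 n1R fx kx Pp x in auto)
      moreover have "g2 ` {0..T2} = lo.arc (b2 * (x\<^sup>2 / 2))"
        by (rule lo.excursion_image[where B = "{}"])
           (use g2 n2R fx Px Pp x in auto)
      moreover have "{0..T1 + T2} = {0..T1} \<union> {T1..T1 + T2}"
        using g1(1) g2(1) by (simp add: ivl_disj_un_two_touch)
      moreover have "g ` {0..T1} = g1 ` {0..T1}" by (auto simp: g_def)
      moreover have "g ` {T1..T1 + T2} = (\<lambda>t. - g2 (t - T1)) ` {T1..T1 + T2}" using gl by (intro image_cong) auto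
      moreover have "\<dots> = uminus ` g2 ` {0..T2}"
      proof -
        have "{T1..T1 + T2} = (\<lambda>t. t + T1) ` {0..T2}" by (simp add: add.commute)
        then show ?thesis by (simp only: image_image add_diff_cancel_right')
      qed
      ultimately show ?thesis by (simp add: cycle_def image_Un)
    qed
  qed (use g1 g2 in auto)
qed

lemma cycle_properties:
  assumes x: "0 < x" "x < R" "k x = 0"
  shows "p \<in> cycle x \<Longrightarrow> norm p < 2 * d + Y \<and> \<bar>p $ 2\<bar> < Y"
    and "p \<in> cycle x \<and> p $ 2 = 0 \<longleftrightarrow> p = vector [x, 0] \<or> p = vector [- x, 0]"
    and "periodic_orbit U Z (cycle x)"
proof -
  have xd: "x < d" using k_zero x by blast
  have Px: "P x = x" using P_fix_iff x by simp
  obtain T1 T g where T: "0 < T1" "T1 < T" and gc: "continuous_on {0..T} g"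
    and g: "g 0 = vector [x, 0]" "g T1 = vector [- x, 0]" "g T = vector [x, 0]"
    and pos: "\<And>t. t \<in> {0<..<T1} \<Longrightarrow> g t $ 2 > 0" and neg: "\<And>t. t \<in> {T1<..<T} \<Longrightarrow> g t $ 2 < 0"
    and bd: "\<And>t. t \<in> {0..T} \<Longrightarrow> norm (g t) < 2 * d + Y \<and> \<bar>g t $ 2\<bar> < Y"
    and sol: "solves_in (upper_part U) (fst Z) g {0<..<T1}" "solves_in (lower_part U) (snd Z) g {T1<..<T}"
    and img: "g ` {0..T} = cycle x"
    using loop_exists[OF x(1) xd] Px by metis
  show "p \<in> cycle x \<Longrightarrow> norm p < 2 * d + Y \<and> \<bar>p $ 2\<bar> < Y"
    using bd img by (metis imageE)
  show "p \<in> cycle x \<and> p $ 2 = 0 \<longleftrightarrow> p = vector [x, 0] \<or> p = vector [- x, 0]"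
  proof
    assume p: "p \<in> cycle x \<and> p $ 2 = 0"
    then obtain t where t: "t \<in> {0..T}" "p = g t" using img by (metis imageE)
    then have "t = 0 \<or> t = T1 \<or> t = T" using pos[of t] neg[of t] p by force
    then show "p = vector [x, 0] \<or> p = vector [- x, 0]" using t g by auto
  next
    have "0 \<in> {0..T}" "T1 \<in> {0..T}" using T by auto
    then have "vector [x, 0] \<in> cycle x" "vector [- x, 0] \<in> cycle x" using g img by (metis imageI)+
    then show "p = vector [x, 0] \<or> p = vector [- x, 0] \<Longrightarrow> p \<in> cycle x \<and> p $ 2 = 0" by auto
  qed
  have gU: "g ` {0..T} \<subseteq> U" using bd U d_le(1) by force
  have "g T = g 0" using g by simp
  from periodic_extension[OF T gc this gU sol] obtain G where
    G: "pw_orbit U Z UNIV G" "\<And>t. G (t + T) = G t" "range G = g ` {0..T}" "\<And>t. t \<in> {0..T} \<Longrightarrow> G t = g t"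
    by blast
  have "G T1 \<noteq> G 0" using G(4)[of T1] G(4)[of 0] g T x by simp
  then have "\<exists>t. G t \<noteq> G 0" by blast
  moreover have "T > 0" "cycle x = range G" using T img G(3) by auto
  ultimately show "periodic_orbit U Z (cycle x)"
    unfolding periodic_orbit_def using G(1,2) by blast
qed

text \<open>Radius x makes the section the points with abscissa strictly between 0 and 2 x. The
  intermediate crossing at -P z is outside it, so the end of the full loop is the first
  return.\<close>

lemma poincare_map_P:
  assumes x: "0 < x" "x < R" "k x = 0"
  shows "poincare_map U Z x x P"
proof -
  have xd: "x < d" using k_zero x by blast
  have Px: "P x = x" using P_fix_iff x by simp
  have "isCont P x" using P_deriv[OF x] by (rule DERIV_isCont)
  then have "\<forall>r>0. \<exists>c>0. \<forall>z. \<bar>z - x\<bar> < c \<longrightarrow> \<bar>P z - P x\<bar> < r"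
    unfolding continuous_at_eps_delta dist_real_def .
  from this[rule_format, OF x(1)] obtain e1 where e1: "e1 > 0" "\<And>z. \<bar>z - x\<bar> < e1 \<Longrightarrow> \<bar>P z - x\<bar> < x"
    unfolding Px by auto
  have "first_return U Z {vector [s, 0] | s. \<bar>s - x\<bar> < x} (vector [z, 0]) (vector [P z, 0])"
    if z: "\<bar>z - x\<bar> < min e1 (min x (d - x))" for z
  proof -
    have z': "0 < z" "z < d" using z by auto
    obtain T1 T g where T: "0 < T1" "T1 < T" and gc: "continuous_on {0..T} g"
      and g: "g 0 = vector [z, 0]" "g T1 = vector [- P z, 0]" "g T = vector [P z, 0]"
      and pos: "\<And>t. t \<in> {0<..<T1} \<Longrightarrow> g t $ 2 > 0" and neg: "\<And>t. t \<in> {T1<..<T} \<Longrightarrow> g t $ 2 < 0"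
      and bd: "\<And>t. t \<in> {0..T} \<Longrightarrow> norm (g t) < 2 * d + Y \<and> \<bar>g t $ 2\<bar> < Y"
      and sol: "solves_in (upper_part U) (fst Z) g {0<..<T1}" "solves_in (lower_part U) (snd Z) g {T1<..<T}"
      using loop_exists[OF z'] by metis
    have gU: "g ` {0..T} \<subseteq> U" using bd U d_le(1) by force
    have "pw_orbit U Z {0..T} g"
      unfolding pw_orbit_def
    proof (intro conjI exI[of _ "{T1}"] allI impI gc gU)
      fix s t :: real
      assume st: "s < t \<and> {s<..<t} \<subseteq> {0..T} \<and> {s<..<t} \<inter> {T1} = {}"
      \<comment> \<open>An open interval inside [0, T] has its ends there too; this puts it inside
        one of the two open pieces.\<close>
      then have "closure {s<..<t} \<subseteq> {0..T}" by (intro closure_minimal) auto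
      then have "s \<in> {0..T}" "t \<in> {0..T}" using st closure_greaterThanLessThan[of s t] by auto
      moreover have "t \<le> T1 \<or> T1 \<le> s" using st by force
      ultimately have "{s<..<t} \<subseteq> {0<..<T1} \<or> {s<..<t} \<subseteq> {T1<..<T}" by auto
      then show "solves_in (upper_part U) (fst Z) g {s<..<t} \<or> solves_in (lower_part U) (snd Z) g {s<..<t} \<or>
          solves_in (switching_line U) (filippov U Z) g {s<..<t}"
        using sol unfolding solves_in_def by blast
    qed auto
    moreover have "\<bar>P z - x\<bar> < x" using e1 z by simp
    moreover have "g t \<notin> {vector [s, 0] | s. \<bar>s - x\<bar> < x}" if "t \<in> {0<..<T}" for t
    proof (cases "t = T1")
      case True
      have "z < R" using z' d_le(1) d_pos up.Y_pos by simp
      then have "P z > 0" using P_pos z' by simp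
      then show ?thesis using g(2) True by simp
    next
      case False
      then have "g t $ 2 < 0 \<or> g t $ 2 > 0" using pos[of t] neg[of t] that by force
      then show ?thesis by auto
    qed
    moreover have "T > 0" using T by simp
    moreover have "vector [P z, 0] \<in> {vector [s, 0] | s. \<bar>s - x\<bar> < x}"
      using \<open>\<bar>P z - x\<bar> < x\<close> by (intro CollectI exI[of _ "P z"] conjI refl)
    ultimately show ?thesis
      unfolding first_return_def using g(1,3)
      by (intro conjI exI[of _ g] exI[of _ T] ballI)
  qed
  moreover have "min e1 (min x (d - x)) > 0" using x xd e1(1) by simp
  ultimately have "\<exists>c>0. \<forall>z. \<bar>z - x\<bar> < c \<longrightarrow>
      first_return U Z {vector [s, 0] | s. \<bar>s - x\<bar> < x} (vector [z, 0]) (vector [P z, 0])"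
    by (intro exI[of _ "min e1 (min x (d - x))"] conjI allI impI)
  then show ?thesis
    unfolding poincare_map_def by (intro conjI x(1) Px)
qed

section \<open>Identification of arbitrary periodic orbits\<close>

lemma crossing_side:
  assumes orb: "pw_orbit U Z UNIV g" and ball: "\<And>t. norm (g t) < R"
    and t: "g t $ 2 = 0" "g t $ 1 \<noteq> 0"
  shows "\<exists>c>0. (\<forall>u\<in>{t<..<t + c}. sgn (g t $ 1) * g u $ 2 > 0) \<and>
    (\<forall>u\<in>{t - c<..<t}. sgn (g t $ 1) * g u $ 2 < 0)"
proof -
  have "g t \<in> ball 0 R" using ball[of t] by simp
  then have "isCont (fst Z) (g t)" "isCont (snd Z) (g t)"
    using Z_cont continuous_on_eq_continuous_at[OF open_ball] by blast+
  from pw_orbit_crossing[OF orb t(1) crossing_values[OF ball t] this]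
  obtain c where "c > 0" "\<And>u. u \<in> {t<..<t + c} \<Longrightarrow> sgn (g t $ 1) * g u $ 2 > 0"
    "\<And>u. u \<in> {t - c<..<t} \<Longrightarrow> sgn (g t $ 1) * g u $ 2 < 0" by metis
  then show ?thesis by blast
qed

text \<open>The orbit leaves the line upwards and comes down at its next zero. At a positive
  abscissa it would have to arrive from below, so this zero is on the left, and \<open>H\<close>
  fixes its abscissa. That much holds for every orbit in the ball; only the description of the image
  as an arc needs a low level. The time \<open>t'\<close> guarantees that a next zero
  exists.\<close>

lemma upper_passage:
  assumes orb: "pw_orbit U Z UNIV g" and ball: "\<And>t. norm (g t) < R"
    and cross: "\<forall>t. g t $ 2 = 0 \<longrightarrow> g t $ 1 \<noteq> 0"
    and t0: "g t0 $ 2 = 0" "g t0 $ 1 = q" "q > 0" and t': "t0 < t'" "g t' $ 2 = 0"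
  obtains t1 where "t0 < t1" "t1 \<le> t'" "g t1 $ 2 = 0" "g t1 $ 1 = - P q"
    "\<And>t. t \<in> {t0<..<t1} \<Longrightarrow> g t $ 2 > 0"
    "b1 * (q\<^sup>2 / 2) < Y * e / 2 \<Longrightarrow> k q = 0 \<Longrightarrow> g ` {t0..t1} = up.arc (b1 * (q\<^sup>2 / 2))"
proof -
  have gc: "continuous_on A g" for A
    using orb by (auto simp: pw_orbit_def intro: continuous_on_subset)
  have yc: "continuous_on UNIV (\<lambda>t. g t $ 2)" using gc by (auto intro!: continuous_intros)
  have qR: "q < R" using up.comps[OF ball[of t0]] t0 by simp
  obtain c where c: "c > 0" "\<And>u. u \<in> {t0<..<t0 + c} \<Longrightarrow> g u $ 2 > 0"
    using crossing_side[OF orb ball t0(1)] t0 by auto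
  obtain t1 where t1: "t0 < t1" "t1 \<le> t'" "g t1 $ 2 = 0" "\<And>t. t \<in> {t0<..<t1} \<Longrightarrow> g t $ 2 > 0"
    using first_zero_after[OF yc c t'] by metis
  have neg: "g t1 $ 1 < 0"
  proof (rule ccontr)
    assume "\<not> g t1 $ 1 < 0"
    then have "g t1 $ 1 > 0" using cross[rule_format, OF t1(3)] by simp
    then obtain c where c: "c > 0" "\<And>u. u \<in> {t1 - c<..<t1} \<Longrightarrow> g u $ 2 < 0"
      using crossing_side[OF orb ball t1(3)] by auto
    obtain u where "max t0 (t1 - c) < u" "u < t1" using dense[of "max t0 (t1 - c)" t1] c t1 by auto
    then show False using c(2)[of u] t1(4)[of u] by auto
  qed
  obtain B where B: "finite B" "\<And>t. t \<in> {t0<..<t1} - B \<Longrightarrow> (g has_vector_derivative fst Z (g t)) (at t)"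
    using pw_orbit_upper[OF orb _ t1(4)] by auto
  have sol: "(g has_vector_derivative up.X (g t)) (at t)" if "t \<in> {t0<..<t1} - B" for t
    using B(2)[OF that] fst_Z[OF ball] by simp
  have "up.H (g t1) = up.H (g t0)"
    by (rule up.H_constant[where t = t1, OF less_imp_le[OF t1(1)] gc B(1) sol ball]) (use t1 in auto)
  then have "b1 * (g t1 $ 1)\<^sup>2 = b1 * (P q)\<^sup>2"
    using t0 t1 k_0[of "g t1 $ 1"] neg P_sq[of q] qR unfolding up.H_def by (simp add: field_simps)
  then have "(g t1 $ 1)\<^sup>2 = (P q)\<^sup>2" using b1_pos by simp
  then have x1: "g t1 $ 1 = - P q" using neg P_pos[of q] t0 qR by (auto simp: power2_eq_iff)
  show ?thesis
  proof (rule that[OF t1(1-3) x1 t1(4)])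
    assume l: "b1 * (q\<^sup>2 / 2) < Y * e / 2" "k q = 0"
    show "g ` {t0..t1} = up.arc (b1 * (q\<^sup>2 / 2))"
      by (rule up.excursion_image[OF t1(1) gc B(1) sol ball t1(4)])
         (use t0 t1 neg l in auto)
  qed
qed

lemma lower_passage:
  assumes orb: "pw_orbit U Z UNIV g" and ball: "\<And>t. norm (g t) < R"
    and cross: "\<forall>t. g t $ 2 = 0 \<longrightarrow> g t $ 1 \<noteq> 0"
    and t1: "g t1 $ 2 = 0" "g t1 $ 1 = - q" "q > 0" and t': "t1 < t'" "g t' $ 2 = 0"
  obtains t2 where "t1 < t2" "t2 \<le> t'" "g t2 $ 2 = 0" "g t2 $ 1 = q"
    "\<And>t. t \<in> {t1<..<t2} \<Longrightarrow> g t $ 2 < 0"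
    "b2 * (q\<^sup>2 / 2) < Y * e / 2 \<Longrightarrow> g ` {t1..t2} = uminus ` lo.arc (b2 * (q\<^sup>2 / 2))"
proof -
  have gc: "continuous_on A g" for A
    using orb by (auto simp: pw_orbit_def intro: continuous_on_subset)
  have yc: "continuous_on UNIV (\<lambda>t. - g t $ 2)" using gc by (auto intro!: continuous_intros)
  obtain c where c: "c > 0" "\<And>u. u \<in> {t1<..<t1 + c} \<Longrightarrow> - g u $ 2 > 0"
    using crossing_side[OF orb ball t1(1)] t1 by auto
  obtain t2 where t2: "t1 < t2" "t2 \<le> t'" "g t2 $ 2 = 0" "\<And>t. t \<in> {t1<..<t2} \<Longrightarrow> g t $ 2 < 0"
    using first_zero_after[OF yc c t'(1)] t'(2) by auto
  have pos: "g t2 $ 1 > 0"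
  proof (rule ccontr)
    assume "\<not> g t2 $ 1 > 0"
    then have "g t2 $ 1 < 0" using cross[rule_format, OF t2(3)] by simp
    then obtain c where c: "c > 0" "\<And>u. u \<in> {t2 - c<..<t2} \<Longrightarrow> g u $ 2 > 0"
      using crossing_side[OF orb ball t2(3)] by auto
    obtain u where "max t1 (t2 - c) < u" "u < t2" using dense[of "max t1 (t2 - c)" t2] c t2 by auto
    then show False using c(2)[of u] t2(4)[of u] by auto
  qed
  obtain B where B: "finite B" "\<And>t. t \<in> {t1<..<t2} - B \<Longrightarrow> (g has_vector_derivative snd Z (g t)) (at t)"
    using pw_orbit_lower[OF orb _ t2(4)] by auto
  define h where "h t = - g t" for t
  have sol: "(h has_vector_derivative lo.X (h t)) (at t)" if "t \<in> {t1<..<t2} - B" for t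
    using has_vector_derivative_minus[OF B(2)[OF that]] snd_Z[OF ball[of t]] by (simp add: h_def[abs_def])
  have hc: "continuous_on {t1..t2} h" and hb: "norm (h t) < R" for t
    using gc ball by (auto simp: h_def[abs_def] intro!: continuous_intros)
  have "lo.H (h t2) = lo.H (h t1)"
    by (rule lo.H_constant[where t = t2, OF less_imp_le[OF t2(1)] hc B(1) sol hb]) (use t2 in auto)
  then have "(g t2 $ 1)\<^sup>2 = q\<^sup>2"
    using t1 t2 b2_pos unfolding lo.H_def h_def by simp
  then have x2: "g t2 $ 1 = q" using pos t1 by (auto simp: power2_eq_iff)
  show ?thesis
  proof (rule that[OF t2(1-3) x2 t2(4)])
    assume l: "b2 * (q\<^sup>2 / 2) < Y * e / 2"
    have "h ` {t1..t2} = lo.arc (b2 * (q\<^sup>2 / 2))"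
      by (rule lo.excursion_image[OF t2(1) hc B(1) sol hb])
         (use t1 t2 x2 l in \<open>auto simp: h_def\<close>)
    moreover have "g ` {t1..t2} = uminus ` h ` {t1..t2}" by (simp add: image_image h_def)
    ultimately show "g ` {t1..t2} = uminus ` lo.arc (b2 * (q\<^sup>2 / 2))" by simp
  qed
qed

text \<open>An upper passage followed by a lower one; periodicity supplies the later zero that each
  of them needs, and the upper one cannot end at \<open>t0 + T\<close>, where the abscissa is
  positive. The clause on intermediate crossings ensures that a later return to a positive abscissa
  is not jumped over.\<close>

lemma next_crossing:
  assumes orb: "pw_orbit U Z UNIV g" and per: "\<And>t. g (t + T) = g t" and "T > 0"
    and ball: "\<And>t. norm (g t) < R" and cross: "\<forall>t. g t $ 2 = 0 \<longrightarrow> g t $ 1 \<noteq> 0"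
    and t0: "g t0 = vector [q, 0]" "q > 0"
  obtains n where "t0 < n" "n \<le> t0 + T" "g n = vector [P q, 0]"
    "\<And>t. t \<in> {t0<..<n} \<Longrightarrow> g t $ 2 = 0 \<Longrightarrow> g t $ 1 < 0"
    "q < d \<and> P q = q \<Longrightarrow> g ` {t0..n} = cycle q"
proof -
  have qR: "q < R" using up.comps[OF ball[of t0]] t0 by simp
  note Pq = P_pos[OF t0(2) qR]
  obtain t1 where t1: "t0 < t1" "t1 \<le> t0 + T" "g t1 $ 2 = 0" "g t1 $ 1 = - P q"
    "\<And>t. t \<in> {t0<..<t1} \<Longrightarrow> g t $ 2 > 0"
    "b1 * (q\<^sup>2 / 2) < Y * e / 2 \<Longrightarrow> k q = 0 \<Longrightarrow> g ` {t0..t1} = up.arc (b1 * (q\<^sup>2 / 2))"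
    using upper_passage[OF orb ball cross, of t0 q "t0 + T"] t0 \<open>T > 0\<close> per[of t0] by auto
  have "t1 \<noteq> t0 + T" using per[of t0] t0 t1(4) Pq by auto
  then have "t1 < t0 + T" using t1(2) by simp
  then obtain t2 where t2: "t1 < t2" "t2 \<le> t0 + T" "g t2 $ 2 = 0" "g t2 $ 1 = P q"
    "\<And>t. t \<in> {t1<..<t2} \<Longrightarrow> g t $ 2 < 0"
    "b2 * ((P q)\<^sup>2 / 2) < Y * e / 2 \<Longrightarrow> g ` {t1..t2} = uminus ` lo.arc (b2 * ((P q)\<^sup>2 / 2))"
    using lower_passage[OF orb ball cross t1(3,4) Pq, of "t0 + T"] t0 per[of t0] by auto
  show ?thesis
  proof (rule that[of t2])
    show "t0 < t2" "t2 \<le> t0 + T" using t1 t2 by auto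
    show "g t2 = vector [P q, 0]" using t2 by (simp add: vec_eq_iff forall_2)
    show "g t $ 1 < 0" if "t \<in> {t0<..<t2}" "g t $ 2 = 0" for t
      using that t1(5)[of t] t2(5)[of t] t1(4) Pq by (cases t t1 rule: linorder_cases) auto
    assume "q < d \<and> P q = q"
    then have q: "q < d" "P q = q" by auto
    then have kq: "k q = 0" using P_fix_iff t0 qR by simp
    have qd: "q\<^sup>2 < d\<^sup>2" using q t0 by (intro power_strict_mono) auto
    have l1: "b1 * (q\<^sup>2 / 2) < Y * e / 2"
      using mult_left_mono[of "q\<^sup>2 / 2" "d\<^sup>2" b1] qd b1_pos d_le(2) zero_le_power2[of q] by linarith
    have l2: "b2 * (q\<^sup>2 / 2) < Y * e / 2"
      using mult_left_mono[of "q\<^sup>2 / 2" "2 * d\<^sup>2" b2] qd b2_pos d_le(3) zero_le_power2[of q] by linarith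
    have "{t0..t2} = {t0..t1} \<union> {t1..t2}" using t1(1) t2(1) by (simp add: ivl_disj_un_two_touch)
    then show "g ` {t0..t2} = cycle q"
      using t1(6)[OF l1 kq] t2(6) l2 q(2) by (simp add: image_Un cycle_def)
  qed
qed

text \<open>An increasing map of an interval has no periodic points except fixed points. The
  argument runs over compact sets of crossing times instead of iterates: a last crossing in the set
  would have a successor in it.\<close>

lemma crossing_periodic_is_cycle:
  assumes orb: "pw_orbit U Z UNIV g" and per: "\<And>t. g (t + T) = g t" and "T > 0"
    and ball: "\<And>t. norm (g t) < R" and cross: "\<forall>t. g t $ 2 = 0 \<longrightarrow> g t $ 1 \<noteq> 0"
    and meets: "g t' $ 2 = 0"
  obtains q where "0 < q" "q < R" "k q = 0" "range g = cycle q"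
proof -
  note next' = next_crossing[OF orb per \<open>T > 0\<close> ball cross]
  have gc: "continuous_on UNIV g" using orb by (auto simp: pw_orbit_def)
  have fixed: "P q = q" if t0: "g t0 = vector [q, 0]" "q > 0" for t0 q
  proof -
    obtain n where n: "t0 < n" "n \<le> t0 + T" "g n = vector [P q, 0]" using next'[OF t0] by metis
    have qR: "q < R" using up.comps[OF ball[of t0]] t0 by simp
    have PR: "P q < R" using up.comps[OF ball[of n]] n by (simp add: abs_less_iff)
    note Ppos = P_pos[OF t0(2) qR]
    show ?thesis
    proof (rule ccontr)
      assume "P q \<noteq> q"
      then consider "P q > q" | "P q < q" by linarith
      then show False
      proof cases
        case 1
        \<comment> \<open>\<open>P\<close> is increasing, so after the first return the crossings stay beyond \<open>P q\<close>: the
          last such one before time \<open>t0 + T\<close> has a successor of the same kind\<close>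
        define A where "A = {t0..t0 + T} \<inter> {t. g t $ 2 = 0 \<and> P q \<le> g t $ 1}"
        have "compact A" unfolding A_def using gc
          by (intro compact_Int_closed closed_Collect_conj closed_Collect_eq closed_Collect_le continuous_intros) auto
        moreover have "n \<in> A" using n by (simp add: A_def)
        ultimately obtain m where m: "m \<in> A" "\<And>t. t \<in> A \<Longrightarrow> t \<le> m"
          using compact_attains_sup[of A] by blast
        define r where "r = g m $ 1"
        have r: "g m = vector [r, 0]" "P q \<le> r" "m \<in> {t0..t0 + T}"
          using m(1) by (auto simp: A_def r_def vec_eq_iff forall_2)
        have "m \<noteq> t0 + T" using r per[of t0] t0 1 by auto
        moreover obtain n' where n': "m < n'" "g n' = vector [P r, 0]"
            "\<And>t. t \<in> {m<..<n'} \<Longrightarrow> g t $ 2 = 0 \<Longrightarrow> g t $ 1 < 0"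
          using next'[OF r(1)] r(2) Ppos by (metis less_le_trans)
        ultimately have "n' \<le> t0 + T"
          using n'(3)[of "t0 + T"] per[of t0] t0 r(3) by force
        moreover have "P q \<le> P r"
          using P_mono[of q r] 1 r t0 up.comps[OF ball[of m]] by simp
        ultimately have "n' \<in> A" using n' r(3) by (simp add: A_def)
        then show False using m(2) n'(1) by force
      next
        case 2
        \<comment> \<open>As in the other case, with crossings at or before P q. The weak bound 0 <=
          makes the set closed; abscissa 0 itself is ruled out by \<open>cross\<close>.\<close>
        define A where "A = {t0..t0 + T} \<inter> {t. g t $ 2 = 0 \<and> 0 \<le> g t $ 1 \<and> g t $ 1 \<le> P q}"
        have "compact A" unfolding A_def using gc
          by (intro compact_Int_closed closed_Collect_conj closed_Collect_eq closed_Collect_le continuous_intros) auto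
        moreover have "n \<in> A" using n Ppos by (simp add: A_def)
        ultimately obtain m where m: "m \<in> A" "\<And>t. t \<in> A \<Longrightarrow> t \<le> m"
          using compact_attains_sup[of A] by blast
        define r where "r = g m $ 1"
        have r: "g m = vector [r, 0]" "r \<le> P q" "m \<in> {t0..t0 + T}" "0 < r"
          using m(1) cross[rule_format, of m] by (auto simp: A_def r_def vec_eq_iff forall_2 less_le)
        have "m \<noteq> t0 + T" using r per[of t0] t0 2 by auto
        moreover obtain n' where n': "m < n'" "g n' = vector [P r, 0]"
            "\<And>t. t \<in> {m<..<n'} \<Longrightarrow> g t $ 2 = 0 \<Longrightarrow> g t $ 1 < 0"
          using next'[OF r(1)] r(4) by metis
        ultimately have "n' \<le> t0 + T"
          using n'(3)[of "t0 + T"] per[of t0] t0 r(3) by force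
        moreover have "P r \<le> P q" "0 < P r"
          using P_mono[of r q] P_pos[of r] 2 r qR by simp_all
        ultimately have "n' \<in> A" using n' r(3) by (simp add: A_def)
        then show False using m(2) n'(1) by force
      qed
    qed
  qed
  \<comment> \<open>A crossing on the left is followed by a lower passage, which ends on the
    right.\<close>
  obtain t0 where t0: "g t0 $ 2 = 0" "g t0 $ 1 > 0"
  proof (cases "g t' $ 1 > 0")
    case True
    then show ?thesis using meets that by blast
  next
    case False
    then have "- g t' $ 1 > 0" using cross[rule_format, OF meets] by simp
    moreover have "g t' $ 1 = - (- g t' $ 1)" "t' < t' + T" "g (t' + T) $ 2 = 0"
      using \<open>T > 0\<close> per meets by auto
    ultimately obtain t2 where "g t2 $ 2 = 0" "g t2 $ 1 = - g t' $ 1"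
      using lower_passage[OF orb ball cross meets] by metis
    then show ?thesis using \<open>- g t' $ 1 > 0\<close> by (intro that[of t2]) auto
  qed
  define q where "q = g t0 $ 1"
  have q: "g t0 = vector [q, 0]" "q > 0" using t0 by (auto simp: q_def vec_eq_iff forall_2)
  have qR: "q < R" using up.comps[OF ball[of t0]] q by simp
  note Pq = fixed[OF q]
  have kq: "k q = 0" using P_fix_iff[OF q(2) qR] Pq by simp
  have qd: "q < d" using k_zero q(2) qR kq by blast
  have "range g = cycle q"
  proof
    show "cycle q \<subseteq> range g" using next'[OF q] qd Pq by (metis image_mono subset_UNIV)
    show "range g \<subseteq> cycle q"
    proof
      fix p assume "p \<in> range g"
      then obtain u where u: "p = g u" by blast
      have pern: "g (t + of_nat j * T) = g t" for t j
      proof (induction j)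
        case (Suc j)
        then show ?case using per[of "t + of_nat j * T"] by (simp add: algebra_simps)
      qed simp
      obtain j :: nat where "t0 - u < of_nat j * T" using reals_Archimedean3[OF \<open>T > 0\<close>] by blast
      then have v: "t0 \<le> u + of_nat j * T" by simp
      define v where "v = u + of_nat j * T"
      have gv: "p = g v" using pern u by (simp add: v_def)
      \<comment> \<open>Consider the last visit to (q, 0) up to time \<open>v\<close>. The loop
        starting there ends at (q, 0) after \<open>v\<close> and traces the cycle, so the point at
        time \<open>v\<close> lies on it.\<close>
      define A where "A = {t0..v} \<inter> {t. g t $ 2 = 0 \<and> g t $ 1 = q}"
      have "compact A" unfolding A_def using gc
        by (intro compact_Int_closed closed_Collect_conj closed_Collect_eq continuous_intros) auto
      moreover have "t0 \<in> A" using q v by (simp add: A_def v_def)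
      ultimately obtain m where m: "m \<in> A" "\<And>t. t \<in> A \<Longrightarrow> t \<le> m"
        using compact_attains_sup[of A] by blast
      have gm: "g m = vector [q, 0]" using m(1) by (auto simp: A_def vec_eq_iff forall_2)
      obtain n where n: "m < n" "g n = vector [P q, 0]" "g ` {m..n} = cycle q"
        using next'[OF gm q(2)] qd Pq by metis
      have "v < n"
      proof (rule ccontr)
        assume "\<not> v < n"
        then have "n \<in> A" using n(1,2) m(1) Pq by (simp add: A_def)
        then show False using m(2)[of n] n(1) by simp
      qed
      then show "p \<in> cycle q" using gv n(3) m(1) by (auto simp: A_def)
    qed
  qed
  then show ?thesis using that q qR kq by blast
qed

text \<open>An orbit that avoids the line stays on one side, by the intermediate value theorem, and
  there its abscissa is strictly monotone.\<close>

lemma periodic_meets_line: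
  assumes orb: "pw_orbit U Z UNIV g" and per: "\<And>t. g (t + T) = g t" and "T > 0"
    and ball: "\<And>t. norm (g t) < R" and y: "\<And>t. \<bar>g t $ 2\<bar> < Y"
  shows "\<exists>t. g t $ 2 = 0"
proof (rule ccontr)
  assume "\<not> ?thesis"
  then have nz: "g t $ 2 \<noteq> 0" for t by blast
  have gc: "continuous_on A g" for A
    using orb by (auto simp: pw_orbit_def intro: continuous_on_subset)
  have yc: "continuous_on A (\<lambda>t. g t $ 2)" for A using gc by (auto intro!: continuous_intros)
  have gT: "g T = g 0" using per[of 0] by simp
  show False
  proof (cases "g 0 $ 2 > 0")
    case True
    have pos: "g t $ 2 > 0" if "t \<in> {0..T}" for t
      using IVT2'[of "\<lambda>t. g t $ 2" t 0 0] yc nz True that by (auto simp: not_less)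
        (metis linorder_not_le)
    obtain B where B: "finite B" "\<And>t. t \<in> {0<..<T} - B \<Longrightarrow> (g has_vector_derivative fst Z (g t)) (at t)"
      using pw_orbit_upper[OF orb, of 0 T] pos by auto
    have sol: "(g has_vector_derivative up.X (g t)) (at t)" if "t \<in> {0<..<T} - B" for t
      using B(2)[OF that] fst_Z[OF ball] by simp
    have "0 \<le> g t $ 2 \<and> g t $ 2 \<le> Y" if "t \<in> {0..T}" for t using pos[OF that] y[of t] by simp
    from up.no_periodic_arc[OF \<open>T > 0\<close> gc B(1) sol ball this] gT show False by simp
  next
    case False
    then have "g 0 $ 2 < 0" using nz[of 0] by simp
    then have neg: "g t $ 2 < 0" if "t \<in> {0..T}" for t
      using IVT'[of "\<lambda>t. g t $ 2" 0 0 t] yc nz that by (auto simp: not_less)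
        (metis linorder_not_le)
    obtain B where B: "finite B" "\<And>t. t \<in> {0<..<T} - B \<Longrightarrow> (g has_vector_derivative snd Z (g t)) (at t)"
      using pw_orbit_lower[OF orb, of 0 T] neg by auto
    define h where "h t = - g t" for t
    have sol: "(h has_vector_derivative lo.X (h t)) (at t)" if "t \<in> {0<..<T} - B" for t
      using has_vector_derivative_minus[OF B(2)[OF that]] snd_Z[OF ball[of t]] by (simp add: h_def[abs_def])
    have hc: "continuous_on {0..T} h" and hb: "norm (h t) < R" for t
      using gc ball by (auto simp: h_def[abs_def] intro!: continuous_intros)
    have "0 \<le> h t $ 2 \<and> h t $ 2 \<le> Y" if "t \<in> {0..T}" for t
      using neg[OF that] y[of t] by (simp add: h_def)
    from lo.no_periodic_arc[OF \<open>T > 0\<close> hc B(1) sol hb this] gT show False by (simp add: h_def)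
  qed
qed

text \<open>The alternatives in \<open>meets\<close> serve two purposes: crossing limit cycles meet
  the line by definition and may a priori be of any height in the ball, while isolation concerns
  arbitrary periodic orbits, which are confined to the strip |y| < Y.\<close>

lemma periodic_orbit_is_cycle:
  assumes C: "periodic_orbit U Z C" "C \<subseteq> ball 0 R"
    and cross: "\<And>p. p \<in> C \<Longrightarrow> p $ 2 = 0 \<Longrightarrow> p $ 1 \<noteq> 0"
    and meets: "(\<exists>p\<in>C. p $ 2 = 0) \<or> (\<forall>p\<in>C. \<bar>p $ 2\<bar> < Y)"
  obtains q where "0 < q" "q < R" "k q = 0" "C = cycle q"
proof -
  obtain g T where g: "pw_orbit U Z UNIV g" "T > 0" "\<And>t. g (t + T) = g t" "C = range g"
    using C(1) unfolding periodic_orbit_def by blast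
  have ball: "norm (g t) < R" for t using subsetD[OF C(2), of "g t"] g(4) by simp
  have cr: "\<forall>t. g t $ 2 = 0 \<longrightarrow> g t $ 1 \<noteq> 0" using cross g(4) by blast
  have "\<exists>t. g t $ 2 = 0"
    using meets periodic_meets_line[OF g(1,3,2) ball] unfolding g(4) by blast
  then obtain t' where "g t' $ 2 = 0" by blast
  from crossing_periodic_is_cycle[OF g(1,3,2) ball cr this] that g(4) show ?thesis by metis
qed

section \<open>Isolation, hyperbolicity and number of the cycles\<close>

lemma isolated_zero:
  assumes "\<bar>x\<bar> < R" "k x = 0" "k1 x \<noteq> 0"
  obtains c where "c > 0" "\<And>z. \<bar>z - x\<bar> < c \<Longrightarrow> k z = 0 \<Longrightarrow> z = x"
proof -
  have "((\<lambda>z. (k z - k x) / (z - x)) \<longlongrightarrow> k1 x) (at x)"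
    using k_deriv[OF assms(1)] by (simp add: has_field_derivative_iff)
  then have "\<forall>\<^sub>F z in at x. (k z - k x) / (z - x) \<noteq> 0"
    using assms(3) by (rule tendsto_imp_eventually_ne)
  then obtain c where "c > 0" "\<And>z. z \<noteq> x \<Longrightarrow> dist z x < c \<Longrightarrow> (k z - k x) / (z - x) \<noteq> 0"
    unfolding eventually_at by auto
  then show ?thesis using that[of c] assms(2) by (force simp: dist_real_def)
qed

lemma cycle_limit_cycle:
  assumes x: "0 < x" "x < R" "k x = 0"
  shows "limit_cycle U Z (cycle x)"
proof -
  note pr = cycle_properties[OF x]
  obtain c where c: "c > 0" "\<And>z. \<bar>z - x\<bar> < c \<Longrightarrow> k z = 0 \<Longrightarrow> z = x"
    using isolated_zero[of x] x k_zero[OF x] by auto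
  \<comment> \<open>\<open>V\<close> is the ball intersected with the strip and slit along the
    nonnegative half of the line outside the distance r from x. As r <= x, the slit contains the
    origin, the only point near which an orbit need not cross; the left crossing (-x, 0) is
    untouched. A periodic orbit in \<open>V\<close> therefore comes from a zero of \<open>k\<close>
    at distance less than c from x.\<close>
  define r where "r = min c x"
  define V where "V = ball 0 R \<inter> {p :: real^2. \<bar>p $ 2\<bar> < Y} - {p. p $ 2 = 0 \<and> 0 \<le> p $ 1 \<and> r \<le> \<bar>p $ 1 - x\<bar>}"
  have "open V"
    unfolding V_def
    by (intro open_Diff open_Int open_ball open_Collect_less closed_Collect_conj closed_Collect_eq
        closed_Collect_le continuous_intros)
  moreover have "cycle x \<subseteq> V"
  proof
    fix p assume p: "p \<in> cycle x"
    then have "p = vector [x, 0] \<or> p = vector [- x, 0]" if "p $ 2 = 0" using pr(2)[of p] that by blast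
    then show "p \<in> V" using pr(1)[OF p] d_le(1) x c(1) by (force simp: V_def r_def)
  qed
  moreover have "C = cycle x" if C: "periodic_orbit U Z C" "C \<subseteq> V" for C
  proof -
    have nz: "p $ 1 \<noteq> 0" if "p \<in> C" "p $ 2 = 0" for p
    proof
      assume "p $ 1 = 0"
      then have "p \<notin> V" using that(2) x(1) by (simp add: V_def r_def)
      then show False using that(1) C(2) by blast
    qed
    have "C \<subseteq> ball 0 R" "\<forall>p\<in>C. \<bar>p $ 2\<bar> < Y" using C(2) by (auto simp: V_def)
    then obtain q where q: "0 < q" "q < R" "k q = 0" "C = cycle q"
      using periodic_orbit_is_cycle[OF C(1) _ nz] by metis
    have "vector [q, 0] \<in> V" using cycle_properties(2)[OF q(1-3), of "vector [q, 0]"] q(4) C(2) by blast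
    then have "\<bar>q - x\<bar> < c" using q(1) by (simp add: V_def r_def min_le_iff_disj)
    then show ?thesis using c(2) q by blast
  qed
  ultimately show ?thesis unfolding limit_cycle_def using pr(3) by blast
qed

lemma cycle_hyperbolic:
  assumes x: "0 < x" "x < R" "k x = 0"
  shows "hyperbolic_clc U Z (cycle x)"
proof -
  note pr = cycle_properties[OF x]
  have U': "p \<in> U" if "p \<in> cycle x" for p using pr(1)[OF that] U d_le(1) by auto
  have "vector [x, 0] \<in> cycle x" using pr(2) by blast
  moreover from this have "cycle x \<inter> switching_line U \<noteq> {}" using U' by (auto simp: switching_line_def)
  moreover have "cycle x \<inter> switching_line U \<subseteq> crossing_set U Z"
  proof
    fix p assume "p \<in> cycle x \<inter> switching_line U"
    then have p: "p \<in> cycle x" "p $ 2 = 0" by (auto simp: switching_line_def)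
    then have "p = vector [x, 0] \<or> p = vector [- x, 0]" using pr(2) by blast
    then have "p $ 1 \<noteq> 0" using x by auto
    then show "p \<in> crossing_set U Z" using crossing_iff[of p] p pr(1)[OF p(1)] d_le(1) by simp
  qed
  moreover have "\<bar>1 + k1 x / x\<bar> \<noteq> 1"
  proof -
    have "\<bar>k1 x / x\<bar> \<le> 1 / 2" using k1_le[of x] x by (simp add: field_simps)
    moreover have "k1 x / x \<noteq> 0" using k_zero[OF x] x by simp
    ultimately show ?thesis by linarith
  qed
  ultimately show ?thesis
    unfolding hyperbolic_clc_def crossing_limit_cycle_def
    using cycle_limit_cycle[OF x] poincare_map_P[OF x] P_deriv[OF x] by blast
qed

text \<open>The cycles correspond to the zeros of \<open>k\<close>: injectivity holds because (x, 0)
  is the only point of the cycle on the positive half of the line. The count covers the whole ball,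
  even though the cycles themselves turn out to lie in a smaller one.\<close>

lemma crossing_limit_cycles:
  "ecard {C. crossing_limit_cycle U Z C \<and> C \<subseteq> ball 0 R} = ecard {x. 0 < x \<and> x < R \<and> k x = 0}"
  "crossing_limit_cycle U Z C \<Longrightarrow> C \<subseteq> ball 0 R \<Longrightarrow> hyperbolic_clc U Z C \<and> C \<subseteq> ball 0 (2 * d + Y)"
proof -
  let ?S = "{x. 0 < x \<and> x < R \<and> k x = 0}"
  have cyc: "\<exists>x\<in>?S. C = cycle x" if C: "crossing_limit_cycle U Z C" "C \<subseteq> ball 0 R" for C
  proof -
    have per: "periodic_orbit U Z C" and ne: "C \<inter> switching_line U \<noteq> {}"
      and cr: "C \<inter> switching_line U \<subseteq> crossing_set U Z"
      using C(1) by (auto simp: crossing_limit_cycle_def limit_cycle_def)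
    have nz: "p $ 1 \<noteq> 0" if "p \<in> C" "p $ 2 = 0" for p
    proof -
      have "norm p < R" using that C(2) by auto
      moreover from this have "p \<in> crossing_set U Z" using that cr U by (auto simp: switching_line_def)
      ultimately show ?thesis using crossing_iff that(2) by blast
    qed
    have "\<exists>p\<in>C. p $ 2 = 0" using ne by (auto simp: switching_line_def)
    then show ?thesis using periodic_orbit_is_cycle[OF per C(2) nz] by blast
  qed
  have ball: "cycle x \<subseteq> ball 0 (2 * d + Y)" if "x \<in> ?S" for x
    using cycle_properties(1)[of x] that by auto
  have clc: "crossing_limit_cycle U Z (cycle x)" if "x \<in> ?S" for x
    using cycle_hyperbolic[of x] that by (simp add: hyperbolic_clc_def)
  have inj: "inj_on cycle ?S"
  proof (rule inj_onI)
    fix x y assume xy: "x \<in> ?S" "y \<in> ?S" "cycle x = cycle y"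
    have "vector [x, 0] \<in> cycle y" using cycle_properties(2)[of x "vector [x, 0]"] xy by auto
    then show "x = y" using cycle_properties(2)[of y "vector [x, 0]"] xy by auto
  qed
  have img: "{C. crossing_limit_cycle U Z C \<and> C \<subseteq> ball 0 R} = cycle ` ?S"
  proof
    show "{C. crossing_limit_cycle U Z C \<and> C \<subseteq> ball 0 R} \<subseteq> cycle ` ?S" using cyc by blast
    have "ball 0 (2 * d + Y) \<subseteq> (ball 0 R :: (real^2) set)" using d_le(1) by auto
    then show "cycle ` ?S \<subseteq> {C. crossing_limit_cycle U Z C \<and> C \<subseteq> ball 0 R}" using ball clc by blast
  qed
  show "ecard {C. crossing_limit_cycle U Z C \<and> C \<subseteq> ball 0 R} = ecard ?S"
    unfolding img ecard_def by (simp add: card_image[OF inj] finite_image_iff[OF inj])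
  show "hyperbolic_clc U Z C \<and> C \<subseteq> ball 0 (2 * d + Y)" if "crossing_limit_cycle U Z C" "C \<subseteq> ball 0 R"
    using cyc[OF that] ball cycle_hyperbolic by blast
qed

end

subsection \<open>Small perturbations in the \<open>C\<^sup>1\<close> topology\<close>

lemma norm_le_rows: "norm (M :: 'a::real_normed_vector^2) \<le> norm (M $ 1) + norm (M $ 2)"
  using L2_set_le_sum[of UNIV "\<lambda>i. norm (M $ i)"] by (simp add: norm_vec_def sum_2)

lemma norm_matrix_vector_le: "norm (M *v h) \<le> 2 * norm M * norm h" for M :: "real^2^2"
proof -
  have "\<bar>(M *v h) $ i\<bar> \<le> norm M * norm h" for i
  proof -
    have "\<bar>(M *v h) $ i\<bar> \<le> norm (M $ i) * norm h"
      using Cauchy_Schwarz_ineq2[of "M $ i" h] by (simp add: matrix_vector_mul_component)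
    also have "\<dots> \<le> norm M * norm h" by (intro mult_right_mono Finite_Cartesian_Product.norm_nth_le) simp
    finally show ?thesis .
  qed
  from this[of 1] this[of 2] show ?thesis using norm_le_rows[of "M *v h"] by simp
qed

lemma jacobian_eqI:
  fixes X :: vfield
  assumes "(X has_derivative (\<lambda>h. J *v h)) (at p)"
  shows "jacobian X (at p) = J"
  unfolding jacobian_def frechet_derivative_at[OF assms, symmetric] by simp

lemma C1_fieldI:
  assumes "\<And>p. p \<in> U \<Longrightarrow> (X has_derivative (\<lambda>h. J p *v h)) (at p)" "continuous_on U J"
  shows "X \<in> C1_fields U"
proof -
  have "X differentiable_on U"
    unfolding differentiable_on_def
    by (rule ballI, rule differentiable_at_withinI, rule differentiableI[OF assms(1)])
  moreover have "continuous_on U (\<lambda>p. jacobian X (at p))"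
    using assms(2) by (rule continuous_on_eq) (rule jacobian_eqI[OF assms(1), symmetric])
  ultimately show ?thesis by (simp add: C1_fields_def)
qed

lemma C1_fieldD:
  assumes "open U" "X \<in> C1_fields U" "p \<in> U"
  shows "(X has_derivative (\<lambda>h. jacobian X (at p) *v h)) (at p)"
proof -
  have "X differentiable (at p)"
    using assms(2,3) at_within_open[OF assms(3,1)] unfolding C1_fields_def differentiable_on_def by force
  then show ?thesis by (rule iffD1[OF jacobian_works])
qed

lemma C1_field_continuous:
  assumes "X \<in> C1_fields U" shows "continuous_on U X" "continuous_on U (\<lambda>p. jacobian X (at p))"
  using assms by (simp_all add: C1_fields_def differentiable_imp_continuous_on)

definition C1_small :: "(real^2) set \<Rightarrow> real \<Rightarrow> vfield \<Rightarrow> bool" where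
  "C1_small U r E \<longleftrightarrow> E \<in> C1_fields U \<and> (\<forall>p\<in>U. norm (E p) + norm (jacobian E (at p)) \<le> r)"

lemma C1_fields_add:
  assumes "open U" "X \<in> C1_fields U" "Y \<in> C1_fields U"
  shows "(\<lambda>p. X p + Y p) \<in> C1_fields U"
    "p \<in> U \<Longrightarrow> jacobian (\<lambda>p. X p + Y p) (at p) = jacobian X (at p) + jacobian Y (at p)"
proof -
  have d: "((\<lambda>p. X p + Y p) has_derivative (\<lambda>h. (jacobian X (at p) + jacobian Y (at p)) *v h)) (at p)" if "p \<in> U" for p
    using has_derivative_add[OF C1_fieldD[OF assms(1,2) that] C1_fieldD[OF assms(1,3) that]]
    by (simp add: matrix_vector_mult_add_rdistrib)
  show "p \<in> U \<Longrightarrow> jacobian (\<lambda>p. X p + Y p) (at p) = jacobian X (at p) + jacobian Y (at p)"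
    using d by (rule jacobian_eqI)
  show "(\<lambda>p. X p + Y p) \<in> C1_fields U"
    by (rule C1_fieldI[OF d], assumption) (intro continuous_on_add C1_field_continuous(2) assms(2,3))
qed

lemma C1_fields_minus:
  assumes "open U" "X \<in> C1_fields U"
  shows "(\<lambda>p. - X p) \<in> C1_fields U"
    "p \<in> U \<Longrightarrow> jacobian (\<lambda>p. - X p) (at p) = - jacobian X (at p)"
proof -
  have neg: "(- A) *v h = - (A *v h)" for A :: "real^2^2" and h
    by (simp add: matrix_vector_mult_def vec_eq_iff sum_negf)
  have d: "((\<lambda>p. - X p) has_derivative (\<lambda>h. (- jacobian X (at p)) *v h)) (at p)" if "p \<in> U" for p
    unfolding neg by (rule has_derivative_minus[OF C1_fieldD[OF assms that]])
  show "p \<in> U \<Longrightarrow> jacobian (\<lambda>p. - X p) (at p) = - jacobian X (at p)"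
    using d by (rule jacobian_eqI)
  show "(\<lambda>p. - X p) \<in> C1_fields U"
    by (rule C1_fieldI[OF d], assumption) (intro continuous_on_minus C1_field_continuous(2) assms(2))
qed

lemma C1_small_add:
  assumes "open U" "C1_small U r E" "C1_small U r' E'"
  shows "C1_small U (r + r') (\<lambda>p. E p + E' p)"
  unfolding C1_small_def
proof (intro conjI ballI)
  show "(\<lambda>p. E p + E' p) \<in> C1_fields U" using C1_fields_add(1) assms by (simp add: C1_small_def)
  fix p assume p: "p \<in> U"
  then have "norm (E p) + norm (jacobian E (at p)) \<le> r" "norm (E' p) + norm (jacobian E' (at p)) \<le> r'"
    using assms by (auto simp: C1_small_def)
  moreover have "jacobian (\<lambda>p. E p + E' p) (at p) = jacobian E (at p) + jacobian E' (at p)"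
    using C1_fields_add(2)[of U E E' p] p assms by (simp add: C1_small_def)
  ultimately show "norm (E p + E' p) + norm (jacobian (\<lambda>p. E p + E' p) (at p)) \<le> r + r'"
    using norm_triangle_ineq[of "E p" "E' p"]
      norm_triangle_ineq[of "jacobian E (at p)" "jacobian E' (at p)"] by simp
qed

lemma C1_small_minus:
  assumes "open U" "C1_small U r E"
  shows "C1_small U r (\<lambda>p. - E p)"
proof -
  have E: "E \<in> C1_fields U" using assms(2) by (simp add: C1_small_def)
  have "norm (- E p) + norm (jacobian (\<lambda>p. - E p) (at p)) \<le> r" if "p \<in> U" for p
    using assms(2) that unfolding C1_fields_minus(2)[OF assms(1) E that] C1_small_def by simp
  then show ?thesis using C1_fields_minus(1)[OF assms(1) E] by (simp add: C1_small_def)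
qed

lemma C1_dist_add_le:
  assumes "open U" "X \<in> C1_fields U" "C1_small U r E"
  shows "C1_dist U X (\<lambda>p. X p + E p) \<le> ereal r"
  unfolding C1_dist_def
proof (rule SUP_least)
  fix p assume p: "p \<in> U"
  have "norm (E p) + norm (jacobian E (at p)) \<le> r" using p assms(3) by (simp add: C1_small_def)
  moreover have "jacobian (\<lambda>p. X p + E p) (at p) = jacobian X (at p) + jacobian E (at p)"
    using C1_fields_add(2)[of U X E p] assms p by (simp add: C1_small_def)
  ultimately show "ereal (norm (X p - (X p + E p)) +
      norm (jacobian X (at p) - jacobian (\<lambda>p. X p + E p) (at p))) \<le> ereal r"
    by simp
qed

lemma C1_dist_triangle:
  "C1_dist U A C \<le> C1_dist U A B + C1_dist U B C"
proof -
  have "ereal (norm (A p - C p) + norm (jacobian A (at p) - jacobian C (at p))) \<le> C1_dist U A B + C1_dist U B C"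
    if p: "p \<in> U" for p
  proof -
    have "ereal (norm (A p - C p) + norm (jacobian A (at p) - jacobian C (at p)))
      \<le> ereal (norm (A p - B p) + norm (jacobian A (at p) - jacobian B (at p)))
        + ereal (norm (B p - C p) + norm (jacobian B (at p) - jacobian C (at p)))"
      using norm_triangle_ineq[of "A p - B p" "B p - C p"]
        norm_triangle_ineq[of "jacobian A (at p) - jacobian B (at p)" "jacobian B (at p) - jacobian C (at p)"]
      by simp
    also have "\<dots> \<le> C1_dist U A B + C1_dist U B C"
      unfolding C1_dist_def by (intro add_mono SUP_upper p)
    finally show ?thesis .
  qed
  then show ?thesis unfolding C1_dist_def[of U A C] by (rule SUP_least)
qed

text \<open>The generating sets are balls around arbitrary centers, so each set of the subbase needs
  the triangle inequality to give a ball around \<open>X\<close>; finite intersections and unions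
  then follow by induction.\<close>

lemma C1_topology_ball:
  assumes "U \<noteq> {}" "openin (C1_topology U) S" "X \<in> S"
  shows "\<exists>r>0. \<forall>X'\<in>C1_fields U. C1_dist U X X' < ereal r \<longrightarrow> X' \<in> S"
proof -
  have "generate_topology_on {{Y \<in> C1_fields U. C1_dist U X Y < ereal e} | X e. X \<in> C1_fields U \<and> e > 0} S"
    using assms(2) by (simp add: C1_topology_def openin_topology_generated_by_iff)
  then show ?thesis using assms(3)
  proof (induction rule: generate_topology_on.induct)
    case (Int S T)
    then obtain r1 r2 where "r1 > 0" "r2 > 0"
      "\<forall>X'\<in>C1_fields U. C1_dist U X X' < ereal r1 \<longrightarrow> X' \<in> S"
      "\<forall>X'\<in>C1_fields U. C1_dist U X X' < ereal r2 \<longrightarrow> X' \<in> T" by auto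
    moreover have "ereal (min r1 r2) \<le> ereal r1" "ereal (min r1 r2) \<le> ereal r2" by auto
    ultimately show ?case
      by (intro exI[of _ "min r1 r2"] conjI ballI impI IntI) (auto intro: less_le_trans)
  next
    case (UN K)
    then show ?case by blast
  next
    case (Basis S)
    then obtain X0 e where S: "S = {Y \<in> C1_fields U. C1_dist U X0 Y < ereal e}" by auto
    then have lt: "C1_dist U X0 X < ereal e" using Basis by simp
    \<comment> \<open>A point of \<open>U\<close> makes the supremum nonnegative; over the empty set
      it would be minus infinity. With the upper bound \<open>e\<close> this makes the distance a
      real number.\<close>
    obtain p where "p \<in> U" using assms(1) by blast
    then have "0 \<le> C1_dist U X0 X"
      unfolding C1_dist_def by (rule SUP_upper2) simp
    then obtain t where t: "C1_dist U X0 X = ereal t" using lt by (cases "C1_dist U X0 X") auto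
    show ?case
    proof (intro exI[of _ "e - t"] conjI ballI impI)
      show "e - t > 0" using t lt by simp
      fix X' assume X': "X' \<in> C1_fields U" "C1_dist U X X' < ereal (e - t)"
      have "C1_dist U X0 X' \<le> ereal t + C1_dist U X X'" using C1_dist_triangle[of U X0 X' X] t by simp
      also have "\<dots> < ereal e" using X'(2) by (cases "C1_dist U X X'") auto
      finally show "X' \<in> S" using S X'(1) by simp
    qed
  qed simp
qed

lemma Omega_nbhd_small:
  assumes "open U" "U \<noteq> {}" "Omega_nbhd U (X, Y) N"
  obtains r where "r > 0" "\<And>E F. C1_small U r E \<Longrightarrow> C1_small U r F \<Longrightarrow> (\<lambda>p. X p + E p, \<lambda>p. Y p + F p) \<in> N"
proof -
  obtain V where V: "openin (prod_topology (C1_topology U) (C1_topology U)) V" "(X, Y) \<in> V" "V \<subseteq> N" "N \<subseteq> Omega U"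
    using assms(3) by (auto simp: Omega_nbhd_def Omega_topology_def)
  have XY: "X \<in> C1_fields U" "Y \<in> C1_fields U" using V by (auto simp: Omega_def)
  obtain S T where ST: "openin (C1_topology U) S" "openin (C1_topology U) T" "X \<in> S" "Y \<in> T" "S \<times> T \<subseteq> V"
    using V(1)[unfolded openin_prod_topology_alt, rule_format, OF V(2)] by blast
  obtain r1 where r1: "r1 > 0" "\<forall>X'\<in>C1_fields U. C1_dist U X X' < ereal r1 \<longrightarrow> X' \<in> S"
    using C1_topology_ball[OF assms(2) ST(1,3)] by blast
  obtain r2 where r2: "r2 > 0" "\<forall>Y'\<in>C1_fields U. C1_dist U Y Y' < ereal r2 \<longrightarrow> Y' \<in> T"
    using C1_topology_ball[OF assms(2) ST(2,4)] by blast
  \<comment> \<open>Halving turns the weak bound on the distance given by \<open>C1_small\<close>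
    into the strict one of the balls.\<close>
  define r where "r = min r1 r2 / 2"
  have r: "r > 0" "r < r1" "r < r2" using r1 r2 by (auto simp: r_def)
  show ?thesis
  proof (rule that[OF r(1)])
    fix E F assume EF: "C1_small U r E" "C1_small U r F"
    have "C1_dist U X (\<lambda>p. X p + E p) < ereal r1"
      using C1_dist_add_le[OF assms(1) XY(1) EF(1)] r(2) by (meson ereal_less_eq(3) le_less_trans less_ereal.simps(1))
    moreover have "C1_dist U Y (\<lambda>p. Y p + F p) < ereal r2"
      using C1_dist_add_le[OF assms(1) XY(2) EF(2)] r(3) by (meson ereal_less_eq(3) le_less_trans less_ereal.simps(1))
    moreover have "(\<lambda>p. X p + E p) \<in> C1_fields U" "(\<lambda>p. Y p + F p) \<in> C1_fields U"
      using C1_fields_add(1)[OF assms(1)] XY EF by (auto simp: C1_small_def)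
    ultimately show "(\<lambda>p. X p + E p, \<lambda>p. Y p + F p) \<in> N" using r1 r2 ST(5) V(3) by blast
  qed
qed

section \<open>A continuously differentiable cutoff\<close>

definition relu_sq :: "real \<Rightarrow> real" where "relu_sq v = (if v \<le> 0 then 0 else v\<^sup>2)"

lemma relu_sq_deriv: "(relu_sq has_real_derivative 2 * max 0 v) (at v)"
proof -
  have "((\<lambda>x::real. x\<^sup>2) has_real_derivative 2 * x) (at x)" for x
    by (auto intro!: derivative_eq_intros)
  from glued_derivative[of "\<lambda>x. x\<^sup>2" 1 "\<lambda>x. 2 * x" v, OF _ _ this]
  have "((\<lambda>x. if x \<le> 0 then 0 else x\<^sup>2) has_real_derivative (if v \<le> 0 then 0 else 2 * v)) (at v)" by simp
  moreover have "(if v \<le> 0 then 0 else 2 * v) = 2 * max 0 v" by simp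
  ultimately show ?thesis unfolding relu_sq_def[abs_def] by simp
qed

text \<open>Equal to (1 - (u - 1)^2)^2 between u = 1 and u = 2; the squares make both junctions,
  with the constants 1 and 0, continuously differentiable.\<close>

definition plateau :: "real \<Rightarrow> real" where "plateau u = relu_sq (1 - relu_sq (u - 1))"

definition plateau' :: "real \<Rightarrow> real" where
  "plateau' u = - (2 * max 0 (1 - relu_sq (u - 1)) * (2 * max 0 (u - 1)))"

lemma plateau_deriv: "(plateau has_real_derivative plateau' u) (at u)"
proof -
  have "((\<lambda>u. u - 1) has_real_derivative 1) (at u)" by (auto intro!: derivative_eq_intros)
  from DERIV_diff[OF DERIV_const[of 1] DERIV_chain2[OF relu_sq_deriv this]]
  have "((\<lambda>u. 1 - relu_sq (u - 1)) has_real_derivative - (2 * max 0 (u - 1))) (at u)" by simp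
  from DERIV_chain2[OF relu_sq_deriv this] show ?thesis
    unfolding plateau_def[abs_def] plateau'_def by simp
qed

lemma plateau'_continuous: "continuous_on UNIV plateau'"
proof -
  have "continuous_on UNIV relu_sq"
    by (rule continuous_at_imp_continuous_on) (intro ballI DERIV_isCont[OF relu_sq_deriv])
  then have "continuous_on UNIV (\<lambda>u. relu_sq (u - 1))"
    by (rule continuous_on_compose2) (auto intro!: continuous_intros)
  then show ?thesis unfolding plateau'_def[abs_def] by (intro continuous_intros)
qed

lemma plateau_values:
  "u \<le> 1 \<Longrightarrow> plateau u = 1" "2 \<le> u \<Longrightarrow> plateau u = 0" "2 \<le> u \<Longrightarrow> plateau' u = 0"
  "0 \<le> plateau u" "plateau u \<le> 1" "\<bar>plateau' u\<bar> \<le> 4"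
proof -
  have nn: "0 \<le> relu_sq v" for v by (simp add: relu_sq_def)
  have ge: "1 \<le> relu_sq (u - 1)" if "2 \<le> u" for u using that one_le_power[of "u - 1" 2] by (simp add: relu_sq_def)
  show "u \<le> 1 \<Longrightarrow> plateau u = 1" by (simp add: plateau_def relu_sq_def)
  show z: "2 \<le> u \<Longrightarrow> plateau u = 0" using ge[of u] by (simp add: plateau_def relu_sq_def[of "1 - _"])
  show z': "2 \<le> u \<Longrightarrow> plateau' u = 0" using ge[of u] by (simp add: plateau'_def)
  show "0 \<le> plateau u" by (simp add: plateau_def nn)
  show "plateau u \<le> 1" using nn[of "u - 1"] power_le_one[of "1 - relu_sq (u - 1)" 2]
    by (simp add: plateau_def relu_sq_def[of "1 - _"])
  show "\<bar>plateau' u\<bar> \<le> 4"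
  proof (cases "2 \<le> u")
    case False
    then have "max 0 (1 - relu_sq (u - 1)) * max 0 (u - 1) \<le> 1 * 1"
      using nn[of "u - 1"] by (intro mult_mono) auto
    then show ?thesis by (simp add: plateau'_def abs_mult)
  qed (simp add: z')
qed

text \<open>The squared norm keeps the function differentiable at the origin. It is 1 for |p| <= r
  and 0 for |p|^2 >= 2 r^2.\<close>

definition cutoff :: "real \<Rightarrow> real^2 \<Rightarrow> real" where "cutoff r p = plateau (p \<bullet> p / r\<^sup>2)"

lemma cutoff_1: "r > 0 \<Longrightarrow> norm p \<le> r \<Longrightarrow> cutoff r p = 1"
proof -
  assume "r > 0" "norm p \<le> r"
  then have "(norm p)\<^sup>2 \<le> r\<^sup>2" by (intro power_mono) auto
  then show ?thesis unfolding cutoff_def using \<open>r > 0\<close>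
    by (intro plateau_values) (simp add: power2_norm_eq_inner)
qed

text \<open>The gradient of the cutoff is of order 1 / r, but a field with zero value and zero
  derivative at the origin is o(r) on its support, so the product still tends to 0 with r.\<close>

lemma cutoff_small:
  assumes U: "open U" "0 \<in> U" and E: "E \<in> C1_fields U" "E 0 = 0" "jacobian E (at 0) = 0" and "c > 0" "r0 > 0"
  obtains r where "0 < r" "r \<le> r0" "C1_small U c (\<lambda>p. cutoff r p *\<^sub>R E p)"
proof -
  \<comment> \<open>On the support the value contributes 4 n, the cut-off Jacobian n, and the
    product of \<open>E\<close> with the gradient of the cutoff 32 n for each of its two rows: 4 + 1
    + 64 = 69.\<close>
  define n where "n = c / 69"
  have n: "n > 0" using \<open>c > 0\<close> by (simp add: n_def)
  obtain r1 where r1: "r1 > 0" "ball 0 r1 \<subseteq> U" using U open_contains_ball by blast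
  have "isCont (\<lambda>p. jacobian E (at p)) 0"
    using C1_field_continuous(2)[OF E(1)] U continuous_on_eq_continuous_at by blast
  then obtain r2 where r2: "r2 > 0" "\<And>p. norm p < r2 \<Longrightarrow> norm (jacobian E (at p)) < n"
    unfolding continuous_at_eps_delta using n E(3) by (metis diff_zero dist_0_norm dist_commute dist_norm)
  define r where "r = min (min r0 1) (min r1 r2 / 2)"
  have r: "r > 0" "r \<le> r0" "r \<le> 1" "2 * r \<le> r1" "2 * r \<le> r2" using r1 r2 \<open>r0 > 0\<close> by (auto simp: r_def)
  have dE: "(E has_derivative (\<lambda>h. jacobian E (at p) *v h)) (at p)" if "p \<in> U" for p
    using C1_fieldD U E that by blast
  have Ele: "norm (E p) \<le> 2 * n * norm p" if p: "norm p < 2 * r" for p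
  proof -
    have "norm (E p - E 0) \<le> 2 * n * norm (p - 0)"
    proof (rule differentiable_bound[where S = "ball 0 (2 * r)" and f' = "\<lambda>p h. jacobian E (at p) *v h"])
      fix q :: "real^2" assume q: "q \<in> ball 0 (2 * r)"
      then have "q \<in> U" using r r1 by auto
      then show "(E has_derivative (\<lambda>h. jacobian E (at q) *v h)) (at q within ball 0 (2 * r))"
        by (rule has_derivative_at_withinI[OF dE])
      have "norm (jacobian E (at q)) \<le> n" using r2(2)[of q] q r by simp
      then have "norm (jacobian E (at q) *v h) \<le> (2 * n) * norm h" for h
        using norm_matrix_vector_le[of "jacobian E (at q)" h] mult_right_mono[of "2 * norm (jacobian E (at q))" "2 * n" "norm h"]
        by simp
      then show "onorm (\<lambda>h. jacobian E (at q) *v h) \<le> 2 * n" by (rule onorm_le)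
    qed (use p r(1) in auto)
    then show ?thesis using E(2) by simp
  qed
  define g where "g p = (plateau' (p \<bullet> p / r\<^sup>2) * 2 / r\<^sup>2) *\<^sub>R p" for p :: "real^2"
  define J where "J p = cutoff r p *\<^sub>R jacobian E (at p) + (\<chi> i. (E p $ i) *\<^sub>R g p)" for p
  have dc: "(cutoff r has_derivative (\<lambda>h. g p \<bullet> h)) (at p)" for p
  proof -
    have "((\<lambda>p. p \<bullet> p) has_derivative (\<lambda>h. 2 * (p \<bullet> h))) (at p)"
      by (auto intro!: derivative_eq_intros simp: inner_commute)
    then have "((\<lambda>p. p \<bullet> p / r\<^sup>2) has_derivative (\<lambda>h. 2 * (p \<bullet> h) / r\<^sup>2)) (at p)"
      by (rule bounded_linear.has_derivative[OF bounded_linear_divide])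
    from has_derivative_compose[OF this plateau_deriv[unfolded has_field_derivative_def]]
    show ?thesis unfolding cutoff_def[abs_def] g_def by (simp add: mult.assoc)
  qed
  have d: "((\<lambda>p. cutoff r p *\<^sub>R E p) has_derivative (\<lambda>h. J p *v h)) (at p)" if "p \<in> U" for p
  proof -
    have "J p *v h = cutoff r p *\<^sub>R (jacobian E (at p) *v h) + (g p \<bullet> h) *\<^sub>R E p" for h
      by (simp add: J_def vec_eq_iff matrix_vector_mul_component inner_add_left mult.commute)
    then show ?thesis using has_derivative_scaleR[OF dc[of p] dE[OF that]] by simp
  qed
  have gc: "continuous_on A g" for A
    unfolding g_def[abs_def]
    by (intro continuous_intros continuous_on_compose2[OF plateau'_continuous]) (use r(1) in auto)
  have cc: "continuous_on A (cutoff r)" for A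
    by (rule continuous_at_imp_continuous_on) (intro ballI has_derivative_continuous[OF dc])
  have Jc: "continuous_on U J"
    unfolding J_def[abs_def]
    by (intro continuous_intros cc gc C1_field_continuous[OF E(1)] continuous_on_vec_lambda)
  have C1: "(\<lambda>p. cutoff r p *\<^sub>R E p) \<in> C1_fields U" by (rule C1_fieldI[OF d _], assumption, rule Jc)
  have "norm (cutoff r p *\<^sub>R E p) + norm (J p) \<le> c" for p
  proof (cases "2 \<le> p \<bullet> p / r\<^sup>2")
    case True
    then have "cutoff r p = 0" "g p = 0" by (auto simp: cutoff_def g_def plateau_values)
    then show ?thesis using \<open>c > 0\<close> by (simp add: J_def zero_vec_def[symmetric])
  next
    case False
    then have p2: "(norm p)\<^sup>2 < 2 * r\<^sup>2" using r(1) by (simp add: power2_norm_eq_inner field_simps)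
    then have "(norm p)\<^sup>2 < 4 * r\<^sup>2" using zero_le_power2[of r] by linarith
    then have "(norm p)\<^sup>2 < (2 * r)\<^sup>2" by (simp add: power_mult_distrib)
    then have p: "norm p < 2 * r" by (rule power_less_imp_less_base) (use r(1) in simp)
    have c01: "\<bar>cutoff r p\<bar> \<le> 1" using plateau_values(4,5) by (simp add: cutoff_def)
    have E1: "norm (E p) \<le> 4 * n"
    proof -
      have "n * norm p \<le> n * 2" using p r(3) n by (intro mult_left_mono) auto
      then show ?thesis using Ele[OF p] by simp
    qed
    have "norm (g p) \<le> 8 * norm p / r\<^sup>2"
    proof -
      have "norm (g p) = \<bar>plateau' (p \<bullet> p / r\<^sup>2)\<bar> * (2 * norm p / r\<^sup>2)" by (simp add: g_def abs_mult)
      also have "\<dots> \<le> 4 * (2 * norm p / r\<^sup>2)" by (intro mult_right_mono plateau_values) simp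
      finally show ?thesis by simp
    qed
    then have "norm (E p) * norm (g p) \<le> (2 * n * norm p) * (8 * norm p / r\<^sup>2)"
      using Ele[OF p] n by (intro mult_mono) auto
    also have "\<dots> = 16 * n * ((norm p)\<^sup>2 / r\<^sup>2)" by (simp add: power2_eq_square)
    also have "\<dots> \<le> 16 * n * 2" using p2 n r(1) by (intro mult_left_mono) (auto simp: divide_le_eq)
    finally have Eg: "norm (E p) * norm (g p) \<le> 32 * n" by simp
    have "norm (\<chi> i. (E p $ i) *\<^sub>R g p) \<le> \<bar>E p $ 1\<bar> * norm (g p) + \<bar>E p $ 2\<bar> * norm (g p)"
      using norm_le_rows[of "\<chi> i. (E p $ i) *\<^sub>R g p"] by simp
    also have "\<dots> \<le> norm (E p) * norm (g p) + norm (E p) * norm (g p)"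
      by (intro add_mono mult_right_mono component_le_norm_cart) auto
    finally have "norm (\<chi> i. (E p $ i) *\<^sub>R g p) \<le> 64 * n" using Eg by simp
    moreover have "norm (cutoff r p *\<^sub>R jacobian E (at p)) \<le> 1 * n"
      using r2(2)[of p] p r(5) c01 unfolding norm_scaleR by (intro mult_mono) auto
    ultimately have "norm (J p) \<le> 65 * n"
      unfolding J_def using norm_triangle_ineq[of "cutoff r p *\<^sub>R jacobian E (at p)" "\<chi> i. (E p $ i) *\<^sub>R g p"] by simp
    moreover have "norm (cutoff r p *\<^sub>R E p) \<le> 1 * (4 * n)"
      using c01 E1 unfolding norm_scaleR by (intro mult_mono) auto
    ultimately show ?thesis by (simp add: n_def)
  qed
  then have "C1_small U c (\<lambda>p. cutoff r p *\<^sub>R E p)"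
    unfolding C1_small_def using C1 jacobian_eqI[OF d] by simp
  then show ?thesis using that r(1,2) by blast
qed

section \<open>Size of a translation combined with a profile\<close>

lemma has_derivative_vector2:
  fixes u v :: "real^2 \<Rightarrow> real"
  assumes "(u has_derivative (\<lambda>h. u1 * h $ 1 + u2 * h $ 2)) (at p)"
    and "(v has_derivative (\<lambda>h. v1 * h $ 1 + v2 * h $ 2)) (at p)"
  shows "((\<lambda>p. vector [u p, v p] :: real^2) has_derivative
    (\<lambda>h. (vector [vector [u1, u2], vector [v1, v2]] :: real^2^2) *v h)) (at p)"
proof -
  have e: "(vector [a, b] :: real^2) = a *\<^sub>R vector [1, 0] + b *\<^sub>R vector [0, 1]" for a b
    by (simp add: vec_eq_iff forall_2)
  have "(vector [vector [u1, u2], vector [v1, v2]] :: real^2^2) *v h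
      = (u1 * h $ 1 + u2 * h $ 2) *\<^sub>R vector [1, 0] + (v1 * h $ 1 + v2 * h $ 2) *\<^sub>R vector [0, 1]" for h
    by (simp add: vec_eq_iff forall_2 matrix_vector_mult_def sum_2)
  then show ?thesis
    unfolding e[of "u _"] by (simp only:) (intro has_derivative_add has_derivative_scaleR_left assms)
qed

text \<open>The affine factor multiplying \<open>k1\<close> makes room for b1 times the factor
  \<open>s\<close> of the normal form, so that adding the profile changes \<open>f1\<close> alone
  and keeps the field a multiple of a Hamiltonian one.\<close>

lemma perturbation_small:
  assumes U: "\<And>p. p \<in> U \<Longrightarrow> norm p \<le> D" and "D \<ge> 0" "l \<ge> 0"
    and k: "\<And>x. (k1 has_real_derivative k2 x) (at x)" "continuous_on UNIV k2"
      "\<And>x. \<bar>x\<bar> \<le> D \<Longrightarrow> \<bar>k1 x\<bar> \<le> l * \<bar>x\<bar> \<and> \<bar>k2 x\<bar> \<le> l"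
    and le: "\<bar>c0\<bar> + l * (D + 1) * (\<bar>b\<bar> + (\<bar>c1\<bar> + \<bar>c2\<bar>) * (D + 1)) \<le> r"
  shows "C1_small U r (\<lambda>p. vector [c0, k1 (p $ 1) * (b + c1 * p $ 1 + c2 * p $ 2)])"
proof -
  define w where "w p = b + c1 * p $ 1 + c2 * p $ 2" for p :: "real^2"
  define J where "J p = (vector [vector [0, 0], vector [k2 (p $ 1) * w p + k1 (p $ 1) * c1, k1 (p $ 1) * c2]] :: real^2^2)" for p :: "real^2"
  have d: "((\<lambda>p. vector [c0, k1 (p $ 1) * w p] :: real^2) has_derivative (\<lambda>h. J p *v h)) (at p)" for p
  proof -
    have n: "((\<lambda>p. p $ 1) has_derivative (\<lambda>h. h $ 1)) (at p)" "((\<lambda>p. p $ 2) has_derivative (\<lambda>h. h $ 2)) (at p)"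
      by (auto intro: bounded_linear_imp_has_derivative)
    have "((\<lambda>p. k1 (p $ 1)) has_derivative (\<lambda>h. k2 (p $ 1) * h $ 1)) (at p)"
      using has_derivative_compose[OF n(1) k(1)[of "p $ 1", unfolded has_field_derivative_def]] by simp
    moreover have "(w has_derivative (\<lambda>h. c1 * h $ 1 + c2 * h $ 2)) (at p)"
      unfolding w_def[abs_def] using n by (auto intro!: derivative_eq_intros)
    ultimately have "((\<lambda>p. k1 (p $ 1) * w p) has_derivative
        (\<lambda>h. k1 (p $ 1) * (c1 * h $ 1 + c2 * h $ 2) + k2 (p $ 1) * h $ 1 * w p)) (at p)"
      by (rule has_derivative_mult)
    moreover have "(\<lambda>h :: real^2. k1 (p $ 1) * (c1 * h $ 1 + c2 * h $ 2) + k2 (p $ 1) * h $ 1 * w p)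
        = (\<lambda>h. (k2 (p $ 1) * w p + k1 (p $ 1) * c1) * h $ 1 + (k1 (p $ 1) * c2) * h $ 2)"
      by (simp add: algebra_simps)
    ultimately show ?thesis
      unfolding J_def by (intro has_derivative_vector2) (auto intro: has_derivative_const)
  qed
  have k1c: "continuous_on UNIV k1"
    by (rule continuous_at_imp_continuous_on) (intro ballI DERIV_isCont[OF k(1)])
  have Jc: "continuous_on U J"
    unfolding J_def[abs_def] w_def
    by (intro continuous_on_vector2 continuous_intros continuous_on_compose2[OF k(2)] continuous_on_compose2[OF k1c]) auto
  have C1: "(\<lambda>p. vector [c0, k1 (p $ 1) * w p] :: real^2) \<in> C1_fields U" by (rule C1_fieldI[OF d Jc])
  have "norm (vector [c0, k1 (p $ 1) * w p] :: real^2) + norm (J p) \<le> r" if p: "p \<in> U" for p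
  proof -
    have x: "\<bar>p $ 1\<bar> \<le> D" "\<bar>p $ 2\<bar> \<le> D"
      using U[OF p] component_le_norm_cart[of p 1] component_le_norm_cart[of p 2] by linarith+
    have k1: "\<bar>k1 (p $ 1)\<bar> \<le> l * D"
      using k(3)[OF x(1)] mult_left_mono[OF x(1) \<open>l \<ge> 0\<close>] by linarith
    have k2: "\<bar>k2 (p $ 1)\<bar> \<le> l" using k(3)[OF x(1)] by simp
    define M where "M = \<bar>b\<bar> + (\<bar>c1\<bar> + \<bar>c2\<bar>) * D"
    have "\<bar>c1 * p $ 1\<bar> \<le> \<bar>c1\<bar> * D" "\<bar>c2 * p $ 2\<bar> \<le> \<bar>c2\<bar> * D"
      using x by (auto simp: abs_mult intro: mult_left_mono)
    then have w: "\<bar>w p\<bar> \<le> M" unfolding w_def M_def distrib_right by linarith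
    have lD: "l * D \<ge> 0" using \<open>l \<ge> 0\<close> \<open>D \<ge> 0\<close> by simp
    have 1: "\<bar>k1 (p $ 1) * w p\<bar> \<le> l * D * M" "\<bar>k2 (p $ 1) * w p\<bar> \<le> l * M"
      unfolding abs_mult using k1 k2 w lD \<open>l \<ge> 0\<close> by (auto intro!: mult_mono)
    have 2: "\<bar>k1 (p $ 1) * c1\<bar> \<le> l * D * \<bar>c1\<bar>" "\<bar>k1 (p $ 1) * c2\<bar> \<le> l * D * \<bar>c2\<bar>"
      unfolding abs_mult using k1 by (auto intro!: mult_right_mono)
    have rows: "norm (a :: real^2) \<le> \<bar>a $ 1\<bar> + \<bar>a $ 2\<bar>" for a using norm_le_rows[of a] by simp
    have "norm (J p) \<le> \<bar>k2 (p $ 1) * w p + k1 (p $ 1) * c1\<bar> + \<bar>k1 (p $ 1) * c2\<bar>"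
      using norm_le_rows[of "J p"] rows[of "J p $ 1"] rows[of "J p $ 2"] by (simp add: J_def)
    moreover have "norm (vector [c0, k1 (p $ 1) * w p] :: real^2) \<le> \<bar>c0\<bar> + \<bar>k1 (p $ 1) * w p\<bar>"
      using rows[of "vector [c0, k1 (p $ 1) * w p]"] by simp
    ultimately have "norm (vector [c0, k1 (p $ 1) * w p] :: real^2) + norm (J p)
        \<le> \<bar>c0\<bar> + (l * D * M + l * M + l * D * (\<bar>c1\<bar> + \<bar>c2\<bar>))"
      using 1 2 abs_triangle_ineq[of "k2 (p $ 1) * w p" "k1 (p $ 1) * c1"]
        distrib_left[of "l * D" "\<bar>c1\<bar>" "\<bar>c2\<bar>"] by linarith
    also have "l * D * M + l * M + l * D * (\<bar>c1\<bar> + \<bar>c2\<bar>) \<le> l * (D + 1) * (\<bar>b\<bar> + (\<bar>c1\<bar> + \<bar>c2\<bar>) * (D + 1))"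
    proof -
      have "l * (D + 1) * (\<bar>b\<bar> + (\<bar>c1\<bar> + \<bar>c2\<bar>) * (D + 1)) - (l * D * M + l * M + l * D * (\<bar>c1\<bar> + \<bar>c2\<bar>)) = l * (\<bar>c1\<bar> + \<bar>c2\<bar>)"
        by (simp add: M_def algebra_simps)
      moreover have "l * (\<bar>c1\<bar> + \<bar>c2\<bar>) \<ge> 0" using \<open>l \<ge> 0\<close> by simp
      ultimately show ?thesis by linarith
    qed
    finally show ?thesis using le by linarith
  qed
  then show ?thesis
    unfolding C1_small_def using C1 jacobian_eqI[OF d] by (simp add: w_def[abs_def])
qed

subsection \<open>Bifurcation from the linear saddle and center\<close>

lemma half_plane_profile:
  assumes "e > 0" "0 < Y" "Y < R" "\<bar>a\<bar> * R \<le> e / 4" "\<bar>sg\<bar> * Y \<le> e / 2" "b > 0"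
    and k: "\<And>x. (k has_real_derivative k1 x) (at x)" "k 0 = 0" "\<And>x. \<bar>x\<bar> < R \<Longrightarrow> \<bar>k1 x\<bar> \<le> \<bar>x\<bar> / 2"
    and s: "continuous_on (ball 0 R) s" "\<And>p. norm p < R \<Longrightarrow> s p > 0"
  shows "half_plane R e a sg Y (\<lambda>x. b * (x\<^sup>2 / 2 + k x)) (\<lambda>x. b * (x + k1 x)) s"
proof
  show "((\<lambda>x. b * (x\<^sup>2 / 2 + k x)) has_real_derivative b * (x + k1 x)) (at x)" for x
    using k(1)[of x] by (auto intro!: derivative_eq_intros)
  show "0 < b * (x + k1 x)" if "0 < x" "x < R" for x
    using k(3)[of x] that \<open>b > 0\<close> by simp
  show "b * (x + k1 x) < 0" if "- R < x" "x < 0" for x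
    using k(3)[of x] that \<open>b > 0\<close> by (simp add: mult_pos_neg)
qed (use assms in auto)

lemma nonsmooth_equilibrium_0:
  assumes "0 \<in> U" "X 0 = 0" "Y 0 = 0"
  shows "nonsmooth_equilibrium U (X, Y) 0"
  using assms by (simp add: nonsmooth_equilibrium_def switching_line_def filippov_def)

lemma linear_field:
  "((\<lambda>p. A *v p) has_derivative (\<lambda>h. A *v h)) (at p)" for A :: "real^2^2"
  by (rule bounded_linear_imp_has_derivative) (rule matrix_vector_mul_bounded_linear)

lemma linear_field_C1: "(\<lambda>p. A *v p) \<in> C1_fields U" for A :: "real^2^2"
  by (rule C1_fieldI[where J = "\<lambda>_. A"]) (auto intro: linear_field)

lemma constant_small:
  assumes "bounded U" "\<bar>c0\<bar> \<le> r"
  shows "C1_small U r (\<lambda>p. vector [c0, 0])"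
proof -
  obtain D where D: "D > 0" "\<forall>p\<in>U. norm p \<le> D" using assms(1) unfolding bounded_pos by blast
  have "C1_small U r (\<lambda>p. vector [c0, 0 * (0 + 0 * p $ 1 + 0 * p $ 2)])"
    by (rule perturbation_small[where D = D and l = 0 and ?k2.0 = "\<lambda>_. 0"]) (use D assms(2) in auto)
  then show ?thesis by simp
qed

lemma C1_small_mono: "C1_small U r E \<Longrightarrow> r \<le> r' \<Longrightarrow> C1_small U r' E"
  by (force simp: C1_small_def)

text \<open>Here \<open>sg = 1\<close> is the center and \<open>sg = -1\<close> the saddle. The
  perturbed fields are Hamiltonian as they stand, with \<open>a = 0\<close> and
  \<open>s = 1\<close>, so \<open>a_le\<close> holds for every \<open>R\<close>: the ball of radius
  R serves as the neighbourhood fixed before \<open>N\<close> and \<open>W\<close>.\<close>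

lemma linear_center_saddle_bifurcates:
  fixes sg :: real and m :: enat
  assumes U: "open U" "bounded U" "0 \<in> U" and "\<bar>sg\<bar> = 1" "m \<noteq> 0"
  defines "L \<equiv> \<lambda>p. (vector [vector [0, - sg], vector [1, 0]] :: real^2^2) *v p"
  shows "bifurcates_exactly_hyperbolic U (L, L) m"
proof -
  have L: "L p = vector [- sg * p $ 2, p $ 1]" for p
    by (simp add: L_def vec_eq_iff forall_2 matrix_vector_mult_def sum_2)
  have LC: "L \<in> C1_fields U" unfolding L_def by (rule linear_field_C1)
  obtain R where R: "R > 0" "ball 0 R \<subseteq> U" using U open_contains_ball by blast
  obtain D where D: "D > 0" "\<And>p. p \<in> U \<Longrightarrow> norm p \<le> D" using \<open>bounded U\<close> unfolding bounded_pos by blast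
  have ex: "\<exists>Z'\<in>N. ecard {C. crossing_limit_cycle U Z' C \<and> C \<subseteq> ball 0 R} = m \<and>
       (\<forall>C. crossing_limit_cycle U Z' C \<and> C \<subseteq> ball 0 R \<longrightarrow> hyperbolic_clc U Z' C \<and> C \<subseteq> W)"
    if NW: "Omega_nbhd U (L, L) N" "open W" "0 \<in> W" for N W
  proof -
    obtain r where r: "r > 0" "\<And>E F. C1_small U r E \<Longrightarrow> C1_small U r F \<Longrightarrow> (\<lambda>p. L p + E p, \<lambda>p. L p + F p) \<in> N"
      using Omega_nbhd_small[OF U(1) _ NW(1)] U(3) by auto
    obtain w where w: "w > 0" "ball 0 w \<subseteq> W" using NW open_contains_ball by blast
    \<comment> \<open>With Y = e / 2, the largest height that \<open>sg_le\<close> permits, and d =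
      e / 4, the cycles lie in the ball of radius 2 d + Y = e < w. As e <= r / 2, another r / 2
      remains for the profile.\<close>
    define e where "e = min (r / 2) (min R w / 2)"
    have e: "e > 0" "e \<le> r / 2" "e < R" "e < w" using r R w by (auto simp: e_def)
    define l where "l = min (1 / 2) (r / (2 * (D + 1)))"
    have l: "l > 0" "l \<le> 1 / 2" "l * (D + 1) \<le> r / 2"
    proof -
      show "l > 0" using r D by (simp add: l_def)
      show "l \<le> 1 / 2" unfolding l_def by (rule min.cobounded1)
      have "l * (D + 1) \<le> r / (2 * (D + 1)) * (D + 1)" using D by (intro mult_right_mono) (auto simp: l_def)
      moreover have "r / (2 * (D + 1)) * (D + 1) = r / 2" using D by (simp add: field_simps)
      ultimately show "l * (D + 1) \<le> r / 2" by (simp only:)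
    qed
    \<comment> \<open>The profile must be controlled up to R for the return map and up to D, which
      bounds \<open>U\<close>, for its size in the topology.\<close>
    have ed: "e / 4 > 0" and RD: "max R D > 0" using e(1) R by auto
    obtain k k1 k2 where k: "\<And>x. (k has_real_derivative k1 x) (at x)"
      "\<And>x. (k1 has_real_derivative k2 x) (at x)" "continuous_on UNIV k2" "\<And>x. x \<le> 0 \<Longrightarrow> k x = 0"
      "\<And>x. \<bar>x\<bar> \<le> max R D \<Longrightarrow> \<bar>k1 x\<bar> \<le> l * \<bar>x\<bar> \<and> \<bar>k2 x\<bar> \<le> l"
      "\<And>x. 0 < x \<Longrightarrow> k x = 0 \<Longrightarrow> x < e / 4 \<and> k1 x \<noteq> 0"
      "ecard {x. 0 < x \<and> k x = 0} = m"
      by (rule perturbation_profile[OF \<open>m \<noteq> 0\<close> ed RD l(1)]) (rule that)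
    have k1: "\<bar>k1 x\<bar> \<le> \<bar>x\<bar> / 2" if "\<bar>x\<bar> < R" for x
    proof -
      have "l * \<bar>x\<bar> \<le> 1 / 2 * \<bar>x\<bar>" using l(2) by (intro mult_right_mono) auto
      moreover have "\<bar>x\<bar> \<le> max R D" using that by simp
      ultimately show ?thesis using k(5)[of x] by linarith
    qed
    define E where "E p = (vector [- e, k1 (p $ 1) * (1 + 0 * p $ 1 + 0 * p $ 2)] :: real^2)" for p :: "real^2"
    define F where "F p = (vector [e, 0] :: real^2)" for p :: "real^2"
    have Es: "C1_small U r E"
      unfolding E_def
      by (rule perturbation_small[where D = D and l = l and ?k2.0 = k2]) (use D k l e in auto)
    have Fs: "C1_small U r F" unfolding F_def by (rule constant_small) (use U e in auto)
    define Z' where "Z' = (\<lambda>p. L p + E p, \<lambda>p. L p + F p)"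
    have ZN: "Z' \<in> N" unfolding Z'_def by (rule r(2)[OF Es Fs])
    have ZC: "fst Z' \<in> C1_fields U" "snd Z' \<in> C1_fields U"
      using C1_fields_add(1)[OF U(1) LC] Es Fs by (auto simp: Z'_def C1_small_def)
    interpret up: half_plane R e 0 sg "e / 2" "\<lambda>x. 1 * (x\<^sup>2 / 2 + k x)" "\<lambda>x. 1 * (x + k1 x)" "\<lambda>_. 1"
      by (rule half_plane_profile) (use e k k1 \<open>\<bar>sg\<bar> = 1\<close> in auto)
    have "half_plane R e 0 sg (e / 2) (\<lambda>x. 1 * (x\<^sup>2 / 2 + 0)) (\<lambda>x. 1 * (x + 0)) (\<lambda>_. 1)"
      by (rule half_plane_profile) (use e \<open>\<bar>sg\<bar> = 1\<close> in auto)
    then interpret lo: half_plane R e 0 sg "e / 2" "\<lambda>x. 1 * (x\<^sup>2 / 2)" "\<lambda>x. 1 * x" "\<lambda>_. 1" by simp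
    interpret perturbed_pair R e 0 0 sg "e / 2" 1 1 k k1 "\<lambda>_. 1" "\<lambda>_. 1" U Z' "e / 4"
    proof
      show "fst Z' p = half_field (\<lambda>_. 1) e 0 sg (\<lambda>x. 1 * (x + k1 x)) p" for p
        by (simp add: Z'_def L E_def vec_eq_iff forall_2)
      show "snd Z' p = - half_field (\<lambda>_. 1) e 0 sg (\<lambda>x. 1 * x) (- p)" for p
        by (simp add: Z'_def L F_def vec_eq_iff forall_2)
      show "continuous_on (ball 0 R) (fst Z')" "continuous_on (ball 0 R) (snd Z')"
        using C1_field_continuous(1) ZC R continuous_on_subset by blast+
      have "e * e > 0" using e(1) by simp
      then show "1 * (e / 4)\<^sup>2 < e / 2 * e / 2" "2 * 1 * (e / 4)\<^sup>2 < e / 2 * e / 2"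
        by (auto simp: power2_eq_square)
    qed (use R k k1 e in auto)
    have S: "{x. 0 < x \<and> x < R \<and> k x = 0} = {x. 0 < x \<and> k x = 0}" using k(6) e by force
    have "ecard {C. crossing_limit_cycle U Z' C \<and> C \<subseteq> ball 0 R} = m"
      using crossing_limit_cycles(1) k(7) unfolding S by simp
    moreover have "hyperbolic_clc U Z' C \<and> C \<subseteq> W" if "crossing_limit_cycle U Z' C \<and> C \<subseteq> ball 0 R" for C
    proof -
      have "hyperbolic_clc U Z' C" "C \<subseteq> ball 0 (2 * (e / 4) + e / 2)"
        using crossing_limit_cycles(2) that by blast+
      moreover have "ball 0 (2 * (e / 4) + e / 2) \<subseteq> (ball 0 w :: (real^2) set)" using e by auto
      ultimately show ?thesis using w(2) by blast
    qed
    ultimately show ?thesis using ZN by blast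
  qed
  have "L 0 = 0" by (simp add: L_def)
  then have "nonsmooth_equilibrium U (L, L) 0" using nonsmooth_equilibrium_0 U(3) by blast
  then show ?thesis
    unfolding bifurcates_exactly_hyperbolic_def
    using ex R(1) by (intro conjI exI[of _ "ball 0 R"] allI impI) auto
qed

section \<open>Classification of the two linear examples\<close>

lemma linear_Omega0:
  fixes A B :: "real^2^2"
  assumes "det A * det B \<noteq> 0" "A $ 2 $ 1 * B $ 2 $ 1 > 0"
  shows "((\<lambda>p. A *v p), (\<lambda>p. B *v p)) \<in> Omega0 U"
  using assms linear_field_C1[of A U] linear_field_C1[of B U]
  by (simp add: Omega0_def Omega_def jacobian_eqI[OF linear_field])

lemma saddle_in_Omega1:
  defines "A \<equiv> (vector [vector [0, 1], vector [1, 0]] :: real^2^2)"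
  shows "((\<lambda>p. A *v p), (\<lambda>p. A *v p)) \<in> Omega1 U"
proof -
  have "eigenvalues A 1 (- 1)"
    unfolding eigenvalues_def det_2 A_def by (simp add: mat_def algebra_simps)
  moreover have "((\<lambda>p. A *v p), (\<lambda>p. A *v p)) \<in> Omega0 U"
    by (rule linear_Omega0) (simp_all add: A_def det_2)
  moreover have "ell 1 1 \<noteq> 0" "(1::complex) \<noteq> - 1" by (simp_all add: ell_def)
  ultimately have "((\<lambda>p. A *v p), (\<lambda>p. A *v p)) \<in> Omega0 U \<and> (\<exists>lp1 lp2 lm1 lm2.
      eigenvalues A lp1 lp2 \<and> eigenvalues A lm1 lm2 \<and> lp1 \<noteq> lp2 \<and> lm1 \<noteq> lm2 \<and> ell lp1 lm1 \<noteq> 0)"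
    by blast
  then show ?thesis
    by (simp only: Omega1_def mem_Collect_eq prod.case jacobian_eqI[OF linear_field])
qed

text \<open>The characteristic polynomial is z^2 + 1, so both quotients in \<open>ell\<close> have
  numerator 0 for every labelling of the eigenvalues.\<close>

lemma center_in_Omega0_minus_Omega1:
  defines "A \<equiv> (vector [vector [0, - 1], vector [1, 0]] :: real^2^2)"
  shows "((\<lambda>p. A *v p), (\<lambda>p. A *v p)) \<in> Omega0 U - Omega1 U"
proof -
  have imag: "Re l1 = 0 \<and> Im l1 \<noteq> 0" if "eigenvalues A l1 l2" for l1 l2
  proof -
    have "det (mat l1 - (\<chi> i j. complex_of_real (A $ i $ j))) = l1 * l1 + 1"
      by (simp add: det_2 A_def mat_def)
    then have "l1 * l1 + 1 = 0" using that by (simp add: eigenvalues_def)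
    then have "Re (l1 * l1 + 1) = 0" "Im (l1 * l1 + 1) = 0" by simp_all
    then have r: "Re l1 * Re l1 - Im l1 * Im l1 = - 1" "Re l1 = 0 \<or> Im l1 = 0" by auto
    have "Im l1 \<noteq> 0"
    proof
      assume "Im l1 = 0"
      then have "Re l1 * Re l1 = - 1" using r(1) by simp
      then show False using zero_le_square[of "Re l1"] by linarith
    qed
    then show ?thesis using r(2) by blast
  qed
  have "((\<lambda>p. A *v p), (\<lambda>p. A *v p)) \<in> Omega0 U"
    by (rule linear_Omega0) (simp_all add: A_def det_2)
  moreover have "((\<lambda>p. A *v p), (\<lambda>p. A *v p)) \<notin> Omega1 U"
    using imag by (auto simp: Omega1_def jacobian_eqI[OF linear_field] ell_def)
  ultimately show ?thesis by blast
qed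

subsection \<open>Bifurcation from an arbitrary field\<close>

text \<open>The correction consists of the linearisation error and the quadratic field
  \<open>Q\<close>, both cut off. The coefficients \<open>al\<close> and \<open>be\<close> contain 1
  / e and may be huge; this is harmless, since the cutoff radius is chosen after \<open>e\<close>.
  The translation is left to the caller, and e may be negative, as the lower field requires.\<close>

lemma normal_form:
  assumes U: "open U" "0 \<in> U" and X: "X \<in> C1_fields U" "X 0 = 0" and "r > 0" "e \<noteq> 0"
  obtains al be h E where "h > 0" "C1_small U r E"
    "\<And>p. norm p \<le> h \<Longrightarrow> X p + E p = vector [e, 0] +
      half_field (\<lambda>p. 1 + al * p $ 1 + be * p $ 2) e (jacobian X (at 0) $ 2 $ 2) 0
        (\<lambda>x. jacobian X (at 0) $ 2 $ 1 * x) p"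
proof -
  define A where "A = jacobian X (at 0)"
  define a where "a = A $ 2 $ 2"
  define b where "b = A $ 2 $ 1"
  define al where "al = - (A $ 1 $ 1 + a) / e"
  define be where "be = - A $ 1 $ 2 / e"
  define E1 where "E1 p = A *v p + - X p" for p
  have E1: "E1 \<in> C1_fields U" "E1 0 = 0" "jacobian E1 (at 0) = 0"
  proof -
    show "E1 \<in> C1_fields U" unfolding E1_def[abs_def]
      by (intro C1_fields_add C1_fields_minus U X linear_field_C1)
    show "E1 0 = 0" by (simp add: E1_def X)
    have "jacobian (\<lambda>p. A *v p + - X p) (at 0) = jacobian (\<lambda>p. A *v p) (at 0) + jacobian (\<lambda>p. - X p) (at 0)"
      by (rule C1_fields_add(2)[OF U(1) linear_field_C1 C1_fields_minus(1)[OF U(1) X(1)] U(2)])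
    then show "jacobian E1 (at 0) = 0"
      unfolding E1_def[abs_def] by (simp add: jacobian_eqI[OF linear_field] C1_fields_minus(2)[OF U(1) X(1) U(2)] A_def)
  qed
  define w where "w p = al * p $ 1 + be * p $ 2" for p :: "real^2"
  \<comment> \<open>the quadratic part of the product; \<open>al\<close> and \<open>be\<close> are chosen so that its linear part is \<open>A\<close>\<close>
  define Q where "Q p = (vector [w p * (- a * p $ 1), w p * (b * p $ 1 + a * p $ 2)] :: real^2)" for p :: "real^2"
  define JQ where "JQ p = (vector [vector [al * (- a * p $ 1) + w p * (- a), be * (- a * p $ 1)],
      vector [al * (b * p $ 1 + a * p $ 2) + w p * b, be * (b * p $ 1 + a * p $ 2) + w p * a]] :: real^2^2)" for p :: "real^2"
  have dQ: "(Q has_derivative (\<lambda>h. JQ p *v h)) (at p)" for p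
  proof -
    have n: "((\<lambda>p. p $ 1) has_derivative (\<lambda>h. h $ 1)) (at p)" "((\<lambda>p. p $ 2) has_derivative (\<lambda>h. h $ 2)) (at p)" for p :: "real^2"
      by (auto intro: bounded_linear_imp_has_derivative)
    have dw: "(w has_derivative (\<lambda>h. al * h $ 1 + be * h $ 2)) (at p)"
      unfolding w_def[abs_def] using n by (auto intro!: derivative_eq_intros)
    have d1: "((\<lambda>p. - a * p $ 1) has_derivative (\<lambda>h. - a * h $ 1)) (at p)"
      using n by (auto intro!: derivative_eq_intros)
    have d2: "((\<lambda>p. b * p $ 1 + a * p $ 2) has_derivative (\<lambda>h. b * h $ 1 + a * h $ 2)) (at p)"
      using n by (auto intro!: derivative_eq_intros)
    have 1: "(\<lambda>h :: real^2. w p * (- a * h $ 1) + (al * h $ 1 + be * h $ 2) * (- a * p $ 1))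
      = (\<lambda>h. (al * (- a * p $ 1) + w p * (- a)) * h $ 1 + be * (- a * p $ 1) * h $ 2)"
      by (simp add: algebra_simps)
    have 2: "(\<lambda>h :: real^2. w p * (b * h $ 1 + a * h $ 2) + (al * h $ 1 + be * h $ 2) * (b * p $ 1 + a * p $ 2))
      = (\<lambda>h. (al * (b * p $ 1 + a * p $ 2) + w p * b) * h $ 1 + (be * (b * p $ 1 + a * p $ 2) + w p * a) * h $ 2)"
      by (simp add: algebra_simps)
    show ?thesis
      unfolding Q_def[abs_def] JQ_def
      by (rule has_derivative_vector2[OF has_derivative_mult[OF dw d1, unfolded 1] has_derivative_mult[OF dw d2, unfolded 2]])
  qed
  have "continuous_on U JQ"
    unfolding JQ_def[abs_def] w_def by (intro continuous_on_vector2 continuous_intros)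
  then have Q: "Q \<in> C1_fields U" "Q 0 = 0" "jacobian Q (at 0) = 0"
    using C1_fieldI[OF dQ] jacobian_eqI[OF dQ, of 0]
    by (auto simp: Q_def JQ_def w_def vec_eq_iff forall_2)
  have "r / 2 > 0" using \<open>r > 0\<close> by simp
  from cutoff_small[OF U E1 this zero_less_one]
  obtain h1 where h1: "h1 > 0" "C1_small U (r / 2) (\<lambda>p. cutoff h1 p *\<^sub>R E1 p)" by blast
  \<comment> \<open>The second radius is at most the first, so both cutoffs equal 1 on the smaller
    ball.\<close>
  from cutoff_small[OF U Q \<open>r / 2 > 0\<close> h1(1)]
  obtain h2 where h2: "h2 > 0" "h2 \<le> h1" "C1_small U (r / 2) (\<lambda>p. cutoff h2 p *\<^sub>R Q p)" by blast
  show ?thesis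
  proof (rule that[OF h2(1)])
    show "C1_small U r (\<lambda>p. cutoff h1 p *\<^sub>R E1 p + cutoff h2 p *\<^sub>R Q p)"
      using C1_small_add[OF U(1) h1(2) h2(3)] by simp
    fix p :: "real^2" assume p: "norm p \<le> h2"
    have "e * al = - (A $ 1 $ 1 + a)" "e * be = - A $ 1 $ 2" using \<open>e \<noteq> 0\<close> by (auto simp: al_def be_def)
    then have A1: "A $ 1 $ 1 = - a - e * al" "A $ 1 $ 2 = - (e * be)" by linarith+
    have "A $ 1 $ 1 * p $ 1 + A $ 1 $ 2 * p $ 2 = - a * p $ 1 - e * al * p $ 1 - e * be * p $ 2"
      unfolding A1 by (simp add: algebra_simps)
    then have "A *v p + Q p = vector [e, 0] + half_field (\<lambda>p. 1 + al * p $ 1 + be * p $ 2) e a 0 (\<lambda>x. b * x) p"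
      by (simp add: vec_eq_iff forall_2 matrix_vector_mult_def sum_2 Q_def w_def a_def[symmetric] b_def[symmetric])
         (simp add: algebra_simps)
    moreover have "cutoff h1 p = 1" "cutoff h2 p = 1" using cutoff_1 h1(1) h2(1,2) p by auto
    ultimately show "X p + (cutoff h1 p *\<^sub>R E1 p + cutoff h2 p *\<^sub>R Q p) = vector [e, 0] +
      half_field (\<lambda>p. 1 + al * p $ 1 + be * p $ 2) e (jacobian X (at 0) $ 2 $ 2) 0
        (\<lambda>x. jacobian X (at 0) $ 2 $ 1 * x) p"
      by (simp add: E1_def A_def[symmetric] a_def b_def)
  qed
qed

text \<open>Reversing time reduces fields rotating clockwise to the counterclockwise case. The Filippov
  field is not odd at crossing points, but an orbit never stays on the line near one.\<close>

lemma filippov_minus: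
  assumes "\<not> X p $ 2 * Y p $ 2 > 0 \<or> (\<forall>q\<in>switching_line U. X q = Y q)"
  shows "filippov U (\<lambda>p. - X p, \<lambda>p. - Y p) p = - filippov U (X, Y) p"
proof -
  have eq: "(\<forall>q\<in>switching_line U. - X q = - Y q) \<longleftrightarrow> (\<forall>q\<in>switching_line U. X q = Y q)" by simp
  have frac: "u / (- x - - y) = - (u / (x - y))" for u x y :: real
    by (simp only: minus_diff_minus minus_divide_right)
  have neg: "- vector [u, 0] = (vector [- u, 0] :: real^2)" for u
    by (simp add: vec_eq_iff forall_2)
  show ?thesis
  proof (cases "\<forall>q\<in>switching_line U. X q = Y q")
    case True
    then show ?thesis by (simp add: filippov_def)
  next
    case False
    then have "\<not> X p $ 2 * Y p $ 2 > 0" using assms by blast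
    with False show ?thesis
      by (cases "X p $ 2 = Y p $ 2")
        (simp_all only: filippov_def fst_conv snd_conv Let_def eq vector_uminus_component
          minus_mult_minus neg_equal_iff_equal minus_zero neg frac if_False if_True simp_thms)
  qed
qed

lemma pw_orbit_reverse:
  assumes orb: "pw_orbit U (X, Y) UNIV g"
  shows "pw_orbit U (\<lambda>p. - X p, \<lambda>p. - Y p) UNIV (\<lambda>t. g (- t))"
proof -
  obtain B where B: "\<And>a b. finite (B \<inter> {a..b})"
    and sol: "\<And>s t. s < t \<Longrightarrow> {s<..<t} \<inter> B = {} \<Longrightarrow>
          solves_in (upper_part U) X g {s<..<t} \<or> solves_in (lower_part U) Y g {s<..<t} \<or>
          solves_in (switching_line U) (filippov U (X, Y)) g {s<..<t}"
    using orb unfolding pw_orbit_def fst_conv snd_conv by (metis subset_UNIV)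
  have rev: "solves_in S (\<lambda>p. - F p) (\<lambda>t. g (- t)) {s<..<t}" if "solves_in S F g {- t<..<- s}" for S F s t
    unfolding solves_in_def
  proof (rule ballI)
    fix u assume u: "u \<in> {s<..<t}"
    then have v: "g (- u) \<in> S" "(g has_vector_derivative F (g (- u))) (at (- u))"
      using that unfolding solves_in_def by auto
    have "(uminus has_vector_derivative - 1) (at u)"
      using has_vector_derivative_minus[OF has_vector_derivative_id] by simp
    from vector_diff_chain_at[OF this v(2)] v(1)
    show "g (- u) \<in> S \<and> ((\<lambda>t. g (- t)) has_vector_derivative - F (g (- u))) (at u)"
      by (simp add: o_def)
  qed
  have line: "solves_in (switching_line U) (\<lambda>p. - filippov U (X, Y) p) h {s<..<t} \<longleftrightarrow>
      solves_in (switching_line U) (filippov U (\<lambda>p. - X p, \<lambda>p. - Y p)) h {s<..<t}"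
    if "solves_in (switching_line U) (\<lambda>p. - filippov U (X, Y) p) h {s<..<t}" for h s t
  proof -
    have "filippov U (\<lambda>p. - X p, \<lambda>p. - Y p) (h u) = - filippov U (X, Y) (h u)" if u: "u \<in> {s<..<t}" for u
    proof (rule filippov_minus, rule ccontr)
      \<comment> \<open>At such a point the Filippov value has nonzero second component, while an
        orbit that stays on the line for an open time interval has none.\<close>
      assume c: "\<not> (\<not> X (h u) $ 2 * Y (h u) $ 2 > 0 \<or> (\<forall>q\<in>switching_line U. X q = Y q))"
      then have f2: "filippov U (X, Y) (h u) $ 2 \<noteq> 0" by (auto simp: filippov_def Let_def)
      have sol: "h v \<in> switching_line U \<and> (h has_vector_derivative - filippov U (X, Y) (h v)) (at v)" if "v \<in> {s<..<t}" for v
        using \<open>solves_in (switching_line U) (\<lambda>p. - filippov U (X, Y) p) h {s<..<t}\<close> that by (simp add: solves_in_def)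
      have d1: "((\<lambda>v. h v $ 2) has_real_derivative (- filippov U (X, Y) (h u)) $ 2) (at u)"
        using has_vector_derivative_component sol[OF u] by blast
      have d2: "((\<lambda>v. h v $ 2) has_real_derivative 0) (at u)"
        by (rule has_field_derivative_transform_within_open[OF DERIV_const[of 0], where S = "{s<..<t}"])
           (use u sol in \<open>auto simp: switching_line_def\<close>)
      show False using DERIV_unique[OF d1 d2] f2 by simp
    qed
    then show ?thesis unfolding solves_in_def by simp
  qed
  show ?thesis
    unfolding pw_orbit_def fst_conv snd_conv
  proof (intro conjI exI[of _ "uminus ` B"] allI impI)
    have "continuous_on UNIV g" "range g \<subseteq> U" using orb by (auto simp: pw_orbit_def)
    then show "continuous_on UNIV (\<lambda>t. g (- t))" "range (\<lambda>t. g (- t)) \<subseteq> U"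
      by (auto intro!: continuous_on_compose2[of UNIV g] continuous_intros)
    have "uminus ` B \<inter> {a..b} = uminus ` (B \<inter> {- b..- a})" for a b by force
    then show "finite (uminus ` B \<inter> {a..b})" for a b using B by simp
    fix s t :: real
    assume st: "s < t \<and> {s<..<t} \<subseteq> UNIV \<and> {s<..<t} \<inter> uminus ` B = {}"
    have "{- t<..<- s} \<inter> B = {}"
    proof (rule ccontr)
      assume "{- t<..<- s} \<inter> B \<noteq> {}"
      then obtain x where "x \<in> B" "- t < x" "x < - s" by auto
      then have "- x \<in> {s<..<t} \<inter> uminus ` B" by auto
      then show False using st by blast
    qed
    then have "solves_in (upper_part U) X g {- t<..<- s} \<or> solves_in (lower_part U) Y g {- t<..<- s} \<or>
          solves_in (switching_line U) (filippov U (X, Y)) g {- t<..<- s}"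
      using sol st by simp
    then show "solves_in (upper_part U) (\<lambda>p. - X p) (\<lambda>t. g (- t)) {s<..<t} \<or>
        solves_in (lower_part U) (\<lambda>p. - Y p) (\<lambda>t. g (- t)) {s<..<t} \<or>
        solves_in (switching_line U) (filippov U (\<lambda>p. - X p, \<lambda>p. - Y p)) (\<lambda>t. g (- t)) {s<..<t}"
      using rev[of _ _ t s] line by blast
  qed
qed

lemma periodic_orbit_reverse:
  assumes "periodic_orbit U (X, Y) C"
  shows "periodic_orbit U (\<lambda>p. - X p, \<lambda>p. - Y p) C"
proof -
  obtain g T where g: "pw_orbit U (X, Y) UNIV g" "T > 0" "\<And>t. g (t + T) = g t" "\<exists>t. g t \<noteq> g 0" "C = range g"
    using assms unfolding periodic_orbit_def by blast
  define h where "h t = g (- t)" for t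
  have gh: "g t = h (- t)" for t by (simp add: h_def)
  have per: "\<forall>t. h (t + T) = h t"
  proof
    show "h (t + T) = h t" for t using g(3)[of "- t - T"] by (simp add: h_def)
  qed
  obtain t where "g t \<noteq> g 0" using g(4) by blast
  then have "h (- t) \<noteq> h 0" by (simp add: gh)
  then have ne: "\<exists>t. h t \<noteq> h 0" by (rule exI)
  have rng: "C = range h"
  proof (intro equalityI subsetI)
    fix p assume "p \<in> C"
    then obtain t where "p = h (- t)" unfolding g(5) gh by (rule rangeE)
    then show "p \<in> range h" by simp
  next
    fix p assume "p \<in> range h"
    then obtain t where "p = g (- t)" unfolding h_def by (rule rangeE)
    then show "p \<in> C" unfolding g(5) by simp
  qed
  have "pw_orbit U (\<lambda>p. - X p, \<lambda>p. - Y p) UNIV h"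
    unfolding h_def[abs_def] by (rule pw_orbit_reverse[OF g(1)])
  then show ?thesis
    unfolding periodic_orbit_def by (intro exI[of _ h] exI[of _ T] conjI g(2) per ne rng)
qed

text \<open>Isolation refers to all periodic orbits of the reversed field, so these have to be
  carried back as well; reversing twice restores the original field.\<close>

lemma crossing_limit_cycle_reverse:
  assumes "crossing_limit_cycle U (X, Y) C"
  shows "crossing_limit_cycle U (\<lambda>p. - X p, \<lambda>p. - Y p) C"
proof -
  have undo: "periodic_orbit U (X, Y) C'" if "periodic_orbit U (\<lambda>p. - X p, \<lambda>p. - Y p) C'" for C'
    using periodic_orbit_reverse[OF that] by simp
  have cs: "crossing_set U (\<lambda>p. - X p, \<lambda>p. - Y p) = crossing_set U (X, Y)"
    by (simp add: crossing_set_def)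
  have lc: "limit_cycle U (X, Y) C" using assms unfolding crossing_limit_cycle_def by (rule conjunct1)
  then have per: "periodic_orbit U (\<lambda>p. - X p, \<lambda>p. - Y p) C"
    unfolding limit_cycle_def by (intro periodic_orbit_reverse) (rule conjunct1)
  obtain V where V: "open V" "C \<subseteq> V" "\<forall>C'. periodic_orbit U (X, Y) C' \<and> C' \<subseteq> V \<longrightarrow> C' = C"
    using lc unfolding limit_cycle_def by (elim conjE exE)
  have "\<forall>C'. periodic_orbit U (\<lambda>p. - X p, \<lambda>p. - Y p) C' \<and> C' \<subseteq> V \<longrightarrow> C' = C"
  proof (intro allI impI)
    fix C' assume C': "periodic_orbit U (\<lambda>p. - X p, \<lambda>p. - Y p) C' \<and> C' \<subseteq> V"
    show "C' = C" by (rule V(3)[rule_format, OF conjI[OF undo[OF conjunct1[OF C']] conjunct2[OF C']]])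
  qed
  then have "limit_cycle U (\<lambda>p. - X p, \<lambda>p. - Y p) C"
    unfolding limit_cycle_def by (intro conjI exI[of _ V] per V(1,2))
  then show ?thesis
    using assms unfolding crossing_limit_cycle_def cs by (intro conjI) (elim conjE, assumption)+
qed

text \<open>The profile is taken with a single zero. Since \<open>a_le\<close> forces
  \<open>R\<close> to shrink with \<open>e\<close>, the cycle is found in a ball depending on the
  perturbation, which is enough for existence.\<close>

lemma positive_rotation_cycle:
  assumes U: "open U" "bounded U" "0 \<in> U"
    and XY: "X \<in> C1_fields U" "Y \<in> C1_fields U" "X 0 = 0" "Y 0 = 0"
    and pos: "jacobian X (at 0) $ 2 $ 1 > 0" "jacobian Y (at 0) $ 2 $ 1 > 0"
    and "r > 0" "w > 0"
  obtains E F C where "C1_small U r E" "C1_small U r F"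
    "crossing_limit_cycle U (\<lambda>p. X p + E p, \<lambda>p. Y p + F p) C" "C \<subseteq> ball 0 w"
proof -
  define b1 where "b1 = jacobian X (at 0) $ 2 $ 1"
  define b2 where "b2 = jacobian Y (at 0) $ 2 $ 1"
  define a1 where "a1 = jacobian X (at 0) $ 2 $ 2"
  define a2 where "a2 = jacobian Y (at 0) $ 2 $ 2"
  have b: "b1 > 0" "b2 > 0" using pos by (auto simp: b1_def b2_def)
  \<comment> \<open>The upper perturbation uses e for the normal form, e for the translation and e
    for the profile; the lower one uses 2 e.\<close>
  define e where "e = r / 4"
  have e: "e > 0" using \<open>r > 0\<close> by (simp add: e_def)
  then have nz: "e \<noteq> 0" "- e \<noteq> 0" by auto
  obtain al1 be1 h1 E1 where N1: "h1 > 0" "C1_small U e E1"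
    "\<And>p. norm p \<le> h1 \<Longrightarrow> X p + E1 p = vector [e, 0] +
      half_field (\<lambda>p. 1 + al1 * p $ 1 + be1 * p $ 2) e a1 0 (\<lambda>x. b1 * x) p"
    by (rule normal_form[OF U(1,3) XY(1,3) e nz(1), folded a1_def b1_def]) (rule that)
  obtain al2 be2 h2 F1 where N2: "h2 > 0" "C1_small U e F1"
    "\<And>p. norm p \<le> h2 \<Longrightarrow> Y p + F1 p = vector [- e, 0] +
      half_field (\<lambda>p. 1 + al2 * p $ 1 + be2 * p $ 2) (- e) a2 0 (\<lambda>x. b2 * x) p"
    by (rule normal_form[OF U(1,3) XY(2,4) e nz(2), folded a2_def b2_def]) (rule that)
  define M where "M = 1 + \<bar>a1\<bar> + \<bar>a2\<bar> + \<bar>al1\<bar> + \<bar>be1\<bar> + \<bar>al2\<bar> + \<bar>be2\<bar>"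
  have M: "M > 0" by (simp add: M_def)
  obtain R0 where R0: "R0 > 0" "ball 0 R0 \<subseteq> U" using U open_contains_ball by blast
  \<comment> \<open>\<open>R\<close> stays within both normal form balls, \<open>U\<close> and the
    target ball; the last two bounds give \<open>a_le\<close> and keep the affine factors at least 1
    / 2.\<close>
  define R where "R = min (min h1 h2) (min (min R0 w) (min (e / (4 * M)) (1 / (2 * M))))"
  have R: "R > 0" "R \<le> h1" "R \<le> h2" "R \<le> R0" "R \<le> w" "R \<le> e / (4 * M)" "R \<le> 1 / (2 * M)"
    using N1(1) N2(1) R0(1) \<open>w > 0\<close> e M by (auto simp: R_def)
  have MR: "M * R \<le> e / 4" "M * R \<le> 1 / 2"
    using mult_left_mono[OF R(6), of M] mult_left_mono[OF R(7), of M] M by auto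
  have aR: "\<bar>a1\<bar> * R \<le> e / 4" "\<bar>a2\<bar> * R \<le> e / 4"
  proof -
    have "\<bar>a1\<bar> \<le> M" "\<bar>a2\<bar> \<le> M" by (auto simp: M_def)
    then have "\<bar>a1\<bar> * R \<le> M * R" "\<bar>a2\<bar> * R \<le> M * R" using R(1) by (simp_all add: mult_right_mono)
    then show "\<bar>a1\<bar> * R \<le> e / 4" "\<bar>a2\<bar> * R \<le> e / 4" using MR(1) by linarith+
  qed
  have spos: "1 + x * p $ 1 + y * p $ 2 > 0" if p: "norm p < R" and xy: "\<bar>x\<bar> + \<bar>y\<bar> \<le> M" for x y :: real and p :: "real^2"
  proof -
    have "\<bar>x * p $ 1\<bar> \<le> \<bar>x\<bar> * R" "\<bar>y * p $ 2\<bar> \<le> \<bar>y\<bar> * R"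
      using p component_le_norm_cart[of p 1] component_le_norm_cart[of p 2]
      by (auto simp: abs_mult intro!: mult_left_mono)
    moreover have "\<bar>x\<bar> * R + \<bar>y\<bar> * R \<le> M * R"
      using mult_right_mono[OF xy, of R] R(1) by (simp add: distrib_right)
    ultimately show ?thesis using MR(2) by linarith
  qed
  define Yh where "Yh = R / 4"
  have Yh: "0 < Yh" "Yh < R" using R(1) by (auto simp: Yh_def)
  \<comment> \<open>R / 8 gives 2 d + Y <= R / 2; the bound 1 allows d^2 <= d, so the last bound,
    linear in d, controls both levels.\<close>
  define d where "d = min (R / 8) (min 1 (Yh * e / (4 * (b1 + b2 + 1))))"
  have d: "d > 0" "d \<le> R / 8" "d \<le> 1" "d \<le> Yh * e / (4 * (b1 + b2 + 1))"
  proof -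
    show "d > 0" using R(1) Yh e b by (simp add: d_def)
    show "d \<le> R / 8" "d \<le> 1" "d \<le> Yh * e / (4 * (b1 + b2 + 1))"
      unfolding d_def by (rule min.cobounded1, rule min.coboundedI2[OF min.cobounded1],
        rule min.coboundedI2[OF min.cobounded2])
  qed
  have dd: "b1 * d\<^sup>2 < Yh * e / 2" "2 * b2 * d\<^sup>2 < Yh * e / 2"
  proof -
    have "4 * (b1 + b2 + 1) * d \<le> Yh * e"
      using d(4) b by (simp add: le_divide_eq mult.commute)
    moreover have "d * d \<le> d * 1" using d by (intro mult_left_mono) auto
    then have "b1 * d\<^sup>2 \<le> b1 * d" "b2 * d\<^sup>2 \<le> b2 * d"
      using b by (auto simp: power2_eq_square intro!: mult_left_mono)
    moreover have "b1 * d > 0" "b2 * d > 0" using b d by auto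
    ultimately show "b1 * d\<^sup>2 < Yh * e / 2" "2 * b2 * d\<^sup>2 < Yh * e / 2"
      using d(1) by (auto simp: algebra_simps)
  qed
  obtain D where D: "D > 0" "\<And>p. p \<in> U \<Longrightarrow> norm p \<le> D" using U(2) unfolding bounded_pos by blast
  \<comment> \<open>The factor of \<open>l\<close> in the size bound for the profile; l K <= e keeps
    translation and profile together within 2 e.\<close>
  define K where "K = (D + 1) * (\<bar>b1\<bar> + (\<bar>b1 * al1\<bar> + \<bar>b1 * be1\<bar>) * (D + 1))"
  have K: "K \<ge> 0" using D by (simp add: K_def)
  define l where "l = min (1 / 2) (e / (K + 1))"
  have l: "l > 0" "l \<le> 1 / 2" "l * K \<le> e"
  proof -
    show "l > 0" using e K by (simp add: l_def)
    show "l \<le> 1 / 2" unfolding l_def by (rule min.cobounded1)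
    have "l * K \<le> e / (K + 1) * (K + 1)" using K e by (intro mult_mono) (auto simp: l_def)
    then show "l * K \<le> e" using K by simp
  qed
  have RD: "max R D > 0" using R by simp
  obtain k k1 k2 where k: "\<And>x. (k has_real_derivative k1 x) (at x)"
      "\<And>x. (k1 has_real_derivative k2 x) (at x)" "continuous_on UNIV k2" "\<And>x. x \<le> 0 \<Longrightarrow> k x = 0"
      "\<And>x. \<bar>x\<bar> \<le> max R D \<Longrightarrow> \<bar>k1 x\<bar> \<le> l * \<bar>x\<bar> \<and> \<bar>k2 x\<bar> \<le> l"
      "\<And>x. 0 < x \<Longrightarrow> k x = 0 \<Longrightarrow> x < d \<and> k1 x \<noteq> 0"
      "ecard {x. 0 < x \<and> k x = 0} = 1"
    by (rule perturbation_profile[OF one_neq_zero d(1) RD l(1)]) (rule that)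
  have k1: "\<bar>k1 x\<bar> \<le> \<bar>x\<bar> / 2" if "\<bar>x\<bar> < R" for x
  proof -
    have "l * \<bar>x\<bar> \<le> 1 / 2 * \<bar>x\<bar>" using l(2) by (intro mult_right_mono) auto
    moreover have "\<bar>x\<bar> \<le> max R D" using that by simp
    ultimately show ?thesis using k(5)[of x] by linarith
  qed
  \<comment> \<open>The second component is b1 * k1 times the affine factor that is called
    \<open>s1\<close> below.\<close>
  define E where "E p = E1 p + (vector [- e, k1 (p $ 1) * (b1 + b1 * al1 * p $ 1 + b1 * be1 * p $ 2)] :: real^2)" for p
  define F where "F p = F1 p + (vector [e, 0] :: real^2)" for p
  have "C1_small U (2 * e) (\<lambda>p. vector [- e, k1 (p $ 1) * (b1 + b1 * al1 * p $ 1 + b1 * be1 * p $ 2)])"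
    by (rule perturbation_small[where D = D and l = l and ?k2.0 = k2])
       (use D k l e in \<open>auto simp: K_def mult.assoc\<close>)
  then have Es: "C1_small U r E"
    using C1_small_mono[OF C1_small_add[OF U(1) N1(2)]] e unfolding E_def[abs_def] by (simp add: e_def)
  have "C1_small U e (\<lambda>p. vector [e, 0])" by (rule constant_small) (use U e in auto)
  then have Fs: "C1_small U r F"
    using C1_small_mono[OF C1_small_add[OF U(1) N2(2)]] e unfolding F_def[abs_def] by (simp add: e_def)
  define Z' where "Z' = (\<lambda>p. X p + E p, \<lambda>p. Y p + F p)"
  define s1 where "s1 p = 1 + al1 * p $ 1 + be1 * p $ 2" for p :: "real^2"
  \<comment> \<open>The lower field is described through -p, hence the reversed signs.\<close>
  define s2 where "s2 p = 1 + (- al2) * p $ 1 + (- be2) * p $ 2" for p :: "real^2"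
  have sc: "continuous_on (ball 0 R) s1" "continuous_on (ball 0 R) s2"
    unfolding s1_def[abs_def] s2_def[abs_def] by (intro continuous_intros)+
  have sp: "s1 p > 0" "s2 p > 0" if "norm p < R" for p
    using spos[OF that, of al1 be1] spos[OF that, of "- al2" "- be2"] by (auto simp: s1_def s2_def M_def)
  have ZC: "fst Z' \<in> C1_fields U" "snd Z' \<in> C1_fields U"
    using C1_fields_add(1)[OF U(1)] XY Es Fs by (auto simp: Z'_def C1_small_def)
  have k0: "k 0 = 0" using k(4) by simp
  have z0: "\<bar>0 :: real\<bar> * Yh \<le> e / 2" using e by simp
  note hu = half_plane_profile[OF e Yh aR(1) z0 b(1) k(1) k0 k1 sc(1) sp(1)]
  have hl: "half_plane R e a2 0 Yh (\<lambda>x. b2 * (x\<^sup>2 / 2)) (\<lambda>x. b2 * x) s2"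
    using half_plane_profile[OF e Yh aR(2) z0 b(2), of "\<lambda>_. 0" "\<lambda>_. 0" s2] sc(2) sp(2) by simp
  interpret up: half_plane R e a1 0 Yh "\<lambda>x. b1 * (x\<^sup>2 / 2 + k x)" "\<lambda>x. b1 * (x + k1 x)" s1 by (rule hu)
  interpret lo: half_plane R e a2 0 Yh "\<lambda>x. b2 * (x\<^sup>2 / 2)" "\<lambda>x. b2 * x" s2 by (rule hl)
  interpret perturbed_pair R e a1 a2 0 Yh b1 b2 k k1 s1 s2 U Z' d
  proof
    show "ball 0 R \<subseteq> U" using R0 R(4) by auto
    show "fst Z' p = half_field s1 e a1 0 (\<lambda>x. b1 * (x + k1 x)) p" if p: "norm p < R" for p
    proof -
      have "fst Z' p = (X p + E1 p) + vector [- e, k1 (p $ 1) * (b1 + b1 * al1 * p $ 1 + b1 * be1 * p $ 2)]"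
        by (simp add: Z'_def E_def)
      also have "X p + E1 p = vector [e, 0] + half_field s1 e a1 0 (\<lambda>x. b1 * x) p"
        using N1(3)[of p] p R(2) by (simp add: s1_def[abs_def])
      finally show ?thesis by (simp add: vec_eq_iff forall_2 s1_def algebra_simps)
    qed
    show "snd Z' p = - half_field s2 e a2 0 (\<lambda>x. b2 * x) (- p)" if p: "norm p < R" for p
    proof -
      have "snd Z' p = (Y p + F1 p) + vector [e, 0]" by (simp add: Z'_def F_def)
      also have "Y p + F1 p = vector [- e, 0] + half_field (\<lambda>p. 1 + al2 * p $ 1 + be2 * p $ 2) (- e) a2 0 (\<lambda>x. b2 * x) p"
        using N2(3)[of p] p R(3) by simp
      finally show ?thesis by (simp add: vec_eq_iff forall_2 s2_def algebra_simps)
    qed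
    show "continuous_on (ball 0 R) (fst Z')" "continuous_on (ball 0 R) (snd Z')"
      using C1_field_continuous(1) ZC \<open>ball 0 R \<subseteq> U\<close> continuous_on_subset by blast+
    show "2 * d + Yh < R" using d(2) R(1) by (simp add: Yh_def)
  qed (use b d k k1 dd in auto)
  have S: "{x. 0 < x \<and> x < R \<and> k x = 0} = {x. 0 < x \<and> k x = 0}"
    using k(6) d(2) R(1) by force
  have "ecard {C. crossing_limit_cycle U Z' C \<and> C \<subseteq> ball 0 R} = 1"
    using crossing_limit_cycles(1) k(7) unfolding S by simp
  moreover have "ecard ({} :: (real^2) set set) \<noteq> 1"
    by (simp add: ecard_def one_enat_def)
  ultimately have "{C. crossing_limit_cycle U Z' C \<and> C \<subseteq> ball 0 R} \<noteq> {}" by metis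
  then obtain C where "crossing_limit_cycle U Z' C" "C \<subseteq> ball 0 R" by blast
  moreover have "ball 0 R \<subseteq> (ball 0 w :: (real^2) set)" using R(5) by auto
  ultimately show ?thesis using that[OF Es Fs] unfolding Z'_def by blast
qed

lemma Omega0_bifurcates:
  assumes U: "open U" "bounded U" "0 \<in> U" and Z: "Z \<in> Omega0 U"
  shows "bifurcates_clc U Z"
proof -
  obtain X Y where Z_eq: "Z = (X, Y)" by (cases Z)
  have XY: "X \<in> C1_fields U" "Y \<in> C1_fields U" "X 0 = 0" "Y 0 = 0"
    and sgn: "jacobian X (at 0) $ 2 $ 1 * jacobian Y (at 0) $ 2 $ 1 > 0"
    using Z by (auto simp: Omega0_def Omega_def Z_eq)
  have "\<exists>Z'\<in>N. \<exists>C. crossing_limit_cycle U Z' C \<and> C \<subseteq> W"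
    if NW: "Omega_nbhd U Z N" "open W" "0 \<in> W" for N W
  proof -
    have nb: "Omega_nbhd U (X, Y) N" and ne: "U \<noteq> {}" using NW(1) U(3) by (auto simp: Z_eq)
    obtain r where r: "r > 0" "\<And>E F. C1_small U r E \<Longrightarrow> C1_small U r F \<Longrightarrow> (\<lambda>p. X p + E p, \<lambda>p. Y p + F p) \<in> N"
      by (rule Omega_nbhd_small[OF U(1) ne nb]) (rule that)
    obtain w where w: "w > 0" "ball 0 w \<subseteq> W" using NW(2,3) open_contains_ball by blast
    show ?thesis
    proof (cases "jacobian X (at 0) $ 2 $ 1 > 0")
      case True
      then have pos: "jacobian Y (at 0) $ 2 $ 1 > 0" using sgn by (simp add: zero_less_mult_iff)
      obtain E F C where EFC: "C1_small U r E" "C1_small U r F"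
        "crossing_limit_cycle U (\<lambda>p. X p + E p, \<lambda>p. Y p + F p) C" "C \<subseteq> ball 0 w"
        by (rule positive_rotation_cycle[OF U XY True pos r(1) w(1)]) (rule that)
      show ?thesis
        by (intro bexI[OF _ r(2)[OF EFC(1,2)]] exI[of _ C] conjI EFC(3) order_trans[OF EFC(4) w(2)])
    next
      case False
      then have neg: "jacobian (\<lambda>p. - X p) (at 0) $ 2 $ 1 > 0" "jacobian (\<lambda>p. - Y p) (at 0) $ 2 $ 1 > 0"
        using sgn unfolding C1_fields_minus(2)[OF U(1) XY(1) U(3)] C1_fields_minus(2)[OF U(1) XY(2) U(3)]
        by (auto simp: zero_less_mult_iff)
      have zero: "- X 0 = 0" "- Y 0 = 0" using XY by auto
      obtain E F C where EFC: "C1_small U r E" "C1_small U r F"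
        "crossing_limit_cycle U (\<lambda>p. - X p + E p, \<lambda>p. - Y p + F p) C" "C \<subseteq> ball 0 w"
        by (rule positive_rotation_cycle[OF U C1_fields_minus(1)[OF U(1) XY(1)]
            C1_fields_minus(1)[OF U(1) XY(2)] zero neg r(1) w(1)]) (rule that)
      have "crossing_limit_cycle U (\<lambda>p. X p + - E p, \<lambda>p. Y p + - F p) C"
        using crossing_limit_cycle_reverse[OF EFC(3)] by simp
      then show ?thesis
        by (intro bexI[OF _ r(2)[OF C1_small_minus[OF U(1) EFC(1)] C1_small_minus[OF U(1) EFC(2)]]]
            exI[of _ C] conjI order_trans[OF EFC(4) w(2)])
    qed
  qed
  moreover have "nonsmooth_equilibrium U Z 0"
    unfolding Z_eq using U(3) XY(3,4) by (rule nonsmooth_equilibrium_0)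
  ultimately show ?thesis unfolding bifurcates_clc_def by blast
qed

theorem theorem1p3:
  fixes U :: "(real^2) set"
  assumes "open U" and "bounded U" and "0 \<in> U"
  shows "(\<forall>Z\<in>Omega0 U. bifurcates_clc U Z) \<and>
    (\<exists>Z0\<in>Omega1 U. \<forall>m::enat. m \<noteq> 0 \<longrightarrow> bifurcates_exactly_hyperbolic U Z0 m) \<and>
    (\<exists>Z0\<in>Omega0 U - Omega1 U. \<forall>m::enat. m \<noteq> 0 \<longrightarrow> bifurcates_exactly_hyperbolic U Z0 m)"
proof -
  let ?S = "vector [vector [0, 1], vector [1, 0]] :: real^2^2"
  let ?C = "vector [vector [0, - 1], vector [1, 0]] :: real^2^2"
  have "bifurcates_exactly_hyperbolic U ((\<lambda>p. ?S *v p), (\<lambda>p. ?S *v p)) m" if "m \<noteq> 0" for m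
    using linear_center_saddle_bifurcates[OF assms, of "- 1" m] that by simp
  moreover have "bifurcates_exactly_hyperbolic U ((\<lambda>p. ?C *v p), (\<lambda>p. ?C *v p)) m" if "m \<noteq> 0" for m
    using linear_center_saddle_bifurcates[OF assms, of 1 m] that by simp
  ultimately show ?thesis
    using Omega0_bifurcates[OF assms] saddle_in_Omega1 center_in_Omega0_minus_Omega1
    by (intro conjI ballI bexI allI impI)
qed

end
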